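(* The decision problem Bounded-Two-Stage$(\mathcal{X}_d,\mathcal{U}_c(x),\mathcal{Y}_d)$ is in $\Sigma_3^p$.
   Context: An instance consists of rational data encoded in binary: a bound $R\in\mathbb{Z}_+$, vectors $a\in\mathbb{Q}^{m_x}$, $b\in\mathbb{Q}^{m_u}$, matrices $A\in\mathbb{Q}^{m_x\times n_x}$, $W\in\mathbb{Q}^{m_y\times n_y}$, an $m_u\times n_u$ matrix $B(x)$ whose entries depend linearly on $x$ with rational coefficients, and an $m_y\times n_x$ matrix $T(u)$ whose entries depend linearly on $u$ with rational coefficients. Let $\mathcal{X}_d=\{x\in[0,R]^{n_x}\cap\mathbb{Z}^{n_x}: Ax\le a\}$, $\mathcal{U}_c(x)=\{u\in[0,R]^{n_u}: B(x)u\le b\}$, $\mathcal{Y}_d(x,u)=\{y\in[0,R]^{n_y}\cap\mathbb{Z}^{n_y}: T(u)x+Wy\le 0\}$. Bounded-Two-Stage$(\mathcal{X}_d,\mathcal{U}_c(x),\mathcal{Y}_d)$ is the decision problem $$\exists x\in\mathcal{X}_d\ \ \forall u\in\mathcal{U}_c(x)\ \ \exists y\in\mathcal{Y}_d(x,u)\,?$$ $\Sigma_3^p$ is the class of problems expressible as $\exists X\,\forall Y\,\exists Z: P(I,X,Y,Z)$, where $I$ is the instance, $X,Y,Z$ range over objects of encoding length polynomial in that of $I$, and $P$ is decidable in polynomial time. *)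

theory Defs
  imports
    Complex_Main
    "HOL-Computational_Algebra.Polynomial"
    "Jordan_Normal_Form.Matrix"
begin

section \<open>Deterministic multi-tape Turing machines\<close>

datatype move = MoveLeft | Stay | MoveRight

fun shift :: "move \<Rightarrow> int" where
  "shift MoveLeft = - 1"
| "shift Stay = 0"
| "shift MoveRight = 1"

text \<open>
  The states are \<open>0, \<dots>, num_states - 1\<close>, with initial state 0, and the tape symbols are
  \<open>0, \<dots>, num_symbols - 1\<close>. Symbol 0 is the blank, 1 and 2 stand for the bits 0 and 1, and
  3 is a separator. In one step, the machine in state \<open>q\<close> that reads the symbols \<open>ss\<close> (one per
  tape) enters the first component of \<open>trans q ss\<close> and on each tape writes a symbol and moves.
\<close>

record turing_machine =
  num_tapes :: nat
  num_states :: nat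
  num_symbols :: nat
  accept_state :: nat
  reject_state :: nat
  trans :: "nat \<Rightarrow> nat list \<Rightarrow> nat \<times> (nat \<times> move) list"

definition wf_turing_machine :: "turing_machine \<Rightarrow> bool" where
  "wf_turing_machine M \<longleftrightarrow>
     1 \<le> num_tapes M \<and> 4 \<le> num_symbols M \<and>
     0 < num_states M \<and> accept_state M < num_states M \<and> reject_state M < num_states M \<and>
     accept_state M \<noteq> reject_state M \<and>
     (\<forall>q ss. q < num_states M \<and> length ss = num_tapes M \<and> set ss \<subseteq> {..<num_symbols M} \<longrightarrow>
        fst (trans M q ss) < num_states M \<and>
        length (snd (trans M q ss)) = num_tapes M \<and>
        (\<forall>(s, d) \<in> set (snd (trans M q ss)). s < num_symbols M))"

text \<open>A tape is infinite in both directions and is given by its content and its head position.\<close>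

type_synonym tape = "(int \<Rightarrow> nat) \<times> int"

type_synonym config = "nat \<times> tape list"

fun read_tape :: "tape \<Rightarrow> nat" where
  "read_tape (f, i) = f i"

fun act_tape :: "tape \<Rightarrow> nat \<times> move \<Rightarrow> tape" where
  "act_tape (f, i) (s, d) = (f(i := s), i + shift d)"

fun tm_step :: "turing_machine \<Rightarrow> config \<Rightarrow> config" where
  "tm_step M (q, ts) =
     (if q = accept_state M \<or> q = reject_state M then (q, ts)
      else let (q', acts) = trans M q (map read_tape ts) in (q', map2 act_tape ts acts))"

definition blank_tape :: tape where
  "blank_tape = (\<lambda>_. 0, 0)"

definition input_tape :: "nat list \<Rightarrow> tape" where
  "input_tape w = (\<lambda>i. if 0 \<le> i \<and> i < int (length w) then w ! nat i else 0, 0)"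

definition tm_init :: "turing_machine \<Rightarrow> nat list \<Rightarrow> config" where
  "tm_init M w = (0, input_tape w # replicate (num_tapes M - 1) blank_tape)"

definition tm_state_after :: "turing_machine \<Rightarrow> nat list \<Rightarrow> nat \<Rightarrow> nat" where
  "tm_state_after M w t = fst ((tm_step M ^^ t) (tm_init M w))"


section \<open>Polynomial time and the class $\Sigma_3^p$\<close>

fun bit_symbol :: "bool \<Rightarrow> nat" where
  "bit_symbol False = 1"
| "bit_symbol True = 2"

text \<open>The tuple of bit strings $w_1, \dots, w_k$ is written as $w_1 \# w_2 \# \dots \# w_k \#$.\<close>

definition tuple_input :: "bool list list \<Rightarrow> nat list" where
  "tuple_input ws = concat (map (\<lambda>w. map bit_symbol w @ [3]) ws)"

definition poly_time_decidable :: "nat \<Rightarrow> (bool list list \<Rightarrow> bool) \<Rightarrow> bool" where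
  "poly_time_decidable k P \<longleftrightarrow>
     (\<exists>M (p :: nat poly). wf_turing_machine M \<and>
        (\<forall>ws. length ws = k \<longrightarrow>
           tm_state_after M (tuple_input ws) (poly p (length (tuple_input ws))) =
             (if P ws then accept_state M else reject_state M)))"

definition Sigma3p :: "bool list set set" where
  "Sigma3p = {L. \<exists>P (p :: nat poly). poly_time_decidable 4 P \<and>
     (\<forall>w. w \<in> L \<longleftrightarrow>
        (\<exists>X. length X \<le> poly p (length w) \<and>
          (\<forall>Y. length Y \<le> poly p (length w) \<longrightarrow>
            (\<exists>Z. length Z \<le> poly p (length w) \<and> P [w, X, Y, Z]))))}"


section \<open>Instances and the decision problem\<close>

text \<open>
  The matrix $B(x)$ is given by the coefficient matrices $B_0, \dots, B_{n_x - 1}$ with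
  $B(x) = \sum_k x_k B_k$, and likewise $T(u) = \sum_k u_k T_k$.
\<close>

record two_stage =
  bound :: nat
  nx :: nat
  nu :: nat
  ny :: nat
  mx :: nat
  mu :: nat
  my :: nat
  vec_a :: "rat vec"
  vec_b :: "rat vec"
  mat_A :: "rat mat"
  mat_W :: "rat mat"
  coeffs_B :: "rat mat list"
  coeffs_T :: "rat mat list"

definition wf_two_stage :: "two_stage \<Rightarrow> bool" where
  "wf_two_stage I \<longleftrightarrow>
     vec_a I \<in> carrier_vec (mx I) \<and>
     vec_b I \<in> carrier_vec (mu I) \<and>
     mat_A I \<in> carrier_mat (mx I) (nx I) \<and>
     mat_W I \<in> carrier_mat (my I) (ny I) \<and>
     length (coeffs_B I) = nx I \<and> set (coeffs_B I) \<subseteq> carrier_mat (mu I) (nu I) \<and>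
     length (coeffs_T I) = nu I \<and> set (coeffs_T I) \<subseteq> carrier_mat (my I) (nx I)"

definition linear_mat :: "nat \<Rightarrow> nat \<Rightarrow> rat mat list \<Rightarrow> real vec \<Rightarrow> real mat" where
  "linear_mat m n Cs v = mat m n (\<lambda>(i, j). \<Sum>k<length Cs. v $ k * of_rat ((Cs ! k) $$ (i, j)))"

definition mat_B :: "two_stage \<Rightarrow> real vec \<Rightarrow> real mat" where
  "mat_B I x = linear_mat (mu I) (nu I) (coeffs_B I) x"

definition mat_T :: "two_stage \<Rightarrow> real vec \<Rightarrow> real mat" where
  "mat_T I u = linear_mat (my I) (nx I) (coeffs_T I) u"

definition box :: "nat \<Rightarrow> nat \<Rightarrow> real vec set" where
  "box n r = {v \<in> carrier_vec n. \<forall>i<n. 0 \<le> v $ i \<and> v $ i \<le> real r}"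

definition int_vecs :: "nat \<Rightarrow> real vec set" where
  "int_vecs n = {v \<in> carrier_vec n. \<forall>i<n. v $ i \<in> \<int>}"

definition X_d :: "two_stage \<Rightarrow> real vec set" where
  "X_d I = {x \<in> box (nx I) (bound I) \<inter> int_vecs (nx I).
     map_mat of_rat (mat_A I) *\<^sub>v x \<le> map_vec of_rat (vec_a I)}"

definition U_c :: "two_stage \<Rightarrow> real vec \<Rightarrow> real vec set" where
  "U_c I x = {u \<in> box (nu I) (bound I). mat_B I x *\<^sub>v u \<le> map_vec of_rat (vec_b I)}"

definition Y_d :: "two_stage \<Rightarrow> real vec \<Rightarrow> real vec \<Rightarrow> real vec set" where
  "Y_d I x u = {y \<in> box (ny I) (bound I) \<inter> int_vecs (ny I).
     mat_T I u *\<^sub>v x + map_mat of_rat (mat_W I) *\<^sub>v y \<le> 0\<^sub>v (my I)}"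

definition bounded_two_stage :: "two_stage \<Rightarrow> bool" where
  "bounded_two_stage I \<longleftrightarrow> (\<exists>x\<in>X_d I. \<forall>u\<in>U_c I x. \<exists>y. y \<in> Y_d I x u)"


section \<open>Binary encoding of instances\<close>

text \<open>
  Each object is assigned the set of bit strings that encode it. A natural number is encoded by
  its binary digits (least significant first), each preceded by the bit 1, and a final bit 0;
  leading zeros are allowed. A rational is encoded by a numerator and a positive denominator, not
  necessarily in lowest terms. The dimensions are encoded in unary, so that a code is at least as
  long as the vectors it speaks about, even for a matrix with no rows; if all dimensions are
  positive, then they are bounded by the number of entries anyway.
\<close>

definition unary_code :: "nat \<Rightarrow> bool list" where
  "unary_code n = replicate n True @ [False]"

definition nat_codes :: "nat \<Rightarrow> bool list set" where
  "nat_codes n = {concat (map (\<lambda>d. [True, d]) ds) @ [False] | ds. horner_sum of_bool 2 ds = n}"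

definition int_codes :: "int \<Rightarrow> bool list set" where
  "int_codes z = {s # c | s c. c \<in> nat_codes (nat \<bar>z\<bar>) \<and> (z \<noteq> 0 \<longrightarrow> s = (z < 0))}"

definition rat_codes :: "rat \<Rightarrow> bool list set" where
  "rat_codes r = {c @ d | c d p q. c \<in> int_codes p \<and> d \<in> nat_codes q \<and> 0 < q \<and> r = Fract p (int q)}"

definition rat_list_codes :: "rat list \<Rightarrow> bool list set" where
  "rat_list_codes rs = {concat cs | cs. list_all2 (\<lambda>c r. c \<in> rat_codes r) cs rs}"

definition mat_entries :: "rat mat \<Rightarrow> rat list" where
  "mat_entries C = concat (mat_to_list C)"

definition two_stage_entries :: "two_stage \<Rightarrow> rat list" where
  "two_stage_entries I =
     list_of_vec (vec_a I) @ list_of_vec (vec_b I) @ mat_entries (mat_A I) @ mat_entries (mat_W I) @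
     concat (map mat_entries (coeffs_B I)) @ concat (map mat_entries (coeffs_T I))"

definition two_stage_codes :: "two_stage \<Rightarrow> bool list set" where
  "two_stage_codes I =
     {concat (map unary_code [nx I, nu I, ny I, mx I, mu I, my I]) @ c @ d | c d.
        c \<in> nat_codes (bound I) \<and> d \<in> rat_list_codes (two_stage_entries I)}"

definition Bounded_Two_Stage :: "bool list set" where
  "Bounded_Two_Stage = {w. \<exists>I. wf_two_stage I \<and> w \<in> two_stage_codes I \<and> bounded_two_stage I}"

end

theory Submission
  imports Defs "Jordan_Normal_Form.Determinant"
begin

text \<open>
  For fixed \<open>x\<close>, a scenario \<open>u\<close> is bad if and only if for every integer \<open>y\<close> in the box some row of
  $T(u) x + W y$ is positive. Choose such a row for every \<open>y\<close>; for each row only the least value of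
  $W y$ matters, so that the bad scenarios with this choice are the solutions of polynomially many linear
  inequalities, some of them strict, with coefficients of polynomial size. Bound the strict inequalities
  away from equality by an additional variable and move to a feasible point with as many tight constraints
  as possible. It is determined by these constraints, and Cramer's rule for their Gram matrix bounds
  its common denominator. Hence \<open>u\<close> may be restricted to rational vectors of polynomial size, and
  \<open>x\<close>, \<open>u\<close>, \<open>y\<close> themselves are the certificates.

  That the certificates can be checked in polynomial time is shown through a language of structured
  programs over stacks of symbols, which are compiled to Turing machines. The functions that such
  programs compute in polynomial time are closed under composition, pairing, case distinction and loops
  with polynomially bounded intermediate results, so that the verifier can be written as an ordinary
  function on lists of bits.
\<close>

section \<open>Structured stack programs and their compilation to Turing machines\<close>

text \<open>Only the middle quantifier ranges over a continuum, so only there do short certificates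
  need an argument: a universal player confined to short rational \<open>u\<close> must still find a
  counterexample whenever a real one exists. The obstacle is that badness of \<open>u\<close> is an
  exponentially large conjunction over \<open>y\<close> of disjunctions of strict inequalities.
  Fixing one violated row per \<open>y\<close> removes the disjunctions; and since the coefficients
  of \<open>u\<close> in a row do not depend on \<open>y\<close>, all inequalities that fall to one
  row follow from the tightest of them. As \<open>x\<close> and \<open>y\<close> are integral and
  lie in a box whose side is written in binary, one multiplier, the product of all denominators of
  the instance, makes all coefficients and right-hand sides integers without leaving polynomial
  length. The Gram matrix is square and nonsingular without a choice of independent tight rows; it
  squares the size of the entries, which is harmless.\<close>

type_synonym stacks = "nat \<Rightarrow> nat list"

text \<open>An empty stack shows the blank 0, as does a head that stands past the content of its
  tape.\<close>

definition top_symbol :: "nat list \<Rightarrow> nat" where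
  "top_symbol l = (case l of [] \<Rightarrow> 0 | a # _ \<Rightarrow> a)"

lemma top_symbol_simps [simp]: "top_symbol [] = 0" "top_symbol (a # l) = a"
  by (auto simp: top_symbol_def)

datatype cmd =
    Push nat nat
  | Pop nat
  | Seq cmd cmd (infixr ";;" 60)
  | IfTop nat "nat set" cmd cmd
  | WhileTop nat "nat set" cmd

text \<open>The times are the exact step counts of the compiled code: a push moves and then writes,
  a taken branch ends with a jump over the other one, and a loop iteration adds its test and its
  back jump.\<close>

inductive exec :: "cmd \<Rightarrow> stacks \<Rightarrow> nat \<Rightarrow> stacks \<Rightarrow> bool" where
  exec_Push: "exec (Push k a) s 2 (s(k := a # s k))"
| exec_Pop: "exec (Pop k) s 1 (s(k := tl (s k)))"
| exec_Seq: "exec c1 s t1 s1 \<Longrightarrow> exec c2 s1 t2 s2 \<Longrightarrow> exec (c1 ;; c2) s (t1 + t2) s2"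
| exec_IfT: "top_symbol (s k) \<in> S \<Longrightarrow> exec c1 s t s1 \<Longrightarrow> exec (IfTop k S c1 c2) s (t + 2) s1"
| exec_IfF: "top_symbol (s k) \<notin> S \<Longrightarrow> exec c2 s t s1 \<Longrightarrow> exec (IfTop k S c1 c2) s (t + 1) s1"
| exec_WhileF: "top_symbol (s k) \<notin> S \<Longrightarrow> exec (WhileTop k S c) s 1 s"
| exec_WhileT: "top_symbol (s k) \<in> S \<Longrightarrow> exec c s t1 s1 \<Longrightarrow> exec (WhileTop k S c) s1 t2 s2 \<Longrightarrow>
    exec (WhileTop k S c) s (t1 + t2 + 2) s2"

fun wf_cmd :: "cmd \<Rightarrow> bool" where
  "wf_cmd (Push k a) \<longleftrightarrow> k < 4 \<and> a < 4"
| "wf_cmd (Pop k) \<longleftrightarrow> k < 4"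
| "wf_cmd (c1 ;; c2) \<longleftrightarrow> wf_cmd c1 \<and> wf_cmd c2"
| "wf_cmd (IfTop k S c1 c2) \<longleftrightarrow> k < 4 \<and> wf_cmd c1 \<and> wf_cmd c2"
| "wf_cmd (WhileTop k S c) \<longleftrightarrow> k < 4 \<and> wf_cmd c"

text \<open>Only a push lengthens a stack. Through this bound the running time of a program also
  limits the size of its result.\<close>

lemma exec_length: "exec c s t s' \<Longrightarrow> length (s' k) \<le> length (s k) + t"
  by (induction rule: exec.induct) auto

section \<open>Compilation to single-step instructions\<close>

datatype instr =
    ILeft nat
  | IWrite nat nat
  | IRight nat
  | IJumpUnless nat "nat set" nat
  | IJump nat

fun code_size :: "cmd \<Rightarrow> nat" where
  "code_size (Push k a) = 2"
| "code_size (Pop k) = 1"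
| "code_size (c1 ;; c2) = code_size c1 + code_size c2"
| "code_size (IfTop k S c1 c2) = code_size c1 + code_size c2 + 2"
| "code_size (WhileTop k S c) = code_size c + 2"

text \<open>Jump targets are absolute, so the address \<open>n\<close> of the first instruction is a
  parameter. The address of an instruction serves as the machine state.\<close>

fun compile :: "cmd \<Rightarrow> nat \<Rightarrow> instr list" where
  "compile (Push k a) n = [ILeft k, IWrite k a]"
| "compile (Pop k) n = [IRight k]"
| "compile (c1 ;; c2) n = compile c1 n @ compile c2 (n + code_size c1)"
| "compile (IfTop k S c1 c2) n =
     IJumpUnless k S (n + code_size c1 + 2) # compile c1 (n + 1) @
     IJump (n + code_size c1 + code_size c2 + 2) # compile c2 (n + code_size c1 + 2)"
| "compile (WhileTop k S c) n =
     IJumpUnless k S (n + code_size c + 2) # compile c (n + 1) @ [IJump n]"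

lemma length_compile [simp]: "length (compile c n) = code_size c"
  by (induction c arbitrary: n) auto

fun wf_instr :: "nat \<Rightarrow> instr \<Rightarrow> bool" where
  "wf_instr N (ILeft k) \<longleftrightarrow> k < 4"
| "wf_instr N (IWrite k a) \<longleftrightarrow> k < 4 \<and> a < 4"
| "wf_instr N (IRight k) \<longleftrightarrow> k < 4"
| "wf_instr N (IJumpUnless k S m) \<longleftrightarrow> k < 4 \<and> m \<le> N"
| "wf_instr N (IJump m) \<longleftrightarrow> m \<le> N"

lemma wf_compile:
  "wf_cmd c \<Longrightarrow> n + code_size c \<le> N \<Longrightarrow> i \<in> set (compile c n) \<Longrightarrow> wf_instr N i"
proof (induction c arbitrary: n)
  case (Seq c1 c2)
  then show ?case by (force simp: add.assoc)
next
  case (IfTop k S c1 c2)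
  from IfTop.prems(3) consider "i = IJumpUnless k S (n + code_size c1 + 2)" | "i \<in> set (compile c1 (n + 1))"
    | "i = IJump (n + code_size c1 + code_size c2 + 2)" | "i \<in> set (compile c2 (n + code_size c1 + 2))"
    by auto
  then show ?case using IfTop.prems IfTop.IH(1)[of "n+1"] IfTop.IH(2)[of "n + code_size c1 + 2"]
    by cases (auto simp: algebra_simps)
next
  case (WhileTop k S c)
  then show ?case using WhileTop.IH[of "n+1"] by auto
qed auto

definition acts_at :: "nat list \<Rightarrow> nat \<Rightarrow> nat \<times> move \<Rightarrow> (nat \<times> move) list" where
  "acts_at ss k a = (map (\<lambda>x. (x, Stay)) ss)[k := a]"

fun instr_trans :: "instr \<Rightarrow> nat \<Rightarrow> nat list \<Rightarrow> nat \<times> (nat \<times> move) list" where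
  "instr_trans (ILeft k) q ss = (q + 1, acts_at ss k (ss ! k, MoveLeft))"
| "instr_trans (IWrite k a) q ss = (q + 1, acts_at ss k (a, Stay))"
| "instr_trans (IRight k) q ss = (q + 1, acts_at ss k (ss ! k, MoveRight))"
| "instr_trans (IJumpUnless k S m) q ss = (if ss ! k \<in> S then q + 1 else m, map (\<lambda>x. (x, Stay)) ss)"
| "instr_trans (IJump m) q ss = (m, map (\<lambda>x. (x, Stay)) ss)"

text \<open>The last instruction falls through to the accepting state \<open>length P\<close> or jumps to the
  rejecting state \<open>length P + 1\<close>.\<close>

definition machine_code :: "cmd \<Rightarrow> instr list" where
  "machine_code c = compile c 0 @ [IJumpUnless 0 {2} (code_size c + 2)]"

definition machine :: "instr list \<Rightarrow> turing_machine" where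
  "machine P = \<lparr>num_tapes = 4, num_states = length P + 2, num_symbols = 4,
     accept_state = length P, reject_state = length P + 1,
     trans = (\<lambda>q ss. if q < length P then instr_trans (P ! q) q ss else (0, map (\<lambda>x. (x, Stay)) ss))\<rparr>"

lemma acts_at_wf:
  assumes "set ss \<subseteq> {..<4}" "a < 4"
  shows "\<forall>(s, d)\<in>set (acts_at ss k (a, e)). s < 4"
proof -
  have "set (acts_at ss k (a, e)) \<subseteq> insert (a, e) ((\<lambda>x. (x, Stay)) ` set ss)"
    unfolding acts_at_def using set_update_subset_insert by fastforce
  then show ?thesis using assms by force
qed

lemma wf_machine:
  assumes "\<forall>i\<in>set P. wf_instr (length P + 1) i"
  shows "wf_turing_machine (machine P)"
proof -
  have 1: "fst (instr_trans (P ! q) q ss) < length P + 2 \<and>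
      length (snd (instr_trans (P ! q) q ss)) = 4 \<and>
      (\<forall>(s, d)\<in>set (snd (instr_trans (P ! q) q ss)). s < 4)"
    if "q < length P" "length ss = 4" "set ss \<subseteq> {..<4}" for q ss
  proof -
    have i: "wf_instr (length P + 1) (P ! q)"
      using assms that(1) by auto
    have nth: "ss ! k < 4" if "k < 4" for k
      using \<open>length ss = 4\<close> \<open>set ss \<subseteq> {..<4}\<close> that nth_mem[of k ss] by (metis lessThan_iff subsetD)
    have st: "\<forall>(s, d)\<in>set (map (\<lambda>x. (x, Stay)) ss). s < 4" using that by auto
    show ?thesis
    proof (cases "P ! q")
      case (ILeft k)
      then show ?thesis using i that acts_at_wf[OF that(3) nth] by (auto simp: acts_at_def)
    next
      case (IWrite k a)
      then show ?thesis using i that acts_at_wf[OF that(3), of a k Stay] by (auto simp: acts_at_def)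
    next
      case (IRight k)
      then show ?thesis using i that acts_at_wf[OF that(3) nth] by (auto simp: acts_at_def)
    qed (use i that st in \<open>auto split: if_splits\<close>)
  qed
  then show ?thesis
    unfolding wf_turing_machine_def machine_def by (fastforce split: if_splits)
qed

section \<open>Stacks as tape contents\<close>

definition tape_rep :: "tape \<Rightarrow> nat list \<Rightarrow> bool" where
  "tape_rep t l \<longleftrightarrow> (\<forall>n. fst t (snd t + int n) = (if n < length l then l ! n else 0))"

definition tapes_rep :: "tape list \<Rightarrow> stacks \<Rightarrow> bool" where
  "tapes_rep ts s \<longleftrightarrow> length ts = 4 \<and> (\<forall>k<4. tape_rep (ts ! k) (s k))"

lemma tape_rep_read: "tape_rep t l \<Longrightarrow> read_tape t = top_symbol l"
  unfolding tape_rep_def by (cases t; cases l) (auto dest: spec[of _ 0])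

lemma tape_rep_push:
  "tape_rep (f, i) l \<Longrightarrow> tape_rep (f(i - 1 := a), i - 1) (a # l)"
  unfolding tape_rep_def
proof (intro allI)
  fix n
  assume *: "\<forall>n. fst (f, i) (snd (f, i) + int n) = (if n < length l then l ! n else 0)"
  show "fst (f(i - 1 := a), i - 1) (snd (f(i - 1 := a), i - 1) + int n) =
    (if n < length (a # l) then (a # l) ! n else 0)"
  proof (cases n)
    case (Suc m)
    have "i - 1 + int n = i + int m" using Suc by simp
    then show ?thesis using *[rule_format, of m] Suc by simp
  qed simp
qed

text \<open>\<open>tape_rep\<close> says nothing about the cells left of the head, so a popped
  symbol need not be erased; a later push overwrites it.\<close>

lemma tape_rep_pop:
  "tape_rep (f, i) l \<Longrightarrow> tape_rep (f, i + 1) (tl l)"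
  unfolding tape_rep_def
proof (intro allI)
  fix n
  assume *: "\<forall>n. fst (f, i) (snd (f, i) + int n) = (if n < length l then l ! n else 0)"
  show "fst (f, i + 1) (snd (f, i + 1) + int n) = (if n < length (tl l) then tl l ! n else 0)"
    using *[rule_format, of "Suc n"] by (cases l) (auto simp: algebra_simps)
qed

lemma map2_stay: "map2 act_tape ts (map (\<lambda>x. (x, Stay)) (map read_tape ts)) = ts"
  by (rule nth_equalityI) (auto simp: split: prod.split, case_tac "ts ! i", auto)

lemma map2_acts_at:
  assumes "k < length ts"
  shows "map2 act_tape ts (acts_at (map read_tape ts) k a) = ts[k := act_tape (ts ! k) a]"
proof (rule nth_equalityI)
  fix i assume "i < length (map2 act_tape ts (acts_at (map read_tape ts) k a))"
  then have i: "i < length ts" by (simp add: acts_at_def)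
  obtain f j where fj: "ts ! i = (f, j)" by (cases "ts ! i")
  show "map2 act_tape ts (acts_at (map read_tape ts) k a) ! i = ts[k := act_tape (ts ! k) a] ! i"
    using i assms fj by (cases "i = k") (auto simp: acts_at_def)
qed (simp add: acts_at_def)

definition code_at :: "instr list \<Rightarrow> nat \<Rightarrow> instr list \<Rightarrow> bool" where
  "code_at P n is \<longleftrightarrow> (\<exists>as bs. P = as @ is @ bs \<and> length as = n)"

lemma code_at_Cons: "code_at P n (i # is) \<Longrightarrow> n < length P \<and> P ! n = i \<and> code_at P (n + 1) is"
  unfolding code_at_def
proof (elim exE conjE)
  fix as bs assume "P = as @ (i # is) @ bs" "length as = n"
  then have "P = (as @ [i]) @ is @ bs" "length (as @ [i]) = n + 1" "n < length P" "P ! n = i" by auto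
  then show "n < length P \<and> P ! n = i \<and> (\<exists>as bs. P = as @ is @ bs \<and> length as = n + 1)" by blast
qed

lemma code_at_append: "code_at P n (is @ js) \<Longrightarrow> code_at P n is \<and> code_at P (n + length is) js"
  unfolding code_at_def
proof (elim exE conjE)
  fix as bs assume "P = as @ (is @ js) @ bs" "length as = n"
  then have "P = as @ is @ (js @ bs)" "P = (as @ is) @ js @ bs" "length (as @ is) = n + length is" by auto
  then show "(\<exists>as bs. P = as @ is @ bs \<and> length as = n) \<and> (\<exists>as bs. P = as @ js @ bs \<and> length as = n + length is)"
    using \<open>length as = n\<close> by blast
qed

lemma machine_step:
  assumes "n < length P"
  shows "tm_step (machine P) (n, ts) =
    (let (q', acts) = instr_trans (P ! n) n (map read_tape ts) in (q', map2 act_tape ts acts))"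
  using assms by (simp add: machine_def)

lemma machine_act:
  assumes "n < length P" "k < length ts"
    "instr_trans (P ! n) n (map read_tape ts) = (n + 1, acts_at (map read_tape ts) k a)"
  shows "tm_step (machine P) (n, ts) = (n + 1, ts[k := act_tape (ts ! k) a])"
  unfolding machine_step[OF assms(1)] assms(3) by (simp add: map2_acts_at[OF assms(2)])

lemma machine_jump:
  assumes "n < length P" "P ! n = IJump m"
  shows "(tm_step (machine P) ^^ 1) (n, ts) = (m, ts)"
  using machine_step[OF assms(1), of ts] assms(2) map2_stay[of ts] by simp

lemma machine_jump_unless:
  assumes "n < length P" "P ! n = IJumpUnless k S m" "k < 4" "tapes_rep ts s"
  shows "(tm_step (machine P) ^^ 1) (n, ts) = (if top_symbol (s k) \<in> S then n + 1 else m, ts)"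
proof -
  have "read_tape (ts ! k) = top_symbol (s k)" "k < length ts"
    using assms(3,4) tape_rep_read by (auto simp: tapes_rep_def)
  then show ?thesis using machine_step[OF assms(1), of ts] assms(2) map2_stay[of ts] by simp
qed

lemma funpow_trans: "(f ^^ m) x = y \<Longrightarrow> (f ^^ n) y = z \<Longrightarrow> (f ^^ (m + n)) x = z"
  by (metis add.commute comp_apply funpow_add)

text \<open>Induction on the execution, for code at any address of any program, since a subcommand
  is compiled inside a larger one.\<close>

lemma exec_machine:
  "exec c s t s' \<Longrightarrow> wf_cmd c \<Longrightarrow> code_at P n (compile c n) \<Longrightarrow> tapes_rep ts s \<Longrightarrow>
   \<exists>ts'. (tm_step (machine P) ^^ t) (n, ts) = (n + code_size c, ts') \<and> tapes_rep ts' s'"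
proof (induction arbitrary: n ts rule: exec.induct)
  case (exec_Push k a s)
  obtain f i where fi: "ts ! k = (f, i)" by (cases "ts ! k")
  have len: "length ts = 4" and k: "k < 4" using exec_Push by (auto simp: tapes_rep_def)
  have P: "n < length P" "P ! n = ILeft k" "Suc n < length P" "P ! Suc n = IWrite k a"
    using code_at_Cons[of P n "ILeft k" "[IWrite k a]"] code_at_Cons[of P "n + 1" "IWrite k a" "[]"] exec_Push.prems
    by auto
  let ?ts = "ts[k := act_tape (ts ! k) (map read_tape ts ! k, MoveLeft)]"
  have s1: "tm_step (machine P) (n, ts) = (Suc n, ?ts)"
    using machine_act[OF P(1), of k ts] k len P(2) by simp
  have s2: "tm_step (machine P) (Suc n, ?ts) = (Suc (Suc n), ?ts[k := act_tape (?ts ! k) (a, Stay)])"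
    using machine_act[OF P(3), of k ?ts] k len P(4) by simp
  have eq: "?ts[k := act_tape (?ts ! k) (a, Stay)] = ts[k := (f(i - 1 := a), i - 1)]"
    using k len fi by auto
  have "tapes_rep (ts[k := (f(i - 1 := a), i - 1)]) (s(k := a # s k))"
    using exec_Push.prems(3) k fi tape_rep_push unfolding tapes_rep_def
    by (auto simp: nth_list_update)
  moreover have "(tm_step (machine P) ^^ 2) (n, ts) = (n + code_size (Push k a), ts[k := (f(i - 1 := a), i - 1)])"
    using s1 s2 unfolding eq by (simp add: numeral_2_eq_2 del: tm_step.simps)
  ultimately show ?case by blast
next
  case (exec_Pop k s)
  obtain f i where fi: "ts ! k = (f, i)" by (cases "ts ! k")
  have len: "length ts = 4" and k: "k < 4" using exec_Pop by (auto simp: tapes_rep_def)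
  have P: "n < length P" "P ! n = IRight k"
    using exec_Pop.prems by (auto simp: code_at_Cons)
  let ?ts = "ts[k := act_tape (ts ! k) (map read_tape ts ! k, MoveRight)]"
  have s1: "tm_step (machine P) (n, ts) = (Suc n, ?ts)"
    using machine_act[OF P(1), of k ts] k len P(2) by simp
  have eq: "?ts = ts[k := (f, i + 1)]"
    using k len fi by auto
  have "tapes_rep (ts[k := (f, i + 1)]) (s(k := tl (s k)))"
    using exec_Pop.prems(3) k fi tape_rep_pop unfolding tapes_rep_def
    by (auto simp: nth_list_update)
  moreover have "(tm_step (machine P) ^^ 1) (n, ts) = (n + code_size (Pop k), ts[k := (f, i + 1)])"
    using s1 unfolding eq by (simp del: tm_step.simps)
  ultimately show ?case by blast
next
  case (exec_Seq c1 s t1 s1 c2 t2 s2)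
  then have w: "wf_cmd c1" "wf_cmd c2" "code_at P n (compile c1 n)"
    "code_at P (n + code_size c1) (compile c2 (n + code_size c1))"
    by (auto dest!: code_at_append)
  obtain ts1 where 1: "(tm_step (machine P) ^^ t1) (n, ts) = (n + code_size c1, ts1)" "tapes_rep ts1 s1"
    using exec_Seq.IH(1)[OF w(1,3)] exec_Seq.prems by blast
  obtain ts2 where 2: "(tm_step (machine P) ^^ t2) (n + code_size c1, ts1) =
      (n + code_size c1 + code_size c2, ts2)" "tapes_rep ts2 s2"
    using exec_Seq.IH(2)[OF w(2,4) 1(2)] by blast
  show ?case using funpow_trans[OF 1(1) 2(1)] 2(2) by (auto simp: add.assoc)
next
  case (exec_IfT s k S c1 t s1 c2)
  let ?m = "n + code_size c1 + code_size c2 + 2"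
  have w: "wf_cmd c1" "k < 4" "n < length P" "P ! n = IJumpUnless k S (n + code_size c1 + 2)"
    "code_at P (n + 1) (compile c1 (n + 1))"
    "n + 1 + code_size c1 < length P" "P ! (n + 1 + code_size c1) = IJump ?m"
    using exec_IfT.prems by (auto dest!: code_at_append code_at_Cons)
  have s1: "(tm_step (machine P) ^^ 1) (n, ts) = (n + 1, ts)"
    using machine_jump_unless[OF w(3,4,2) exec_IfT.prems(3)] exec_IfT.hyps(1) by simp
  obtain ts1 where 1: "(tm_step (machine P) ^^ t) (n + 1, ts) = (n + 1 + code_size c1, ts1)" "tapes_rep ts1 s1"
    using exec_IfT.IH[OF w(1,5)] exec_IfT.prems by blast
  show ?case using funpow_trans[OF funpow_trans[OF s1 1(1)] machine_jump[OF w(6,7)]] 1(2)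
    by (auto simp: algebra_simps)
next
  case (exec_IfF s k S c2 t s1 c1)
  let ?m = "n + code_size c1 + 2"
  have w: "wf_cmd c2" "k < 4" "n < length P" "P ! n = IJumpUnless k S ?m" "code_at P ?m (compile c2 ?m)"
    using exec_IfF.prems by (auto dest!: code_at_append code_at_Cons)
  have s1: "(tm_step (machine P) ^^ 1) (n, ts) = (?m, ts)"
    using machine_jump_unless[OF w(3,4,2) exec_IfF.prems(3)] exec_IfF.hyps(1) by simp
  obtain ts1 where 1: "(tm_step (machine P) ^^ t) (?m, ts) = (?m + code_size c2, ts1)" "tapes_rep ts1 s1"
    using exec_IfF.IH[OF w(1,5)] exec_IfF.prems by blast
  show ?case using funpow_trans[OF s1 1(1)] 1(2)
    by (auto simp: algebra_simps)
next
  case (exec_WhileF s k S c)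
  have w: "n < length P" "P ! n = IJumpUnless k S (n + code_size c + 2)" "k < 4"
    using exec_WhileF.prems by (auto dest!: code_at_append code_at_Cons)
  show ?case
    using machine_jump_unless[OF w exec_WhileF.prems(3)] exec_WhileF.hyps(1) exec_WhileF.prems(3) by simp
next
  case (exec_WhileT s k S c t1 s1 t2 s2)
  have w: "wf_cmd c" "k < 4" "n < length P" "P ! n = IJumpUnless k S (n + code_size c + 2)"
    "code_at P (n + 1) (compile c (n + 1))"
    "n + 1 + code_size c < length P" "P ! (n + 1 + code_size c) = IJump n"
    using exec_WhileT.prems by (auto dest!: code_at_append code_at_Cons)
  have e1: "(tm_step (machine P) ^^ 1) (n, ts) = (n + 1, ts)"
    using machine_jump_unless[OF w(3,4,2) exec_WhileT.prems(3)] exec_WhileT.hyps(1) by simp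
  obtain ts1 where 1: "(tm_step (machine P) ^^ t1) (n + 1, ts) = (n + 1 + code_size c, ts1)" "tapes_rep ts1 s1"
    using exec_WhileT.IH(1)[OF w(1,5)] exec_WhileT.prems by blast
  \<comment> \<open>The back jump returns to \<open>n\<close>, where the code of the whole loop
    stands, so the second induction hypothesis applies at the same address.\<close>
  obtain ts2 where 2: "(tm_step (machine P) ^^ t2) (n, ts1) = (n + code_size (WhileTop k S c), ts2)"
      "tapes_rep ts2 s2"
    using exec_WhileT.IH(2)[OF exec_WhileT.prems(1,2) 1(2)] by blast
  have "1 + t1 + 1 + t2 = t1 + t2 + 2" by simp
  then show ?case
    using funpow_trans[OF funpow_trans[OF funpow_trans[OF e1 1(1)] machine_jump[OF w(6,7)]] 2(1)] 2(2) by metis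
qed

lemma machine_halted: "q = length P \<or> q = length P + 1 \<Longrightarrow> (tm_step (machine P) ^^ n) (q, ts) = (q, ts)"
  by (induction n) (auto simp: machine_def)

text \<open>\<open>poly_time_decidable\<close> asks for the state at one prescribed time. A halted
  machine keeps its state, so halting by then is enough; the strict bound on \<open>t\<close> leaves
  one step for the final test of the top symbol.\<close>

theorem poly_time_decidable_exec:
  assumes "wf_cmd c"
    and "\<And>ws. length ws = n \<Longrightarrow>
      \<exists>t s'. exec c ((\<lambda>_. [])(0 := tuple_input ws)) t s' \<and>
        t < poly p (length (tuple_input ws)) \<and> (top_symbol (s' 0) = 2 \<longleftrightarrow> Q ws)"
  shows "poly_time_decidable n Q"
  unfolding poly_time_decidable_def
proof (intro exI conjI allI impI)
  let ?P = "machine_code c"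
  have lenP: "length ?P = code_size c + 1" by (simp add: machine_code_def)
  show "wf_turing_machine (machine ?P)"
  proof (rule wf_machine, intro ballI)
    fix i assume "i \<in> set ?P"
    then show "wf_instr (length ?P + 1) i"
      using wf_compile[OF assms(1), of 0 "length ?P + 1"] lenP
      by (auto simp: machine_code_def)
  qed
  fix ws :: "bool list list" assume "length ws = n"
  then obtain t s' where e: "exec c ((\<lambda>_. [])(0 := tuple_input ws)) t s'"
      and t: "t < poly p (length (tuple_input ws))" and Q: "top_symbol (s' 0) = 2 \<longleftrightarrow> Q ws"
    using assms(2) by blast
  define ts where "ts = input_tape (tuple_input ws) # replicate 3 blank_tape"
  have init: "tm_init (machine ?P) (tuple_input ws) = (0, ts)"
    by (simp add: tm_init_def machine_def ts_def)
  have rep: "tapes_rep ts ((\<lambda>_. [])(0 := tuple_input ws))"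
    unfolding tapes_rep_def ts_def
    by (auto simp: tape_rep_def input_tape_def blank_tape_def less_Suc_eq numeral_eq_Suc)
  have ca: "code_at ?P 0 (compile c 0)"
    unfolding machine_code_def code_at_def by (intro exI[of _ "[]"] exI[of _ "[_]"]) simp
  obtain ts' where 1: "(tm_step (machine ?P) ^^ t) (0, ts) = (code_size c, ts')" "tapes_rep ts' s'"
    using exec_machine[OF e assms(1) ca rep] by auto
  have rd: "read_tape (ts' ! 0) = top_symbol (s' 0)"
    using 1(2) tape_rep_read unfolding tapes_rep_def by auto
  have "0 < length ts'" using 1(2) by (simp add: tapes_rep_def)
  then have 2: "(tm_step (machine ?P) ^^ 1) (code_size c, ts') =
      (if Q ws then length ?P else length ?P + 1, ts')"
    using machine_step[of "code_size c" ?P ts'] rd Q lenP map2_stay[of ts'] nth_map[of 0 ts' read_tape]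
    by (auto simp: machine_code_def nth_append)
  obtain d where d: "poly p (length (tuple_input ws)) = t + 1 + d"
    using t by (metis Suc_eq_plus1 less_iff_Suc_add add.commute add_Suc_right)
  have "(tm_step (machine ?P) ^^ (t + 1 + d)) (0, ts) =
      (if Q ws then length ?P else length ?P + 1, ts')"
    by (rule funpow_trans[OF funpow_trans[OF 1(1) 2]]) (rule machine_halted, auto)
  then show "tm_state_after (machine ?P) (tuple_input ws) (poly p (length (tuple_input ws))) =
      (if Q ws then accept_state (machine ?P) else reject_state (machine ?P))"
    unfolding tm_state_after_def init d by (simp add: machine_def)
qed

section \<open>Trees on a stack\<close>

datatype tree = Leaf | Node tree tree

text \<open>Preorder notation delimits itself, so several codes can lie on one stack without
  separators.\<close>

fun code :: "tree \<Rightarrow> nat list" where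
  "code Leaf = [1]"
| "code (Node l r) = 2 # code l @ code r"

lemma set_code: "set (code x) \<subseteq> {1, 2}"
  by (induction x) auto

lemma length_code_pos: "1 \<le> length (code x)"
  by (cases x) auto

lemma exec_le_Seq:
  "\<exists>t\<le>T1. exec c1 s t s1 \<Longrightarrow> \<exists>t\<le>T2. exec c2 s1 t s2 \<Longrightarrow> \<exists>t\<le>T1 + T2. exec (c1 ;; c2) s t s2"
  using exec_Seq add_mono by metis

text \<open>Tape 3 counts the subtrees that remain to be read.\<close>

definition move_loop :: "nat \<Rightarrow> cmd" where
  "move_loop j = WhileTop 3 {1}
     (IfTop 0 {2} (Pop 0 ;; Push j 2 ;; Push 3 1) (Pop 0 ;; Push j 1 ;; Pop 3))"

definition move_tree :: "nat \<Rightarrow> cmd" where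
  "move_tree j = Push 3 1 ;; move_loop j"

text \<open>A subtree is not handled by a loop of its own, so the induction can only prepend its
  symbols to a run of the loop that starts after it; hence the form with a continuation. A symbol
  costs at most 9 steps.\<close>

lemma exec_move_loop:
  assumes "j = 1 \<or> j = 2"
  shows "s 0 = code x @ rest \<Longrightarrow> s 3 = replicate (Suc n) 1 \<Longrightarrow>
    \<exists>t'\<le>t. exec (move_loop j) (s(0 := rest, j := rev (code x) @ s j, 3 := replicate n 1)) t' s' \<Longrightarrow>
    \<exists>t'\<le>t + 9 * length (code x). exec (move_loop j) s t' s'"
proof (induction x arbitrary: s n rest t)
  case Leaf
  let ?s = "s(0 := rest, j := rev (code Leaf) @ s j, 3 := replicate n 1)"
  have "exec (Pop 0 ;; Push j 1 ;; Pop 3) s (1 + (2 + 1)) ?s"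
    using exec_Seq[OF exec_Pop[of 0 s] exec_Seq[OF exec_Push[of j 1] exec_Pop[of 3]]] Leaf.prems(1,2) assms
    by (auto simp: fun_upd_twist)
  then have "exec (IfTop 0 {2} (Pop 0 ;; Push j 2 ;; Push 3 1) (Pop 0 ;; Push j 1 ;; Pop 3)) s (4 + 1) ?s"
    using exec_IfF[of s 0 "{2}" "Pop 0 ;; Push j 1 ;; Pop 3" 4 ?s] Leaf.prems(1)
    by (simp del: fun_upd_apply)
  moreover obtain t' where "t' \<le> t" "exec (move_loop j) ?s t' s'" using Leaf by blast
  ultimately have "exec (move_loop j) s (4 + 1 + t' + 2) s'"
    using exec_WhileT[of s 3 "{1}"] Leaf unfolding move_loop_def by fastforce
  then show ?case using \<open>t' \<le> t\<close> by (intro exI[of _ "4 + 1 + t' + 2"]) auto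
next
  case (Node l r)
  let ?s1 = "s(0 := code l @ code r @ rest, j := 2 # s j, 3 := replicate (Suc (Suc n)) 1)"
  let ?s2 = "?s1(0 := code r @ rest, j := rev (code l) @ ?s1 j, 3 := replicate (Suc n) 1)"
  let ?s3 = "s(0 := rest, j := rev (code (Node l r)) @ s j, 3 := replicate n 1)"
  have "exec (Pop 0 ;; Push j 2 ;; Push 3 1) s (1 + (2 + 2)) ?s1"
    using exec_Seq[OF exec_Pop[of 0 s] exec_Seq[OF exec_Push[of j 2] exec_Push[of 3 1]]] Node.prems assms
    by (auto simp: fun_upd_twist)
  then have 1: "exec (IfTop 0 {2} (Pop 0 ;; Push j 2 ;; Push 3 1) (Pop 0 ;; Push j 1 ;; Pop 3)) s (5 + 2) ?s1"
    using exec_IfT[of s 0 "{2}" "Pop 0 ;; Push j 2 ;; Push 3 1" 5 ?s1] Node.prems(1)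
    by (simp del: fun_upd_apply)
  have s3: "?s2(0 := rest, j := rev (code r) @ ?s2 j, 3 := replicate n 1) = ?s3"
    using assms by (auto simp: fun_eq_iff)
  have "\<exists>t'\<le>t + 9 * length (code r). exec (move_loop j) ?s2 t' s'"
  proof (rule Node.IH(2)[of ?s2 rest n t, unfolded s3])
    show "?s2 0 = code r @ rest" "?s2 3 = replicate (Suc n) 1" using assms by auto
  qed (rule Node.prems(3))
  then have "\<exists>t'\<le>t + 9 * length (code r) + 9 * length (code l). exec (move_loop j) ?s1 t' s'"
  proof (rule Node.IH(1)[of ?s1 "code r @ rest" "Suc n", rotated 2])
    show "?s1 0 = code l @ code r @ rest" "?s1 3 = replicate (Suc (Suc n)) 1" using assms by auto
  qed
  then obtain t' where "t' \<le> t + 9 * length (code r) + 9 * length (code l)" "exec (move_loop j) ?s1 t' s'"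
    by blast
  moreover from this have "exec (move_loop j) s (5 + 2 + t' + 2) s'"
    using exec_WhileT[of s 3 "{1}", OF _ 1] Node.prems unfolding move_loop_def by fastforce
  ultimately show ?case by (intro exI[of _ "5 + 2 + t' + 2"]) auto
qed

lemma exec_move_tree:
  assumes "j = 1 \<or> j = 2" "s 0 = code x @ rest" "s 3 = []"
  shows "\<exists>t\<le>9 * length (code x) + 3. exec (move_tree j) s t (s(0 := rest, j := rev (code x) @ s j))"
proof -
  let ?s = "s(0 := rest, j := rev (code x) @ s j)"
  have "(s(3 := [1]))(0 := rest, j := rev (code x) @ (s(3 := [1])) j, 3 := replicate 0 1) = ?s"
    using assms by (auto simp: fun_eq_iff)
  moreover have "exec (move_loop j) ?s 1 ?s"
    unfolding move_loop_def using assms by (intro exec_WhileF) auto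
  ultimately have "\<exists>t\<le>1 + 9 * length (code x). exec (move_loop j) (s(3 := [1])) t ?s"
    using assms by (intro exec_move_loop[where n = 0 and rest = rest]) auto
  moreover have "exec (Push 3 1) s 2 (s(3 := [1]))"
    using exec_Push[of 3 1 s] assms by simp
  ultimately have "\<exists>t\<le>2 + (1 + 9 * length (code x)). exec (move_tree j) s t ?s"
    unfolding move_tree_def by (intro exec_le_Seq) auto
  then show ?thesis by (metis (no_types, lifting) add.commute add.left_commute numeral_3_eq_3 one_add_one
    plus_1_eq_Suc add_Suc_right numeral_2_eq_2)
qed

lemma exec_IfTop3:
  assumes "a \<in> {1, 2, 3}" "s k = a # w" "exec (c a) s t s'"
  shows "\<exists>t'\<le>t + 3. exec (IfTop k {1} (c 1) (IfTop k {2} (c 2) (c 3))) s t' s'"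
proof (cases "a = 1")
  case True
  then have "exec (IfTop k {1} (c 1) (IfTop k {2} (c 2) (c 3))) s (t + 2) s'"
    using assms by (intro exec_IfT) auto
  then show ?thesis by (intro exI[of _ "t + 2"]) auto
next
  case False
  have "\<exists>t'\<le>t + 2. exec (IfTop k {2} (c 2) (c 3)) s t' s'"
  proof (cases "a = 2")
    case True
    then have "exec (IfTop k {2} (c 2) (c 3)) s (t + 2) s'"
      using assms by (intro exec_IfT) auto
    then show ?thesis by (intro exI[of _ "t + 2"]) auto
  next
    case a: False
    have "a = 3" using False a assms(1) by simp
    then have "exec (IfTop k {2} (c 2) (c 3)) s (t + 1) s'"
      using assms a by (intro exec_IfF) simp_all
    then show ?thesis by (intro exI[of _ "t + 1"]) auto
  qed
  then obtain t' where t': "t' \<le> t + 2" "exec (IfTop k {2} (c 2) (c 3)) s t' s'" by blast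
  have "exec (IfTop k {1} (c 1) (IfTop k {2} (c 2) (c 3))) s (t' + 1) s'"
    using assms(2) False t'(2) by (intro exec_IfF) auto
  then show ?thesis using t'(1) by (intro exI[of _ "t' + 1"]) auto
qed

text \<open>The language has no variables, so the symbol that is read has to be kept in the control:
  \<open>c a\<close> is a separate command for each \<open>a\<close>.\<close>

definition drain :: "nat \<Rightarrow> (nat \<Rightarrow> cmd) \<Rightarrow> cmd" where
  "drain i c = WhileTop i {1, 2, 3} (IfTop i {1} (c 1) (IfTop i {2} (c 2) (c 3)) ;; Pop i)"

text \<open>\<open>\<sigma> w v\<close> abstracts a store with \<open>w\<close> on tape
  \<open>i\<close> and the state \<open>v\<close> of the other tapes, so that one induction serves
  all transfers. Per symbol, \<open>T + 6\<close> counts 3 for the dispatch, 1 for the pop and 2 for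
  the loop.\<close>

lemma exec_drain:
  assumes "\<And>w v. \<sigma> w v i = w" "\<And>a w v. (\<sigma> (a # w) v)(i := w) = \<sigma> w v"
    and body: "\<And>a w v. a \<in> {1, 2, 3} \<Longrightarrow> \<exists>t\<le>T. exec (c a) (\<sigma> (a # w) v) t (\<sigma> (a # w) (g a v))"
  shows "set w \<subseteq> {1, 2, 3} \<Longrightarrow> \<exists>t\<le>(T + 6) * length w + 1. exec (drain i c) (\<sigma> w v) t (\<sigma> [] (fold g w v))"
proof (induction w arbitrary: v)
  case Nil
  have "exec (drain i c) (\<sigma> [] v) 1 (\<sigma> [] v)"
    unfolding drain_def by (rule exec_WhileF) (simp add: assms(1))
  then show ?case by auto
next
  case (Cons a w)
  let ?if = "IfTop i {1} (c 1) (IfTop i {2} (c 2) (c 3))"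
  have a: "a \<in> {1, 2, 3}" using Cons.prems by simp
  obtain t where t: "t \<le> T" "exec (c a) (\<sigma> (a # w) v) t (\<sigma> (a # w) (g a v))" using body[OF a] by blast
  obtain t1 where t1: "t1 \<le> t + 3" "exec ?if (\<sigma> (a # w) v) t1 (\<sigma> (a # w) (g a v))"
    using exec_IfTop3[of a "\<sigma> (a # w) v" i w c, OF a assms(1) t(2)] by blast
  have "exec (Pop i) (\<sigma> (a # w) (g a v)) 1 (\<sigma> w (g a v))"
    using exec_Pop[of i "\<sigma> (a # w) (g a v)"] by (simp only: assms(1,2) list.sel)
  note body = exec_Seq[OF t1(2) this]
  obtain t' where t': "t' \<le> (T + 6) * length w + 1" "exec (drain i c) (\<sigma> w (g a v)) t' (\<sigma> [] (fold g w (g a v)))"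
    using Cons.IH[of "g a v"] Cons.prems by auto
  have "exec (drain i c) (\<sigma> (a # w) v) (t1 + 1 + t' + 2) (\<sigma> [] (fold g w (g a v)))"
    unfolding drain_def by (rule exec_WhileT[OF _ body t'(2)[unfolded drain_def]]) (use a assms(1) in simp)
  moreover have "t1 + 1 + t' + 2 \<le> (T + 6) * length (a # w) + 1" using t(1) t1(1) t'(1) by simp
  ultimately show ?case unfolding fold_simps by blast
qed

definition nop :: cmd where "nop = Push 0 1 ;; Pop 0"

lemma exec_nop: "exec nop s 3 s"
  using exec_Seq[OF exec_Push[of 0 1 s] exec_Pop[of 0]] by (simp add: nop_def)

fun push_all :: "nat list \<Rightarrow> cmd" where
  "push_all [] = nop"
| "push_all (a # l) = push_all l ;; Push 0 a"

lemma exec_push_all: "exec (push_all l) s (2 * length l + 3) (s(0 := l @ s 0))"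
proof (induction l)
  case Nil
  then show ?case using exec_nop by simp
next
  case (Cons a l)
  have "exec (push_all l ;; Push 0 a) s (2 * length l + 3 + 2) (s(0 := (a # l) @ s 0))"
    using exec_Seq[OF Cons exec_Push[of 0 a]] by (simp only: fun_upd_upd fun_upd_same append_Cons)
  moreover have "2 * length l + 3 + 2 = 2 * length (a # l) + 3" by simp
  ultimately show ?case by (simp only: push_all.simps)
qed

lemma wf_push_all: "set l \<subseteq> {1, 2} \<Longrightarrow> wf_cmd (push_all l)"
  by (induction l) (auto simp: nop_def)

section \<open>Commands on the main stack\<close>

definition main_stack :: "nat list \<Rightarrow> stacks" where
  "main_stack m = (\<lambda>_. [])(0 := m)"

text \<open>The tapes 1 to 3 are scratch space, empty before and after the run, which lets commands
  be composed freely.\<close>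

definition runs :: "cmd \<Rightarrow> nat list \<Rightarrow> nat \<Rightarrow> nat list \<Rightarrow> bool" where
  "runs c m t m' \<longleftrightarrow> (\<exists>t'\<le>t. exec c (main_stack m) t' (main_stack m'))"

lemma runs_mono: "runs c m t m' \<Longrightarrow> t \<le> t' \<Longrightarrow> runs c m t' m'"
  unfolding runs_def using le_trans by blast

lemma runs_Seq: "runs c1 m t1 m1 \<Longrightarrow> runs c2 m1 t2 m2 \<Longrightarrow> runs (c1 ;; c2) m (t1 + t2) m2"
  unfolding runs_def by (rule exec_le_Seq)

lemma runs_Push: "runs (Push 0 a) m 2 (a # m)"
  unfolding runs_def main_stack_def using exec_Push[of 0 a "(\<lambda>_. [])(0 := m)"] by auto

lemma runs_Pop: "runs (Pop 0) (a # m) 1 m"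
  unfolding runs_def main_stack_def using exec_Pop[of 0 "(\<lambda>_. [])(0 := a # m)"] by auto

lemma runs_IfT: "top_symbol m \<in> S \<Longrightarrow> runs c1 m t m' \<Longrightarrow> runs (IfTop 0 S c1 c2) m (t + 2) m'"
  unfolding runs_def main_stack_def using exec_IfT[of "(\<lambda>_. [])(0 := m)" 0 S] by fastforce

lemma runs_IfF: "top_symbol m \<notin> S \<Longrightarrow> runs c2 m t m' \<Longrightarrow> runs (IfTop 0 S c1 c2) m (t + 2) m'"
  unfolding runs_def
proof (elim exE conjE)
  fix a assume "top_symbol m \<notin> S" "a \<le> t" "exec c2 (main_stack m) a (main_stack m')"
  then show "\<exists>t'\<le>t + 2. exec (IfTop 0 S c1 c2) (main_stack m) t' (main_stack m')"
    using exec_IfF[of "main_stack m" 0 S c2 a "main_stack m'" c1]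
    by (intro exI[of _ "a + 1"]) (auto simp: main_stack_def)
qed

lemma runs_WhileF: "top_symbol m \<notin> S \<Longrightarrow> runs (WhileTop 0 S c) m 1 m"
  unfolding runs_def main_stack_def using exec_WhileF[of "(\<lambda>_. [])(0 := m)" 0 S] by fastforce

lemma runs_WhileT: "top_symbol m \<in> S \<Longrightarrow> runs c m t1 m1 \<Longrightarrow> runs (WhileTop 0 S c) m1 t2 m2 \<Longrightarrow>
   runs (WhileTop 0 S c) m (t1 + t2 + 2) m2"
  unfolding runs_def
proof (elim exE conjE)
  fix a b assume "top_symbol m \<in> S" "a \<le> t1" "b \<le> t2" "exec c (main_stack m) a (main_stack m1)"
    "exec (WhileTop 0 S c) (main_stack m1) b (main_stack m2)"
  then show "\<exists>t'\<le>t1 + t2 + 2. exec (WhileTop 0 S c) (main_stack m) t' (main_stack m2)"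
    using exec_WhileT[of "main_stack m" 0 S c a "main_stack m1" b "main_stack m2"]
    by (intro exI[of _ "a + b + 2"]) (auto simp: main_stack_def)
qed

text \<open>A transfer between tapes reverses the symbols; the copy on tape 2 therefore returns by
  way of tape 1.\<close>

definition dup_cmd :: cmd where
  "dup_cmd = move_tree 1 ;; drain 1 (\<lambda>a. Push 0 a ;; Push 2 a) ;; drain 2 (Push 1) ;; drain 1 (Push 0)"
definition swap_cmd :: cmd where
  "swap_cmd = move_tree 1 ;; move_tree 2 ;; drain 1 (Push 0) ;; drain 2 (Push 0)"
definition drop_cmd :: cmd where
  "drop_cmd = move_tree 1 ;; drain 1 (\<lambda>_. nop)"

lemma wf_stack_cmds [simp]: "wf_cmd dup_cmd" "wf_cmd swap_cmd" "wf_cmd drop_cmd"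
  by (simp_all add: dup_cmd_def swap_cmd_def drop_cmd_def move_tree_def move_loop_def drain_def nop_def)

definition stacks4 :: "nat list \<Rightarrow> nat list \<Rightarrow> nat list \<Rightarrow> nat list \<Rightarrow> stacks" where
  "stacks4 a b c d = (\<lambda>_. [])(0 := a, 1 := b, 2 := c, 3 := d)"

lemma stacks4_simps:
  "stacks4 a b c d 0 = a" "stacks4 a b c d 1 = b" "stacks4 a b c d 2 = c" "stacks4 a b c d 3 = d"
  "(stacks4 a b c d)(0 := x) = stacks4 x b c d" "(stacks4 a b c d)(1 := x) = stacks4 a x c d"
  "(stacks4 a b c d)(2 := x) = stacks4 a b x d" "(stacks4 a b c d)(3 := x) = stacks4 a b c x"
  by (auto simp: stacks4_def fun_eq_iff)

lemma main_stack_eq_stacks4: "main_stack m = stacks4 m [] [] []"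
  by (auto simp: main_stack_def stacks4_def fun_eq_iff)

lemma exec_move_tree4:
  "\<exists>t\<le>9 * length (code x) + 3. exec (move_tree 1) (stacks4 (code x @ r) b c []) t (stacks4 r (rev (code x) @ b) c [])"
  "\<exists>t\<le>9 * length (code x) + 3. exec (move_tree 2) (stacks4 (code x @ r) b c []) t (stacks4 r b (rev (code x) @ c) [])"
  using exec_move_tree[of 1 "stacks4 (code x @ r) b c []" x r] exec_move_tree[of 2 "stacks4 (code x @ r) b c []" x r]
  by (simp_all only: stacks4_simps simp_thms)

lemma exec_pour:
  assumes "set w \<subseteq> {1, 2, 3}"
  shows "\<exists>t\<le>8 * length w + 1. exec (drain 0 (Push 1)) (stacks4 w b c d) t (stacks4 [] (rev w @ b) c d)" (is ?P1)
    and "\<exists>t\<le>8 * length w + 1. exec (drain 1 (Push 0)) (stacks4 a w c d) t (stacks4 (rev w @ a) [] c d)" (is ?P2)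
    and "\<exists>t\<le>8 * length w + 1. exec (drain 2 (Push 1)) (stacks4 a b w d) t (stacks4 a (rev w @ b) [] d)" (is ?P3)
    and "\<exists>t\<le>8 * length w + 1. exec (drain 2 (Push 0)) (stacks4 a b w d) t (stacks4 (rev w @ a) b [] d)" (is ?P4)
    and "\<exists>t\<le>10 * length w + 1. exec (drain 1 (\<lambda>a. Push 0 a ;; Push 2 a)) (stacks4 a w c d) t
        (stacks4 (rev w @ a) [] (rev w @ c) d)" (is ?P5)
    and "\<exists>t\<le>9 * length w + 1. exec (drain 1 (\<lambda>_. nop)) (stacks4 a w c d) t (stacks4 a [] c d)" (is ?P6)
proof -
  have push0: "\<exists>t\<le>2. exec (Push 0 x) (stacks4 a b c d) t (stacks4 (x # a) b c d)" for x a b c d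
    using exec_Push[of 0 x "stacks4 a b c d"] unfolding stacks4_simps by blast
  have push1: "\<exists>t\<le>2. exec (Push 1 x) (stacks4 a b c d) t (stacks4 a (x # b) c d)" for x a b c d
    using exec_Push[of 1 x "stacks4 a b c d"] unfolding stacks4_simps by blast
  have "exec (Push 0 x ;; Push 2 x) (stacks4 a b c d) (2 + 2) (stacks4 (x # a) b (x # c) d)" for x a b c d
    using exec_Seq[OF exec_Push[of 0 x "stacks4 a b c d"] exec_Push[of 2 x]] unfolding stacks4_simps .
  then have push2: "\<exists>t\<le>4. exec (Push 0 x ;; Push 2 x) (stacks4 a (y # b) (snd v) d) t
      (stacks4 (x # a) (y # b) (x # snd v) d)" for x y a b d and v :: "nat list \<times> nat list"
    by (intro exI[of _ "2 + 2"]) simp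
  have nop: "\<exists>t\<le>3. exec nop s t s" for s using exec_nop by blast
  have fold_pair: "fold (\<lambda>x v. (x # fst v, x # snd v)) w v = (rev w @ fst v, rev w @ snd v)" for v :: "nat list \<times> nat list"
    by (induction w arbitrary: v) auto
  have fold_id: "fold (\<lambda>_ v. v) w () = ()" by simp
  show ?P1
    using exec_drain[of "\<lambda>w v. stacks4 w v c d" 0 2 "Push 1" "Cons" w b, OF stacks4_simps(1) stacks4_simps(5) push1 assms]
    by (simp add: fold_Cons_rev)
  show ?P2
    using exec_drain[of "\<lambda>w v. stacks4 v w c d" 1 2 "Push 0" "Cons" w a, OF stacks4_simps(2) stacks4_simps(6) push0 assms]
    by (simp add: fold_Cons_rev)
  show ?P3
    using exec_drain[of "\<lambda>w v. stacks4 a v w d" 2 2 "Push 1" "Cons" w b, OF stacks4_simps(3) stacks4_simps(7) push1 assms]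
    by (simp add: fold_Cons_rev)
  show ?P4
    using exec_drain[of "\<lambda>w v. stacks4 v b w d" 2 2 "Push 0" "Cons" w a, OF stacks4_simps(3) stacks4_simps(7) push0 assms]
    by (simp add: fold_Cons_rev)
  show ?P5
    using exec_drain[of "\<lambda>w v. stacks4 (fst v) w (snd v) d" 1 4 "\<lambda>a. Push 0 a ;; Push 2 a" "\<lambda>x v. (x # fst v, x # snd v)" w "(a, c)", OF stacks4_simps(2) stacks4_simps(6) _ assms]
    push2 by (simp add: fold_pair)
  show ?P6
    using exec_drain[of "\<lambda>w v. stacks4 a w c d" 1 3 "\<lambda>_. nop" "\<lambda>_ v. v" w "()", OF stacks4_simps(2) stacks4_simps(6) nop assms]
    by (simp add: fold_id)
qed

text \<open>The additive constants are absorbed by the factor 50, since a code is never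
  empty.\<close>

lemma runs_dup: "runs dup_cmd (code x @ r) (50 * length (code x)) (code x @ code x @ r)"
proof -
  let ?n = "length (code x)"
  note S = append_Nil2 rev_rev_ident length_rev
  have w: "set (code x) \<subseteq> {1, 2, 3}" "set (rev (code x)) \<subseteq> {1, 2, 3}" using set_code[of x] by auto
  have "runs dup_cmd (code x @ r) (9 * ?n + 3 + (10 * ?n + 1 + (8 * ?n + 1 + (8 * ?n + 1)))) (code x @ code x @ r)"
    unfolding runs_def dup_cmd_def main_stack_eq_stacks4
    by (rule exec_le_Seq[OF exec_move_tree4(1)[of x r "[]" "[]", unfolded S] exec_le_Seq[OF
      exec_pour(5)[OF w(2), where a = r and c = "[]" and d = "[]", unfolded S] exec_le_Seq[OF
      exec_pour(3)[OF w(1), where a = "code x @ r" and b = "[]" and d = "[]", unfolded S]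
      exec_pour(2)[OF w(2), where a = "code x @ r" and c = "[]" and d = "[]", unfolded S]]]])
  then show ?thesis by (rule runs_mono) (use length_code_pos[of x] in linarith)
qed

lemma runs_swap:
  "runs swap_cmd (code x @ code y @ r) (25 * (length (code x) + length (code y))) (code y @ code x @ r)"
proof -
  let ?n = "length (code x)" let ?m = "length (code y)"
  note S = append_Nil2 rev_rev_ident length_rev
  have w: "set (rev (code x)) \<subseteq> {1, 2, 3}" "set (rev (code y)) \<subseteq> {1, 2, 3}"
    using set_code[of x] set_code[of y] by auto
  have "runs swap_cmd (code x @ code y @ r) (9 * ?n + 3 + (9 * ?m + 3 + (8 * ?n + 1 + (8 * ?m + 1)))) (code y @ code x @ r)"
    unfolding runs_def swap_cmd_def main_stack_eq_stacks4
    by (rule exec_le_Seq[OF exec_move_tree4(1)[of x "code y @ r" "[]" "[]", unfolded S] exec_le_Seq[OF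
      exec_move_tree4(2)[of y r "rev (code x)" "[]", unfolded S] exec_le_Seq[OF
      exec_pour(2)[OF w(1), where a = r and c = "rev (code y)" and d = "[]", unfolded S]
      exec_pour(4)[OF w(2), where a = "code x @ r" and b = "[]" and d = "[]", unfolded S]]]])
  then show ?thesis
    by (rule runs_mono) (use length_code_pos[of x] length_code_pos[of y] in \<open>simp add: distrib_left\<close>)
qed

lemma runs_drop: "runs drop_cmd (code x @ r) (25 * length (code x)) r"
proof -
  let ?n = "length (code x)"
  note S = append_Nil2 rev_rev_ident length_rev
  have w: "set (rev (code x)) \<subseteq> {1, 2, 3}" using set_code[of x] by auto
  have "runs drop_cmd (code x @ r) (9 * ?n + 3 + (9 * ?n + 1)) r"
    unfolding runs_def drop_cmd_def main_stack_eq_stacks4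
    by (rule exec_le_Seq[OF exec_move_tree4(1)[of x r "[]" "[]", unfolded S]
      exec_pour(6)[OF w, where a = r and c = "[]" and d = "[]", unfolded S]])
  then show ?thesis by (rule runs_mono) (use length_code_pos[of x] in linarith)
qed

lemma runs_push_all: "runs (push_all l) r (2 * length l + 3) (l @ r)"
  using exec_push_all[of l "main_stack r"] unfolding runs_def main_stack_eq_stacks4 stacks4_simps by blast

lemma runs_nop: "runs nop m 3 m"
  unfolding runs_def using exec_nop by blast

lemma runs_length: "runs c m t m' \<Longrightarrow> length m' \<le> length m + t"
  unfolding runs_def main_stack_def using exec_length[of c _ _ _ 0] by fastforce

section \<open>Functions computable in polynomial time\<close>

text \<open>Codes are meant to coincide across types: below, a nonempty list has the tree of the
  pair of its head and tail, a number \<open>n\<close> that of a list of \<open>n\<close> units, and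
  \<open>True\<close> that of a list with one unit. Conversions between them then cost
  nothing.\<close>

class encodable =
  fixes to_tree :: "'a \<Rightarrow> tree"

definition enc :: "'a::encodable \<Rightarrow> nat list" where
  "enc x = code (to_tree x)"

definition sz :: "'a::encodable \<Rightarrow> nat" where
  "sz x = length (enc x)"

instantiation unit :: encodable begin
definition "to_tree (_ :: unit) = Leaf"
instance ..
end

instantiation bool :: encodable begin
definition "to_tree b = (if b then Node Leaf Leaf else Leaf)"
instance ..
end

instantiation prod :: (encodable, encodable) encodable begin
definition "to_tree p = Node (to_tree (fst p)) (to_tree (snd p))"
instance ..
end

instantiation list :: (encodable) encodable begin
primrec to_tree_list :: "'a list \<Rightarrow> tree" where
  "to_tree_list [] = Leaf"
| "to_tree_list (x # xs) = Node (to_tree x) (to_tree_list xs)"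
instance ..
end

text \<open>Natural numbers are represented in unary: they serve as dimensions and indices. Binary
  numbers are represented by their lists of digits.\<close>

instantiation nat :: encodable begin
primrec to_tree_nat :: "nat \<Rightarrow> tree" where
  "to_tree_nat 0 = Leaf"
| "to_tree_nat (Suc n) = Node Leaf (to_tree_nat n)"
instance ..
end

section \<open>Sizes and polynomial bounds\<close>

lemma enc_Pair: "enc (x, y) = 2 # enc x @ enc y"
  by (simp add: enc_def to_tree_prod_def)

lemma enc_Nil: "enc [] = [1]"
  by (simp add: enc_def)

lemma enc_Cons: "enc (x # xs) = 2 # enc x @ enc xs"
  by (simp add: enc_def)

lemma enc_bool: "enc True = [2, 1, 1]" "enc False = [1]"
  by (simp_all add: enc_def to_tree_bool_def)

lemma sz_simps [simp]:
  "sz (x, y) = Suc (sz x + sz y)" "sz ([] :: 'a::encodable list) = 1" "sz (z # xs) = Suc (sz z + sz xs)"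
  "sz () = 1" "sz True = 3" "sz False = 1" "sz (0 :: nat) = 1" "sz (Suc n) = Suc (Suc (sz n))"
  by (simp_all add: sz_def enc_def to_tree_prod_def to_tree_unit_def to_tree_bool_def)

lemma sz_bool: "sz (b :: bool) \<le> 3"
  by (cases b) auto

lemma sz_nat: "sz (n :: nat) = 2 * n + 1"
  by (induction n) auto

lemma length_le_sz: "length l \<le> sz l"
  by (induction l) auto

lemma sz_mem: "x \<in> set l \<Longrightarrow> sz x \<le> sz l"
  by (induction l) auto

lemma sz_bool_list: "sz (l :: bool list) \<le> 4 * length l + 1"
proof (induction l)
  case (Cons b l)
  then show ?case using sz_bool[of b] by simp
qed simp

lemma sz_drop: "sz (drop n l) \<le> sz l"
proof (induction l arbitrary: n)
  case (Cons a l)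
  then show ?case by (cases n) (auto simp: le_Suc_eq trans_le_add2)
qed simp

text \<open>A base of at least 2 lets the exponent absorb constants, sums and products.\<close>

definition polyb :: "('a::encodable \<Rightarrow> nat) \<Rightarrow> bool" where
  "polyb g \<longleftrightarrow> (\<exists>k. \<forall>x. g x \<le> (sz x + 2) ^ k)"

lemma polyb_mono: "polyb g \<Longrightarrow> (\<And>x. f x \<le> g x) \<Longrightarrow> polyb f"
  unfolding polyb_def using le_trans by blast

lemma polyb_const [simp]: "polyb (\<lambda>_. c)"
  unfolding polyb_def
proof (intro exI[of _ c] allI)
  fix x :: 'a
  have "c \<le> 2 ^ c" by simp
  also have "\<dots> \<le> (sz x + 2) ^ c" by (rule power_mono) auto
  finally show "c \<le> (sz x + 2) ^ c" .
qed

lemma polyb_sz [simp]: "polyb sz"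
  unfolding polyb_def by (rule exI[of _ 1]) auto

lemma polyb_add: assumes "polyb f" "polyb g" shows "polyb (\<lambda>x. f x + g x)"
proof -
  obtain a b where *: "\<And>x. f x \<le> (sz x + 2) ^ a" "\<And>x. g x \<le> (sz x + 2) ^ b"
    using assms unfolding polyb_def by blast
  have "f x + g x \<le> (sz x + 2) ^ (a + b + 1)" for x
  proof -
    let ?N = "sz x + 2"
    have "?N ^ a \<le> ?N ^ (a + b)" "?N ^ b \<le> ?N ^ (a + b)" by (auto intro: power_increasing)
    then have "f x + g x \<le> 2 * ?N ^ (a + b)" using *[of x] by linarith
    also have "\<dots> \<le> ?N * ?N ^ (a + b)" by (rule mult_right_mono) auto
    finally show ?thesis by simp
  qed
  then show ?thesis unfolding polyb_def by blast
qed

lemma polyb_mult: assumes "polyb f" "polyb g" shows "polyb (\<lambda>x. f x * g x)"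
proof -
  obtain a b where *: "\<And>x. f x \<le> (sz x + 2) ^ a" "\<And>x. g x \<le> (sz x + 2) ^ b"
    using assms unfolding polyb_def by blast
  have "f x * g x \<le> (sz x + 2) ^ (a + b)" for x
    using mult_mono[OF *[of x]] by (simp add: power_add)
  then show ?thesis unfolding polyb_def by blast
qed

lemma polyb_power: assumes "polyb f" shows "polyb (\<lambda>x. f x ^ n)"
  by (induction n) (auto intro: polyb_mult assms)

lemma polyb_subst: assumes "polyb g" "polyb (\<lambda>x. sz (f x))" shows "polyb (\<lambda>x. g (f x))"
proof -
  obtain k where k: "\<And>x. g x \<le> (sz x + 2) ^ k" using assms unfolding polyb_def by blast
  have "polyb (\<lambda>x. (sz (f x) + 2) ^ k)" by (intro polyb_power polyb_add assms) simp
  then show ?thesis by (rule polyb_mono) (rule k)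
qed

text \<open>The arbitrary rest \<open>r\<close> is left untouched, so saved values may lie below the
  argument.\<close>

definition polytime :: "('a::encodable \<Rightarrow> 'b::encodable) \<Rightarrow> bool" where
  "polytime f \<longleftrightarrow> (\<exists>c T. wf_cmd c \<and> polyb T \<and> (\<forall>x r. runs c (enc x @ r) (T x) (enc (f x) @ r)))"

lemma polytimeI:
  "wf_cmd c \<Longrightarrow> polyb T \<Longrightarrow> (\<And>x r. runs c (enc x @ r) (T x) (enc (f x) @ r)) \<Longrightarrow> polytime f"
  unfolding polytime_def by blast

text \<open>A run of \<open>T x\<close> steps adds at most \<open>T x\<close> symbols to the
  stack.\<close>

lemma polyb_sz_polytime: assumes "polytime f" shows "polyb (\<lambda>x. sz (f x))"
proof -
  obtain c T where *: "polyb T" "\<And>x r. runs c (enc x @ r) (T x) (enc (f x) @ r)"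
    using assms unfolding polytime_def by blast
  have "polyb (\<lambda>x. sz x + T x)" by (intro polyb_add * polyb_sz)
  then show ?thesis
    by (rule polyb_mono) (use runs_length[OF *(2)[of _ "[]"]] in \<open>simp add: sz_def\<close>)
qed

lemma polyb_comp: "polyb g \<Longrightarrow> polytime f \<Longrightarrow> polyb (\<lambda>x. g (f x))"
  by (rule polyb_subst[OF _ polyb_sz_polytime])

lemmas polyb_intros = polyb_add polyb_mult polyb_const polyb_sz polyb_sz_polytime

section \<open>Closure properties of polynomial time functions\<close>

lemma runs_dup': "runs dup_cmd (enc x @ r) (50 * sz x) (enc x @ enc x @ r)"
  unfolding enc_def sz_def by (rule runs_dup)

lemma runs_swap': "runs swap_cmd (enc x @ enc y @ r) (25 * (sz x + sz y)) (enc y @ enc x @ r)"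
  unfolding enc_def sz_def by (rule runs_swap)

lemma runs_drop': "runs drop_cmd (enc x @ r) (25 * sz x) r"
  unfolding enc_def sz_def by (rule runs_drop)

named_theorems polytime_intro

lemma polytime_comp:
  assumes "polytime f" "polytime g"
  shows "polytime (\<lambda>x. f (g x))"
proof -
  obtain cf Tf where f: "wf_cmd cf" "polyb Tf" "\<And>x r. runs cf (enc x @ r) (Tf x) (enc (f x) @ r)"
    using assms(1) unfolding polytime_def by blast
  obtain cg Tg where g: "wf_cmd cg" "polyb Tg" "\<And>x r. runs cg (enc x @ r) (Tg x) (enc (g x) @ r)"
    using assms(2) unfolding polytime_def by blast
  show ?thesis
  proof (rule polytimeI)
    show "wf_cmd (cg ;; cf)" using f g by simp
    show "polyb (\<lambda>x. Tg x + Tf (g x))" by (intro polyb_add g polyb_comp[OF f(2)] assms)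
    show "runs (cg ;; cf) (enc x @ r) (Tg x + Tf (g x)) (enc (f (g x)) @ r)" for x r
      by (rule runs_Seq[OF g(3) f(3)])
  qed
qed

lemma polytime_cast: assumes "\<And>x. to_tree (f x) = to_tree x" shows "polytime f"
proof (rule polytimeI[of nop "\<lambda>_. 3"])
  show "runs nop (enc x @ r) 3 (enc (f x) @ r)" for x :: 'a and r
    using runs_nop assms by (simp add: enc_def)
qed (auto simp: nop_def)

lemma polytime_id [polytime_intro]: "polytime (\<lambda>x. x)"
  by (rule polytime_cast) simp

lemma polytime_const [polytime_intro]: "polytime (\<lambda>_. c)"
proof (rule polytimeI[of "drop_cmd ;; push_all (enc c)" "\<lambda>x. 25 * sz x + (2 * length (enc c) + 3)"])
  show "runs (drop_cmd ;; push_all (enc c)) (enc x @ r) (25 * sz x + (2 * length (enc c) + 3)) (enc c @ r)"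
    for x :: 'a and r
    by (rule runs_Seq[OF runs_drop' runs_push_all])
qed (use set_code[of "to_tree c"] in \<open>auto intro!: wf_push_all polyb_intros simp: enc_def\<close>)

text \<open>\<open>g\<close> is evaluated first because the code of the first component has to end
  on top; the final push adds the symbol of the inner node.\<close>

lemma polytime_Pair [polytime_intro]:
  assumes "polytime f" "polytime g"
  shows "polytime (\<lambda>x. (f x, g x))"
proof -
  obtain cf Tf where f: "wf_cmd cf" "polyb Tf" "\<And>x r. runs cf (enc x @ r) (Tf x) (enc (f x) @ r)"
    using assms(1) unfolding polytime_def by blast
  obtain cg Tg where g: "wf_cmd cg" "polyb Tg" "\<And>x r. runs cg (enc x @ r) (Tg x) (enc (g x) @ r)"
    using assms(2) unfolding polytime_def by blast
  show ?thesis
  proof (rule polytimeI)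
    show "wf_cmd (dup_cmd ;; cg ;; swap_cmd ;; cf ;; Push 0 2)" using f g by simp
    show "runs (dup_cmd ;; cg ;; swap_cmd ;; cf ;; Push 0 2) (enc x @ r)
      (50 * sz x + (Tg x + (25 * (sz (g x) + sz x) + (Tf x + 2)))) (enc (f x, g x) @ r)" for x r
      unfolding enc_Pair append_Cons append_assoc
      by (rule runs_Seq[OF runs_dup' runs_Seq[OF g(3) runs_Seq[OF runs_swap' runs_Seq[OF f(3) runs_Push]]]])
  qed (intro polyb_intros f g assms)
qed

lemma polytime_fst0: "polytime fst"
proof (rule polytimeI)
  show "runs (Pop 0 ;; swap_cmd ;; drop_cmd) (enc p @ r)
    (1 + (25 * (sz (fst p) + sz (snd p)) + 25 * sz (snd p))) (enc (fst p) @ r)" for p :: "'a \<times> 'b" and r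
    unfolding enc_Pair[of "fst p" "snd p", simplified] append_Cons append_assoc
    by (rule runs_Seq[OF runs_Pop runs_Seq[OF runs_swap' runs_drop']])
  have "polyb (\<lambda>p :: 'a \<times> 'b. 1 + (25 * (sz p + sz p) + 25 * sz p))" by (intro polyb_intros)
  then show "polyb (\<lambda>p :: 'a \<times> 'b. 1 + (25 * (sz (fst p) + sz (snd p)) + 25 * sz (snd p)))"
    by (rule polyb_mono) (case_tac x, simp)
qed simp

lemma polytime_snd0: "polytime snd"
proof (rule polytimeI)
  show "runs (Pop 0 ;; drop_cmd) (enc p @ r)
    (1 + 25 * sz (fst p)) (enc (snd p) @ r)" for p :: "'a \<times> 'b" and r
    unfolding enc_Pair[of "fst p" "snd p", simplified] append_Cons append_assoc
    by (rule runs_Seq[OF runs_Pop runs_drop'])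
  have "polyb (\<lambda>p :: 'a \<times> 'b. 1 + 25 * sz p)" by (intro polyb_intros)
  then show "polyb (\<lambda>p :: 'a \<times> 'b. 1 + 25 * sz (fst p))"
    by (rule polyb_mono) (case_tac x, simp)
qed simp

lemmas polytime_fst [polytime_intro] = polytime_comp[OF polytime_fst0]
lemmas polytime_snd [polytime_intro] = polytime_comp[OF polytime_snd0]

lemma polytime_comp2:
  assumes "polytime (\<lambda>p. f (fst p) (snd p))" "polytime g" "polytime h"
  shows "polytime (\<lambda>x. f (g x) (h x))"
  using polytime_comp[OF assms(1) polytime_Pair[OF assms(2,3)]] by simp

lemma polytime_comp3:
  assumes "polytime (\<lambda>p. f (fst p) (fst (snd p)) (snd (snd p)))" "polytime g" "polytime h" "polytime i"
  shows "polytime (\<lambda>x. f (g x) (h x) (i x))"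
  using polytime_comp[OF assms(1) polytime_Pair[OF assms(2) polytime_Pair[OF assms(3,4)]]] by simp

lemma polytime_Cons [polytime_intro]:
  assumes "polytime f" "polytime g"
  shows "polytime (\<lambda>x. f x # g x)"
proof -
  have "polytime (\<lambda>p :: 'b \<times> 'b list. fst p # snd p)"
    by (rule polytime_cast) (simp add: to_tree_prod_def)
  from polytime_comp2[OF this assms] show ?thesis .
qed

lemma polytime_Suc [polytime_intro]: assumes "polytime f" shows "polytime (\<lambda>x. Suc (f x))"
proof -
  have "polytime (\<lambda>p :: unit \<times> nat. Suc (snd p))"
    by (rule polytime_cast) (simp add: to_tree_prod_def to_tree_unit_def)
  from polytime_comp[OF this polytime_Pair[OF polytime_const assms]] show ?thesis by simp
qed

text \<open>The code of a nonempty \<open>l x\<close> is already that of the pair of its head and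
  tail. Once \<open>x\<close> and the node symbol are put on top of it, the stack holds the argument
  \<open>(x, a, as)\<close>.\<close>

lemma polytime_case_list0:
  assumes "polytime l" "polytime f" "polytime g"
  shows "polytime (\<lambda>x. case l x of [] \<Rightarrow> f x | a # as \<Rightarrow> g (x, a, as))"
proof -
  obtain cl Tl where l: "wf_cmd cl" "polyb Tl" "\<And>x r. runs cl (enc x @ r) (Tl x) (enc (l x) @ r)"
    using assms(1) unfolding polytime_def by blast
  obtain cf Tf where f: "wf_cmd cf" "polyb Tf" "\<And>x r. runs cf (enc x @ r) (Tf x) (enc (f x) @ r)"
    using assms(2) unfolding polytime_def by blast
  obtain cg Tg where g: "wf_cmd cg" "polyb Tg" "\<And>x r. runs cg (enc x @ r) (Tg x) (enc (g x) @ r)"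
    using assms(3) unfolding polytime_def by blast
  obtain k where k: "\<And>z. Tg z \<le> (sz z + 2) ^ k" using g(2) unfolding polyb_def by blast
  let ?c = "dup_cmd ;; cl ;; IfTop 0 {2} (swap_cmd ;; Push 0 2 ;; cg) (drop_cmd ;; cf)"
  \<comment> \<open>A bound for \<open>Tg (x, a, as)\<close> in terms of \<open>x\<close> alone,
    which makes sense also where \<open>l x\<close> is empty and there is no such triple.\<close>
  let ?B = "\<lambda>x. (sz x + sz (l x) + 1 + 2) ^ k"
  let ?T = "\<lambda>x. 50 * sz x + (Tl x + (25 * (sz (l x) + sz x) + 2 + (Tf x + ?B x) + 2))"
  show ?thesis
  proof (rule polytimeI)
    show "wf_cmd ?c" using l f g by simp
    show "polyb ?T" by (intro polyb_intros polyb_power l f g assms)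
    show "runs ?c (enc x @ r) (?T x) (enc (case l x of [] \<Rightarrow> f x | a # as \<Rightarrow> g (x, a, as)) @ r)" for x r
    proof (rule runs_Seq[OF runs_dup' runs_Seq[OF l(3)]])
      show "runs (IfTop 0 {2} (swap_cmd ;; Push 0 2 ;; cg) (drop_cmd ;; cf)) (enc (l x) @ enc x @ r)
        (25 * (sz (l x) + sz x) + 2 + (Tf x + ?B x) + 2) (enc (case l x of [] \<Rightarrow> f x | a # as \<Rightarrow> g (x, a, as)) @ r)"
      proof (cases "l x")
        case Nil
        have "runs drop_cmd (enc (l x) @ enc x @ r) (25 * sz (l x)) (enc x @ r)" by (rule runs_drop')
        from runs_Seq[OF this f(3)] Nil show ?thesis
          by (intro runs_IfF) (auto simp: enc_Nil elim!: runs_mono)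
      next
        case (Cons a as)
        have eq: "enc (x, a, as) @ r = 2 # enc x @ enc (l x) @ r"
          by (simp add: Cons enc_Pair enc_Cons)
        have "runs swap_cmd (enc (l x) @ enc x @ r) (25 * (sz (l x) + sz x)) (enc x @ enc (l x) @ r)"
          by (rule runs_swap')
        from runs_Seq[OF this runs_Seq[OF runs_Push g(3)[of "(x, a, as)" r, unfolded eq]]]
        have "runs (swap_cmd ;; Push 0 2 ;; cg) (enc (l x) @ enc x @ r)
          (25 * (sz (l x) + sz x) + (2 + Tg (x, a, as))) (enc (g (x, a, as)) @ r)" .
        moreover have "Tg (x, a, as) \<le> ?B x"
          using k[of "(x, a, as)"] Cons by (simp add: add.assoc)
        ultimately show ?thesis using Cons
          by (intro runs_IfT) (auto simp: enc_Cons elim!: runs_mono)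
      qed
    qed
  qed
qed

lemma polytime_case_list [polytime_intro]:
  assumes "polytime l" "polytime f" "polytime (\<lambda>p. g (fst p) (fst (snd p)) (snd (snd p)))"
  shows "polytime (\<lambda>x. case l x of [] \<Rightarrow> f x | a # as \<Rightarrow> g x a as)"
  using polytime_case_list0[OF assms] by (simp cong: list.case_cong)

lemma polytime_If [polytime_intro]:
  assumes "polytime b" "polytime f" "polytime g"
  shows "polytime (\<lambda>x. if b x then f x else g x)"
proof -
  \<comment> \<open>The codes agree, so the case distinction on lists also serves truth
    values.\<close>
  have "polytime (\<lambda>c. if c then [()] else [])"
    by (rule polytime_cast) (simp add: to_tree_bool_def to_tree_unit_def)
  then have "polytime (\<lambda>x. case (if b x then [()] else []) of [] \<Rightarrow> g x | a # as \<Rightarrow> f x)"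
    by (intro polytime_case_list assms polytime_comp[OF _ assms(1)] polytime_comp[OF assms(2)] polytime_intro)
  moreover have "(\<lambda>x. case (if b x then [()] else []) of [] \<Rightarrow> g x | a # as \<Rightarrow> f x) = (\<lambda>x. if b x then f x else g x)"
    by auto
  ultimately show ?thesis by (simp only:)
qed

text \<open>The program tests only \<open>b\<close>; the count \<open>n x\<close> belongs to the
  analysis and is not computed. The bound \<open>B\<close> on the intermediate states is essential,
  since iterated polynomial growth need not stay polynomial.\<close>

lemma polytime_while:
  fixes b :: "'s::encodable \<Rightarrow> bool" and g :: "'s \<Rightarrow> 's" and h :: "'a::encodable \<Rightarrow> 's"
  assumes "polytime b" "polytime g" "polytime h" "polyb n" "polyb B"
    and b: "\<And>x i. i < n x \<Longrightarrow> b ((g ^^ i) (h x))" "\<And>x. \<not> b ((g ^^ n x) (h x))"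
    and B: "\<And>x i. i \<le> n x \<Longrightarrow> sz ((g ^^ i) (h x)) \<le> B x"
  shows "polytime (\<lambda>x. (g ^^ n x) (h x))"
proof -
  obtain cb Tb where cb: "wf_cmd cb" "polyb Tb" "\<And>x r. runs cb (enc x @ r) (Tb x) (enc (b x) @ r)"
    using assms(1) unfolding polytime_def by blast
  obtain cg Tg where cg: "wf_cmd cg" "polyb Tg" "\<And>x r. runs cg (enc x @ r) (Tg x) (enc (g x) @ r)"
    using assms(2) unfolding polytime_def by blast
  obtain ch Th where ch: "wf_cmd ch" "polyb Th" "\<And>x r. runs ch (enc x @ r) (Th x) (enc (h x) @ r)"
    using assms(3) unfolding polytime_def by blast
  have "polyb (\<lambda>x. Tg x + 50 * sz (g x) + Tb (g x) + Tb x + 50 * sz x)"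
    by (intro polyb_intros cb cg polyb_comp[OF cb(2)] assms)
  then obtain k where k: "\<And>x. Tg x + 50 * sz (g x) + Tb (g x) + Tb x + 50 * sz x \<le> (sz x + 2) ^ k"
    unfolding polyb_def by blast
  let ?body = "drop_cmd ;; cg ;; dup_cmd ;; cb"
  let ?loop = "WhileTop 0 {2} ?body"
  let ?S = "\<lambda>x. (B x + 2) ^ k"
  \<comment> \<open>Besides the polynomial part, an iteration takes \<open>25 * 3\<close> steps to
    drop the code of \<open>True\<close> and 2 for the test and the back jump, hence 77.\<close>
  have loop: "runs ?loop (enc (b ((g ^^ i) (h x))) @ enc ((g ^^ i) (h x)) @ r) ((?S x + 77) * (n x - i) + 1)
      (enc False @ enc ((g ^^ n x) (h x)) @ r)" if "i \<le> n x" for x i r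
    using that
  proof (induction "n x - i" arbitrary: i)
    case 0
    then have [simp]: "i = n x" by simp
    have "b ((g ^^ n x) (h x)) = False" using b by simp
    then have "runs ?loop (enc (b ((g ^^ i) (h x))) @ enc ((g ^^ i) (h x)) @ r) 1
      (enc False @ enc ((g ^^ n x) (h x)) @ r)"
      by (simp only: \<open>i = n x\<close>) (rule runs_WhileF, simp add: enc_bool)
    then show ?case by (rule runs_mono) simp
  next
    case (Suc d)
    let ?y = "(g ^^ i) (h x)"
    have i: "i < n x" using Suc by linarith
    then have bt: "b ?y" using b by blast
    have "sz ?y \<le> B x" using i B by simp
    then have S: "Tg ?y + 50 * sz (g ?y) + Tb (g ?y) + 50 * sz ?y \<le> ?S x"
      using k[of ?y] power_mono[of "sz ?y + 2" "B x + 2" k] by linarith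
    have body: "runs ?body (enc (b ?y) @ enc ?y @ r) (25 * sz (b ?y) + (Tg ?y + (50 * sz (g ?y) + Tb (g ?y))))
      (enc (b (g ?y)) @ enc (g ?y) @ r)"
      by (rule runs_Seq[OF runs_drop' runs_Seq[OF cg(3) runs_Seq[OF runs_dup' cb(3)]]])
    have IH: "runs ?loop (enc (b (g ?y)) @ enc (g ?y) @ r) ((?S x + 77) * (n x - Suc i) + 1)
      (enc False @ enc ((g ^^ n x) (h x)) @ r)"
      using Suc.hyps(1)[of "Suc i"] Suc.hyps(2) i by simp
    have eq: "n x - i = Suc (n x - Suc i)" using i by simp
    have "runs ?loop (enc (b ?y) @ enc ?y @ r)
      ((25 * sz (b ?y) + (Tg ?y + (50 * sz (g ?y) + Tb (g ?y)))) + ((?S x + 77) * (n x - Suc i) + 1) + 2)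
      (enc False @ enc ((g ^^ n x) (h x)) @ r)"
      by (rule runs_WhileT[OF _ body IH]) (use bt in \<open>simp add: enc_bool\<close>)
    then show ?case
      by (rule runs_mono) (use S bt in \<open>simp add: eq del: power_Suc\<close>)
  qed
  let ?c = "ch ;; dup_cmd ;; cb ;; ?loop ;; drop_cmd"
  let ?T = "\<lambda>x. Th x + (50 * sz (h x) + (Tb (h x) + (((?S x + 77) * n x + 1) + 25 * 1)))"
  show ?thesis
  proof (rule polytimeI)
    show "wf_cmd ?c" using cb cg ch by simp
    show "polyb ?T" by (intro polyb_intros polyb_power cb ch assms polyb_comp[OF cb(2)])
    show "runs ?c (enc x @ r) (?T x) (enc ((g ^^ n x) (h x)) @ r)" for x r
      using loop[of 0 x r] runs_drop'[of False "enc ((g ^^ n x) (h x)) @ r"]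
      by (intro runs_Seq[OF ch(3)] runs_Seq[OF runs_dup'] runs_Seq[OF cb(3)] runs_Seq) auto
  qed
qed

text \<open>A while loop on triples of parameter, remaining list and accumulator; the parameter is
  carried along because \<open>f\<close> depends on it.\<close>

lemma polytime_fold:
  assumes "polytime l" "polytime s" "polytime (\<lambda>p. f (fst p) (fst (snd p)) (snd (snd p)))" "polyb B"
    and B: "\<And>x i. i \<le> length (l x) \<Longrightarrow> sz (fold (f x) (take i (l x)) (s x)) \<le> B x"
  shows "polytime (\<lambda>x. fold (f x) (l x) (s x))"
proof -
  define b where "b = (\<lambda>p :: 'a \<times> 'b list \<times> 'c. case fst (snd p) of [] \<Rightarrow> False | _ # _ \<Rightarrow> True)"
  define g where "g = (\<lambda>p :: 'a \<times> 'b list \<times> 'c. case fst (snd p) of [] \<Rightarrow> p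
    | a # as \<Rightarrow> (fst p, as, f (fst p) a (snd (snd p))))"
  have pb: "polytime b" unfolding b_def by (intro polytime_intro)
  have pg: "polytime g" unfolding g_def
    by (intro polytime_intro polytime_comp3[OF assms(3)])
  have gi: "(g ^^ i) (x, l', t) = (x, drop i l', fold (f x) (take i l') t)" if "i \<le> length l'" for x i l' t
    using that
  proof (induction i arbitrary: l' t)
    case (Suc i)
    then obtain a as where "l' = a # as" by (cases l') auto
    then show ?case using Suc by (simp add: funpow_Suc_right g_def del: funpow.simps)
  qed simp
  have "polytime (\<lambda>x. (g ^^ length (l x)) (x, l x, s x))"
  proof (rule polytime_while)
    show "polyb (\<lambda>x. length (l x))"
      by (rule polyb_mono[OF polyb_sz_polytime[OF assms(1)]]) (rule length_le_sz)
    show "polyb (\<lambda>x. 2 + sz x + sz (l x) + B x)" by (intro polyb_intros assms)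
    show "sz ((g ^^ i) (x, l x, s x)) \<le> 2 + sz x + sz (l x) + B x" if "i \<le> length (l x)" for x i
      using B[OF that] sz_drop[of i "l x"] that by (simp add: gi)
    show "b ((g ^^ i) (x, l x, s x))" if "i < length (l x)" for x i
      using that by (simp add: gi b_def Cons_nth_drop_Suc[symmetric])
    show "\<not> b ((g ^^ length (l x)) (x, l x, s x))" for x
      by (simp add: gi b_def)
  qed (intro polytime_intro pb pg assms)+
  then have "polytime (\<lambda>x. snd (snd ((g ^^ length (l x)) (x, l x, s x))))"
    by (intro polytime_intro)
  then show ?thesis by (simp add: gi)
qed

text \<open>The measure \<open>m\<close> replaces the size, which for a list of bits depends on the digits and not only
  on their number.\<close>

lemma polytime_fold_measure:
  assumes "polytime l" "polytime s" "polytime (\<lambda>p. f (fst p) (fst (snd p)) (snd (snd p)))" "polyb B"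
    and m: "\<And>t. sz t \<le> c * m t + c" "\<And>t. m t \<le> sz t"
    and B: "\<And>x a t. a \<in> set (l x) \<Longrightarrow> m (f x a t) \<le> m t + B x"
  shows "polytime (\<lambda>x. fold (f x) (l x) (s x))"
proof (rule polytime_fold[OF assms(1-3)])
  have *: "m (fold (f x) l' t) \<le> m t + length l' * B x" if "set l' \<subseteq> set (l x)" for l' x t
    using that
  proof (induction l' arbitrary: t)
    case (Cons a l')
    then have "m (fold (f x) l' (f x a t)) \<le> m (f x a t) + length l' * B x" by (intro Cons.IH) auto
    moreover have "m (f x a t) \<le> m t + B x" using Cons.prems by (intro B) auto
    ultimately show ?case by simp
  qed simp
  show "polyb (\<lambda>x. c * (sz (s x) + sz (l x) * B x) + c)" by (intro polyb_intros assms)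
  show "sz (fold (f x) (take i (l x)) (s x)) \<le> c * (sz (s x) + sz (l x) * B x) + c" if "i \<le> length (l x)" for x i
  proof -
    have "m (fold (f x) (take i (l x)) (s x)) \<le> m (s x) + i * B x"
      using *[of "take i (l x)" x "s x"] set_take_subset[of i "l x"] that by (simp add: min_absorb2)
    also have "\<dots> \<le> sz (s x) + sz (l x) * B x"
      using m(2)[of "s x"] that length_le_sz[of "l x"] by (intro add_mono mult_right_mono) auto
    finally have "c * m (fold (f x) (take i (l x)) (s x)) + c \<le> c * (sz (s x) + sz (l x) * B x) + c"
      by simp
    then show ?thesis using m(1) le_trans by blast
  qed
qed

text \<open>If each step adds an amount that depends on the parameter alone, the accumulator stays
  polynomial over a list of polynomial length.\<close>

lemmas polytime_fold_grow = polytime_fold_measure[where m = sz and c = 1, simplified]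

section \<open>Basic functions on lists and unary numbers\<close>

lemma sz_append: "Suc (sz (xs @ ys)) = sz xs + sz ys"
  by (induction xs) auto

lemma sz_rev [simp]: "sz (rev xs) = sz xs"
proof (induction xs)
  case (Cons a xs)
  then show ?case using sz_append[of "rev xs" "[a]"] by simp
qed simp

lemma sz_tl: "sz (tl xs) \<le> sz xs"
  by (cases xs) auto

lemma polytime_bounded_on:
  assumes "polytime (\<lambda>p. f (fst p) (snd p))" "polytime l"
  obtains B where "polyb B" "\<And>x a. a \<in> set (l x) \<Longrightarrow> sz (f x a) \<le> B x"
proof -
  obtain k where k: "\<And>p. sz (f (fst p) (snd p)) \<le> (sz p + 2) ^ k"
    using polyb_sz_polytime[OF assms(1)] unfolding polyb_def by blast
  show thesis
  proof (rule that)
    show "polyb (\<lambda>x. (sz x + sz (l x) + 3) ^ k)" by (intro polyb_power polyb_intros assms)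
    show "sz (f x a) \<le> (sz x + sz (l x) + 3) ^ k" if "a \<in> set (l x)" for x a
      using k[of "(x, a)"] power_mono[of "sz (x, a) + 2" "sz x + sz (l x) + 3" k] sz_mem[OF that] by simp
  qed
qed

lemma polytime_conj [polytime_intro]:
  "polytime f \<Longrightarrow> polytime g \<Longrightarrow> polytime (\<lambda>x. f x \<and> g x)"
  using polytime_If[OF _ _ polytime_const[of False]] by (simp add: if_bool_eq_disj)

lemma polytime_not [polytime_intro]: "polytime f \<Longrightarrow> polytime (\<lambda>x. \<not> f x)"
  using polytime_If[OF _ polytime_const[of False] polytime_const[of True]] by (simp add: if_bool_eq_disj)

lemma polytime_disj [polytime_intro]:
  "polytime f \<Longrightarrow> polytime g \<Longrightarrow> polytime (\<lambda>x. f x \<or> g x)"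
  using polytime_not[OF polytime_conj[OF polytime_not polytime_not]] by simp

lemma polytime_eq_bool [polytime_intro]:
  fixes f g :: "'a::encodable \<Rightarrow> bool"
  assumes "polytime f" "polytime g" shows "polytime (\<lambda>x. f x = g x)"
proof -
  have "(\<lambda>x. f x = g x) = (\<lambda>x. if f x then g x else \<not> g x)" by auto
  then show ?thesis using polytime_If[OF assms polytime_not[OF assms(2)]] by simp
qed

lemma polytime_tl [polytime_intro]:
  assumes "polytime l" shows "polytime (\<lambda>x. tl (l x))"
proof -
  have "(\<lambda>x. tl (l x)) = (\<lambda>x. case l x of [] \<Rightarrow> [] | a # as \<Rightarrow> as)" by (auto split: list.split)
  moreover have "polytime \<dots>" by (intro polytime_intro assms)
  ultimately show ?thesis by simp
qed

lemma polytime_is_Nil [polytime_intro]: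
  assumes "polytime l" shows "polytime (\<lambda>x. l x = [])"
proof -
  have "(\<lambda>x. l x = []) = (\<lambda>x. case l x of [] \<Rightarrow> True | a # as \<Rightarrow> False)"
    by (auto simp: fun_eq_iff split: list.split)
  moreover have "polytime \<dots>" by (intro polytime_intro assms)
  ultimately show ?thesis by simp
qed

lemma polytime_rev [polytime_intro]:
  assumes "polytime l" shows "polytime (\<lambda>x. rev (l x))"
proof -
  have "polytime (\<lambda>x. fold (\<lambda>a as. a # as) (l x) [])"
  proof (rule polytime_fold_grow)
    show "polyb (\<lambda>x. Suc (sz (l x)))" using polyb_add[OF polyb_const[of 1] polyb_sz_polytime[OF assms]] by simp
    show "sz (a # t) \<le> sz t + Suc (sz (l x))" if "a \<in> set (l x)" for x a t
      using sz_mem[OF that] by simp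
  qed (intro polytime_intro assms)+
  then show ?thesis by (simp add: fold_Cons_rev)
qed

lemma polytime_append [polytime_intro]:
  assumes "polytime f" "polytime g" shows "polytime (\<lambda>x. f x @ g x)"
proof -
  have "polytime (\<lambda>x. fold (\<lambda>a as. a # as) (rev (f x)) (g x))"
  proof (rule polytime_fold_grow)
    show "polyb (\<lambda>x. Suc (sz (f x)))" using polyb_add[OF polyb_const[of 1] polyb_sz_polytime[OF assms(1)]] by simp
    show "sz (a # t) \<le> sz t + Suc (sz (f x))" if "a \<in> set (rev (f x))" for x a t
      using sz_mem[of a "f x"] that by simp
  qed (intro polytime_intro assms)+
  then show ?thesis by (simp add: fold_Cons_rev)
qed

lemma polytime_map [polytime_intro]:
  assumes "polytime (\<lambda>p. f (fst p) (snd p))" "polytime l"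
  shows "polytime (\<lambda>x. map (f x) (l x))"
proof -
  obtain B where B: "polyb B" "\<And>x a. a \<in> set (l x) \<Longrightarrow> sz (f x a) \<le> B x"
    using polytime_bounded_on[OF assms] by blast
  have "polytime (\<lambda>x. fold (\<lambda>a as. f x a # as) (l x) [])"
  proof (rule polytime_fold_grow)
    show "polyb (\<lambda>x. Suc (B x))" using polyb_add[OF polyb_const[of 1] B(1)] by simp
    show "sz (f x a # t) \<le> sz t + Suc (B x)" if "a \<in> set (l x)" for x a t
      using B(2)[OF that] by simp
  qed (intro polytime_intro assms polytime_comp2[OF assms(1)])+
  moreover have "fold (\<lambda>a as. f x a # as) l' acc = rev (map (f x) l') @ acc" for x l' acc
    by (induction l' arbitrary: acc) auto
  ultimately show ?thesis using polytime_rev by fastforce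
qed

lemma polytime_list_all [polytime_intro]:
  assumes "polytime (\<lambda>p. f (fst p) (snd p))" "polytime l"
  shows "polytime (\<lambda>x. list_all (f x) (l x))"
proof -
  have "polytime (\<lambda>x. fold (\<lambda>a b. b \<and> f x a) (l x) True)"
  proof (rule polytime_fold_grow)
    show "polyb (\<lambda>x. 3)" by simp
    show "sz (t \<and> f x a) \<le> sz t + 3" for x a t using sz_bool[of "t \<and> f x a"] by simp
  qed (intro polytime_intro assms polytime_comp2[OF assms(1)])+
  moreover have "fold (\<lambda>a b. b \<and> f x a) l' b \<longleftrightarrow> b \<and> list_all (f x) l'" for x l' b
    by (induction l' arbitrary: b) auto
  ultimately show ?thesis by simp
qed

lemma polytime_concat [polytime_intro]:
  assumes "polytime l" shows "polytime (\<lambda>x. concat (l x))"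
proof -
  have "polytime (\<lambda>x. fold (\<lambda>a as. as @ a) (l x) [])"
  proof (rule polytime_fold_grow)
    show "polyb (\<lambda>x. sz (l x))" by (rule polyb_sz_polytime[OF assms])
    show "sz (t @ a) \<le> sz t + sz (l x)" if "a \<in> set (l x)" for x a t
      using sz_mem[OF that] sz_append[of t a] by simp
  qed (intro polytime_intro assms)+
  moreover have "fold (\<lambda>a as. as @ a) l' acc = acc @ concat l'" for l' and acc :: "'b list"
    by (induction l' arbitrary: acc) auto
  ultimately show ?thesis by simp
qed

lemma polytime_units [polytime_intro]:
  assumes "polytime n" shows "polytime (\<lambda>x. replicate (n x) ())"
proof -
  have "to_tree (replicate n ()) = to_tree n" for n :: nat
    by (induction n) (auto simp: to_tree_unit_def)
  then have "polytime (\<lambda>n. replicate n ())" by (rule polytime_cast)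
  from polytime_comp[OF this assms] show ?thesis .
qed

lemma polytime_length [polytime_intro]:
  assumes "polytime l" shows "polytime (\<lambda>x. length (l x))"
proof -
  have "polytime (\<lambda>x. fold (\<lambda>_. Suc) (l x) 0)"
  proof (rule polytime_fold_grow)
    show "polyb (\<lambda>x. 2)" by simp
  qed (intro polytime_intro assms | simp)+
  moreover have "fold (\<lambda>_. Suc) l' n = n + length l'" for l' :: "'b list" and n
    by (induction l' arbitrary: n) auto
  ultimately show ?thesis by simp
qed

lemma polytime_add_nat [polytime_intro]:
  fixes f g :: "'a::encodable \<Rightarrow> nat"
  assumes "polytime f" "polytime g" shows "polytime (\<lambda>x. f x + g x)"
proof -
  have "polytime (\<lambda>x. length (replicate (f x) () @ replicate (g x) ()))"
    by (intro polytime_intro assms)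
  then show ?thesis by simp
qed

lemma polytime_mult_nat [polytime_intro]:
  fixes f g :: "'a::encodable \<Rightarrow> nat"
  assumes "polytime f" "polytime g" shows "polytime (\<lambda>x. f x * g x)"
proof -
  have "polytime (\<lambda>x. length (concat (map (\<lambda>_. replicate (g x) ()) (replicate (f x) ()))))"
    by (intro polytime_intro assms polytime_comp[OF assms(2)])
  then show ?thesis by (simp add: map_replicate_const length_concat sum_list_replicate)
qed

lemma polytime_upt [polytime_intro]:
  assumes "polytime n" shows "polytime (\<lambda>x. [0..<n x])"
proof -
  \<comment> \<open>The accumulator lists the earlier indices backwards, so its length is the next
    index.\<close>
  have "((\<lambda>as. length as # as) ^^ i) [] = rev [0..<i]" for i
    by (induction i) auto
  then have *: "fold (\<lambda>_ as. length as # as) (replicate i ()) [] = rev [0..<i]" for i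
    by simp
  \<comment> \<open>An explicit bound, since here the increment depends on the accumulator.\<close>
  have s: "sz [0..<i] \<le> 1 + i * (2 * i + 2)" for i
  proof -
    have "Suc (sz xs) = Suc (Suc (sum_list (map (\<lambda>n. Suc (sz n)) xs)))" for xs :: "nat list"
      by (induction xs) auto
    moreover have "sum_list (map (\<lambda>n. Suc (sz n)) [0..<i]) \<le> sum_list (map (\<lambda>_. 2 * i + 2) [0..<i])"
      by (rule sum_list_mono) (auto simp: sz_nat)
    ultimately show ?thesis by (simp add: map_replicate_const sum_list_replicate)
  qed
  have "polytime (\<lambda>x. fold (\<lambda>_ as. length as # as) (replicate (n x) ()) [])"
  proof (rule polytime_fold)
    show "polyb (\<lambda>x. 1 + sz (n x) * (2 * sz (n x) + 2))" by (intro polyb_intros assms)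
    show "sz (fold (\<lambda>_ as. length as # as) (take i (replicate (n x) ())) []) \<le> 1 + sz (n x) * (2 * sz (n x) + 2)"
      if "i \<le> length (replicate (n x) ())" for x i
    proof -
      have "i \<le> sz (n x)" using that by (simp add: sz_nat)
      then have "1 + i * (2 * i + 2) \<le> 1 + sz (n x) * (2 * sz (n x) + 2)"
        by (intro add_left_mono mult_mono) auto
      moreover have "take i (replicate (n x) ()) = replicate i ()" using that by (simp add: min_absorb1)
      ultimately show ?thesis using s[of i] by (simp only: * sz_rev)
    qed
  qed (intro polytime_intro assms)+
  from polytime_rev[OF this] show ?thesis by (simp only: * rev_rev_ident)
qed

definition nth_default :: "'a \<Rightarrow> 'a list \<Rightarrow> nat \<Rightarrow> 'a" where
  "nth_default d l i = (if i < length l then l ! i else d)"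

lemma polytime_nth_default [polytime_intro]:
  assumes "polytime d" "polytime l" "polytime i"
  shows "polytime (\<lambda>x. nth_default (d x) (l x) (i x))"
proof -
  have "polytime (\<lambda>x. fold (\<lambda>_ as. tl as) (replicate (i x) ()) (l x))"
  proof (rule polytime_fold_grow)
    show "polyb (\<lambda>x. 0)" by simp
  qed (intro polytime_intro assms | simp add: sz_tl)+
  moreover have "(tl ^^ n) l' = drop n l'" for n and l' :: "'b list"
    by (induction n) (auto simp: drop_Suc tl_drop)
  ultimately have d: "polytime (\<lambda>x. drop (i x) (l x))"
    by simp
  have "polytime (\<lambda>x. case drop (i x) (l x) of [] \<Rightarrow> d x | a # as \<Rightarrow> a)"
    by (intro polytime_intro d assms)
  moreover have "(case drop n l' of [] \<Rightarrow> e | a # as \<Rightarrow> a) = nth_default e l' n" for n l' and e :: 'b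
    by (cases "n < length l'") (auto simp: nth_default_def Cons_nth_drop_Suc[symmetric])
  ultimately show ?thesis by simp
qed

lemma polytime_eq_bits [polytime_intro]:
  fixes f g :: "'a::encodable \<Rightarrow> bool list"
  assumes "polytime f" "polytime g" shows "polytime (\<lambda>x. f x = g x)"
proof -
  \<comment> \<open>The flag records agreement so far. It is cleared if the second list ends too
    early, and a leftover of the second list is detected at the end.\<close>
  define st where "st = (\<lambda>(a :: bool) p. case snd p of [] \<Rightarrow> (False, []) | b # bs \<Rightarrow> (fst p \<and> a = b, bs))"
  have "polytime (\<lambda>x. fold st (f x) (True, g x))"
  proof (rule polytime_fold_grow)
    show "polyb (\<lambda>x. 3)" by simp
    show "sz (st a t) \<le> sz t + 3" for a and t :: "bool \<times> bool list"
    proof (cases "snd t")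
      case (Cons b bs)
      then show ?thesis using sz_bool[of "fst t \<and> a = b"] by (cases t) (auto simp: st_def)
    qed (auto simp: st_def)
    show "polytime (\<lambda>p. st (fst (snd p)) (snd (snd p)))" unfolding st_def by (intro polytime_intro)
  qed (intro polytime_intro assms)+
  then have "polytime (\<lambda>x. fst (fold st (f x) (True, g x)) \<and> snd (fold st (f x) (True, g x)) = [])"
    by (intro polytime_intro)
  moreover have eq: "fst (fold st l p) \<and> snd (fold st l p) = [] \<longleftrightarrow> fst p \<and> snd p = l" for l p
  proof (induction l arbitrary: p)
    case (Cons a l)
    show ?case
    proof (cases "snd p")
      case Nil
      have "\<not> fst (fold st l (False, q))" for q
        by (induction l arbitrary: q) (auto simp: st_def split: list.split)
      then show ?thesis using Nil by (simp add: st_def)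
    next
      case (Cons b bs)
      have "st a p = (fst p \<and> a = b, bs)" using Cons by (simp add: st_def)
      then show ?thesis using Cons.IH[of "st a p"] Cons by auto
    qed
  qed auto
  moreover have "(\<lambda>x. fst (fold st (f x) (True, g x)) \<and> snd (fold st (f x) (True, g x)) = []) = (\<lambda>x. f x = g x)"
    unfolding eq by auto
  ultimately show ?thesis by (simp only:)
qed

section \<open>From polynomial time functions to Turing machines\<close>

definition symbol_pair :: "nat \<Rightarrow> bool \<times> bool" where
  "symbol_pair a = (if a = 1 then (False, False) else if a = 2 then (False, True) else (True, False))"

text \<open>The code of a list starts with its first element, so it is built from the last symbol
  backwards; tape 1 supplies the symbols in that order.\<close>

definition read_input :: cmd where
  "read_input = drain 0 (Push 1) ;; Push 0 1 ;; drain 1 (\<lambda>a. push_all (2 # enc (symbol_pair a)))"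

lemma enc_symbol_pair:
  "enc (symbol_pair 1) = [2, 1, 1]" "enc (symbol_pair 2) = [2, 1, 2, 1, 1]" "enc (symbol_pair 3) = [2, 2, 1, 1, 1]"
  by (simp_all add: symbol_pair_def enc_Pair enc_bool)

lemma wf_read_input: "wf_cmd read_input"
  unfolding read_input_def drain_def enc_symbol_pair by (simp add: nop_def)

lemma runs_read_input:
  assumes "set w \<subseteq> {1, 2, 3}"
  shows "runs read_input w (30 * length w + 4) (enc (map symbol_pair w))"
proof -
  let ?c = "\<lambda>a. push_all (2 # enc (symbol_pair a))"
  have 1: "\<exists>t\<le>8 * length w + 1. exec (drain 0 (Push 1)) (stacks4 w [] [] []) t (stacks4 [] (rev w) [] [])"
    using exec_pour(1)[OF assms, of "[]"] by simp
  have 2: "\<exists>t\<le>2. exec (Push 0 1) (stacks4 [] (rev w) [] []) t (stacks4 (enc ([] :: (bool \<times> bool) list)) (rev w) [] [])"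
    using exec_Push[of 0 1 "stacks4 [] (rev w) [] []"] unfolding stacks4_simps enc_Nil by blast
  have push: "\<exists>t\<le>15. exec (?c a) (stacks4 (enc l) v [] []) t (stacks4 (enc (symbol_pair a # l)) v [] [])"
    if "a \<in> {1, 2, 3}" for a l v
  proof (intro exI conjI)
    show "exec (?c a) (stacks4 (enc l) v [] []) (2 * length (2 # enc (symbol_pair a)) + 3)
        (stacks4 (enc (symbol_pair a # l)) v [] [])"
      using exec_push_all[of "2 # enc (symbol_pair a)" "stacks4 (enc l) v [] []"]
      unfolding stacks4_simps enc_Cons append_Cons .
    show "2 * length (2 # enc (symbol_pair a)) + 3 \<le> 15" using that enc_symbol_pair by auto
  qed
  have fold: "fold (\<lambda>a l. symbol_pair a # l) v l = map symbol_pair (rev v) @ l" for v l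
    by (induction v arbitrary: l) auto
  have 3: "\<exists>t\<le>21 * length w + 1. exec (drain 1 ?c) (stacks4 (enc ([] :: (bool \<times> bool) list)) (rev w) [] []) t
      (stacks4 (enc (map symbol_pair w)) [] [] [])"
    using exec_drain[of "\<lambda>w l. stacks4 (enc l) w [] []" 1 15 ?c "\<lambda>a l. symbol_pair a # l" "rev w" "[]",
        OF stacks4_simps(2) stacks4_simps(6) push] assms by (simp add: fold)
  show ?thesis
    unfolding runs_def read_input_def main_stack_eq_stacks4
    using exec_le_Seq[OF 1 exec_le_Seq[OF 2 3]] by (elim exE conjE, intro exI conjI) auto
qed

definition split_input :: "(bool \<times> bool) list \<Rightarrow> bool list list" where
  "split_input l = rev (snd (fold (\<lambda>a p. if fst a then ([], rev (fst p) # snd p) else (snd a # fst p, snd p)) l ([], [])))"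

lemma split_input_tuple: "split_input (map symbol_pair (tuple_input ws)) = ws"
proof -
  let ?f = "\<lambda>a p. if fst a then ([], rev (fst p) # snd p) else (snd a # fst p, snd p)"
  have bits: "fold ?f (map symbol_pair (map bit_symbol w)) (cur, out) = (rev w @ cur, out)" for w cur out
  proof (induction w arbitrary: cur)
    case (Cons b w)
    then show ?case by (cases b) (auto simp: symbol_pair_def)
  qed simp
  have "fold ?f (map symbol_pair (tuple_input ws)) ([], out) = ([], rev ws @ out)" for out
  proof (induction ws arbitrary: out)
    case (Cons w ws)
    have "fold ?f (map symbol_pair (tuple_input (w # ws))) ([], out) =
        fold ?f (map symbol_pair (tuple_input ws)) (fold ?f [symbol_pair 3] (fold ?f (map symbol_pair (map bit_symbol w)) ([], out)))"
      by (simp add: tuple_input_def)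
    also have "\<dots> = ([], rev (w # ws) @ out)"
      unfolding bits by (simp add: symbol_pair_def Cons)
    finally show ?case .
  qed (simp add: tuple_input_def)
  then show ?thesis by (simp add: split_input_def)
qed

lemma polytime_split_input: "polytime split_input"
proof -
  let ?f = "\<lambda>(a :: bool \<times> bool) p. if fst a then ([] :: bool list, rev (fst p) # snd p) else (snd a # fst p, snd p)"
  have "polytime (\<lambda>l. fold ?f l ([], []))"
  proof (rule polytime_fold_grow)
    show "polyb (\<lambda>x. 5)" by simp
    show "sz (?f a t) \<le> sz t + 5" for a and t :: "bool list \<times> bool list list"
      using sz_bool[of "snd a"] by (cases t) auto
  qed (intro polytime_intro)+
  then show ?thesis unfolding split_input_def by (intro polytime_intro)
qed

theorem poly_time_decidable_polytime:
  assumes "polytime Q"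
  shows "poly_time_decidable n Q"
proof -
  have "polytime (\<lambda>l. Q (split_input l))"
    by (rule polytime_comp[OF assms polytime_split_input])
  then obtain c T where c: "wf_cmd c" "polyb T" "\<And>l r. runs c (enc l @ r) (T l) (enc (Q (split_input l)) @ r)"
    unfolding polytime_def by blast
  obtain k where k: "\<And>l. T l \<le> (sz l + 2) ^ k" using c(2) unfolding polyb_def by blast
  \<comment> \<open>\<open>30 * n + 4\<close> steps read the input of length \<open>n\<close>, and
    one more makes the bound strict. Each input symbol takes at most 6 symbols in the coded list,
    whence \<open>6 * n + 3\<close> for \<open>sz ?l + 2\<close>.\<close>
  define p :: "nat poly" where "p = [:5, 30:] + [:3, 6:] ^ k"
  show ?thesis
  proof (rule poly_time_decidable_exec[of "read_input ;; c" n p])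
    show "wf_cmd (read_input ;; c)" using wf_read_input c(1) by simp
    fix ws :: "bool list list"
    let ?w = "tuple_input ws" and ?l = "map symbol_pair (tuple_input ws)"
    have b: "bit_symbol b \<in> {1, 2, 3}" for b by (cases b) auto
    have w: "set ?w \<subseteq> {1, 2, 3}" unfolding tuple_input_def using b by auto
    have "sz (map symbol_pair v) \<le> 6 * length v + 1" for v
      by (induction v) (auto simp: symbol_pair_def)
    from this[of ?w] have "sz ?l + 2 \<le> 6 * length ?w + 3" by linarith
    then have "(sz ?l + 2) ^ k \<le> (6 * length ?w + 3) ^ k"
      by (intro power_mono) auto
    then have T: "T ?l \<le> (6 * length ?w + 3) ^ k" using k[of ?l] by linarith
    have "runs (read_input ;; c) ?w (30 * length ?w + 4 + T ?l) (enc (Q ws))"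
      using runs_Seq[OF runs_read_input[OF w] c(3)[of ?l "[]", simplified]] split_input_tuple[of ws] by simp
    then obtain t where t: "t \<le> 30 * length ?w + 4 + T ?l"
        "exec (read_input ;; c) (main_stack ?w) t (main_stack (enc (Q ws)))"
      unfolding runs_def by blast
    show "\<exists>t s'. exec (read_input ;; c) ((\<lambda>_. [])(0 := ?w)) t s' \<and>
        t < poly p (length ?w) \<and> (top_symbol (s' 0) = 2 \<longleftrightarrow> Q ws)"
    proof (intro exI conjI)
      show "exec (read_input ;; c) ((\<lambda>_. [])(0 := ?w)) t (main_stack (enc (Q ws)))"
        using t(2) unfolding main_stack_def .
      show "t < poly p (length ?w)"
        using t(1) T by (simp add: p_def algebra_simps)
      show "top_symbol (main_stack (enc (Q ws)) 0) = 2 \<longleftrightarrow> Q ws"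
        by (cases "Q ws") (auto simp: main_stack_def enc_bool)
    qed
  qed
qed

section \<open>Binary arithmetic\<close>

type_synonym bits = "bool list"

definition val :: "bits \<Rightarrow> nat" where
  "val = horner_sum of_bool 2"

lemma val_simps [simp]: "val [] = 0" "val (b # l) = of_bool b + 2 * val l"
  by (simp_all add: val_def)

lemma val_append: "val (k @ l) = val k + 2 ^ length k * val l"
  by (simp add: val_def horner_sum_append)

lemma val_eq_0: "val l = 0 \<longleftrightarrow> list_all Not l"
  by (induction l) auto

lemma val_less: "val l < 2 ^ length l"
  by (induction l) auto

definition digit :: "bits \<Rightarrow> bool" where
  "digit l = (case l of [] \<Rightarrow> False | b # _ \<Rightarrow> b)"

lemma digit_simps [simp]: "digit [] = False" "digit (b # l) = b"
  by (simp_all add: digit_def)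

lemma polytime_digit [polytime_intro]: "polytime l \<Longrightarrow> polytime (\<lambda>x. digit (l x))"
  unfolding digit_def by (intro polytime_intro)

lemma val_digit_tl: "val l = of_bool (digit l) + 2 * val (tl l)"
  by (cases l) auto

text \<open>The state consists of the carry, the remaining digits and the digits of the sum so far.\<close>

definition add_step :: "bool \<Rightarrow> bool \<times> bits \<times> bits \<times> bits \<Rightarrow> bool \<times> bits \<times> bits \<times> bits" where
  "add_step _ = (\<lambda>(c, a, b, s). if a = [] \<and> b = [] then (c, a, b, s) else
     (if c then digit a \<or> digit b else digit a \<and> digit b, tl a, tl b, (c = (digit a = digit b)) # s))"

text \<open>The list \<open>a @ b\<close> serves only as a clock with enough ticks. The last carry
  becomes the most significant digit.\<close>

definition add_bits :: "bits \<Rightarrow> bits \<Rightarrow> bits" where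
  "add_bits a b = (let p = fold add_step (a @ b) (False, a, b, []) in rev (fst p # snd (snd (snd p))))"

text \<open>Invariant: the value of the digits produced so far, plus \<open>2 ^ length s\<close>
  times what remains to be added, carry included. Once both lists are empty, further ticks change
  nothing.\<close>

lemma fold_add_step:
  assumes "length a \<le> length l" "length b \<le> length l"
  shows "\<exists>c' s'. fold add_step l (c, a, b, s) = (c', [], [], s') \<and>
    length s' = length s + max (length a) (length b) \<and>
    val (rev (c' # s')) = val (rev s) + 2 ^ length s * (of_bool c + val a + val b)"
  using assms
proof (induction l arbitrary: c a b s)
  case Nil
  then show ?case by (simp add: val_append)
next
  case (Cons x l)
  show ?case
  proof (cases "a = [] \<and> b = []")
    case True
    then have "add_step x (c, a, b, s) = (c, [], [], s)" by (simp add: add_step_def)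
    then show ?thesis using Cons.IH[of "[]" "[]" c s] True by simp
  next
    case False
    let ?c = "if c then digit a \<or> digit b else digit a \<and> digit b"
    let ?d = "c = (digit a = digit b)"
    have st: "add_step x (c, a, b, s) = (?c, tl a, tl b, ?d # s)"
      using False by (simp add: add_step_def)
    obtain c' s' where *: "fold add_step l (?c, tl a, tl b, ?d # s) = (c', [], [], s')"
        "length s' = length (?d # s) + max (length (tl a)) (length (tl b))"
        "val (rev (c' # s')) = val (rev (?d # s)) + 2 ^ length (?d # s) * (of_bool ?c + val (tl a) + val (tl b))"
    proof -
      have "length (tl a) \<le> length l" "length (tl b) \<le> length l" using Cons.prems by auto
      from Cons.IH[OF this, of ?c "?d # s"] show ?thesis using that by blast
    qed
    have len: "length s' = length s + max (length a) (length b)"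
      using *(2) False by (cases a; cases b) auto
    have "of_bool ?d + 2 * (of_bool ?c + val (tl a) + val (tl b)) = of_bool c + val a + val b"
      unfolding val_digit_tl[of a] val_digit_tl[of b] by (cases "digit a"; cases "digit b"; cases c) auto
    moreover have "val (rev (?d # s)) + 2 ^ length (?d # s) * y = val (rev s) + 2 ^ length s * (of_bool ?d + 2 * y)" for y
      by (simp add: val_append algebra_simps)
    ultimately have "val (rev (c' # s')) = val (rev s) + 2 ^ length s * (of_bool c + val a + val b)"
      using *(3) by (simp only:)
    moreover have "fold add_step (x # l) (c, a, b, s) = (c', [], [], s')"
      using st *(1) by (simp only: fold_simps)
    ultimately show ?thesis using len by blast
  qed
qed

lemma val_add_bits: "val (add_bits a b) = val a + val b"
  and length_add_bits: "length (add_bits a b) = max (length a) (length b) + 1"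
  using fold_add_step[of a "a @ b" b False "[]"] by (auto simp: add_bits_def)

lemma polytime_add_bits0: "polytime (\<lambda>p. add_bits (fst p) (snd p))"
proof -
  have "polytime (\<lambda>p. fold add_step (fst p @ snd p) (False, fst p, snd p, []))"
  proof (rule polytime_fold_grow)
    show "polyb (\<lambda>p. 10)" by simp
    show "sz (add_step x t) \<le> sz t + 10" for x t
    proof -
      obtain c a b s where t: "t = (c, a, b, s)" by (cases t)
      show ?thesis
        using sz_tl[of a] sz_tl[of b] sz_bool[of "if c then digit a \<or> digit b else digit a \<and> digit b"]
          sz_bool[of "c = (digit a = digit b)"]
        unfolding t add_step_def by (simp only: prod.case split: if_split) auto
    qed
    show "polytime (\<lambda>q. add_step (fst (snd q)) (snd (snd q)))"
      unfolding add_step_def case_prod_beta by (intro polytime_intro)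
  qed (intro polytime_intro)+
  then show ?thesis unfolding add_bits_def Let_def by (intro polytime_intro)
qed

lemmas polytime_add_bits [polytime_intro] = polytime_comp2[OF polytime_add_bits0]

text \<open>Horner's scheme, from the most significant digit of \<open>a\<close> downwards.\<close>

definition mult_bits :: "bits \<Rightarrow> bits \<Rightarrow> bits" where
  "mult_bits a b = fold (\<lambda>d s. add_bits (if d then b else []) (False # s)) (rev a) []"

lemma val_mult_bits: "val (mult_bits a b) = val a * val b"
  and length_mult_bits: "length (mult_bits a b) \<le> 2 * length a + length b"
  by (induction a) (auto simp: mult_bits_def val_add_bits length_add_bits algebra_simps)

lemma polytime_mult_bits0: "polytime (\<lambda>p. mult_bits (fst p) (snd p))"
  unfolding mult_bits_def
proof (rule polytime_fold_measure[where m = length and c = 4])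
  show "sz t \<le> 4 * length t + 4" for t :: "bits" using sz_bool_list[of t] by simp
  show "polyb (\<lambda>p :: bits \<times> bits. sz p + 2)" by (intro polyb_intros)
  show "length (add_bits (if a then snd x else []) (False # t)) \<le> length t + (sz x + 2)"
    for a t and x :: "bits \<times> bits"
    using length_le_sz[of "snd x"] by (cases x) (auto simp: length_add_bits)
qed (intro polytime_intro length_le_sz)+

lemmas polytime_mult_bits [polytime_intro] = polytime_comp2[OF polytime_mult_bits0]

definition le_step :: "bool \<Rightarrow> bool \<times> bits \<times> bits \<Rightarrow> bool \<times> bits \<times> bits" where
  "le_step _ = (\<lambda>(r, a, b). if a = [] \<and> b = [] then (r, a, b) else
     (if digit a = digit b then r else digit b, tl a, tl b))"

definition le_bits :: "bits \<Rightarrow> bits \<Rightarrow> bool" where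
  "le_bits a b = fst (fold le_step (a @ b) (True, a, b))"

text \<open>Later digits are more significant: where they differ, they overrule the verdict
  \<open>r\<close> on the earlier ones.\<close>

lemma fold_le_step:
  assumes "length a \<le> length l" "length b \<le> length l"
  shows "fst (fold le_step l (r, a, b)) \<longleftrightarrow> val a < val b \<or> val a = val b \<and> r"
  using assms
proof (induction l arbitrary: r a b)
  case (Cons x l)
  show ?case
  proof (cases "a = [] \<and> b = []")
    case True
    then show ?thesis using Cons.IH[of "[]" "[]" r] by (simp add: le_step_def)
  next
    case False
    let ?r = "if digit a = digit b then r else digit b"
    have "le_step x (r, a, b) = (?r, tl a, tl b)" using False by (simp add: le_step_def)
    moreover have "fst (fold le_step l (?r, tl a, tl b)) \<longleftrightarrow> val (tl a) < val (tl b) \<or> val (tl a) = val (tl b) \<and> ?r"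
      by (rule Cons.IH) (use Cons.prems in auto)
    ultimately show ?thesis
      unfolding val_digit_tl[of a] val_digit_tl[of b]
      by (cases "digit a"; cases "digit b") auto
  qed
qed simp

lemma le_bits_iff: "le_bits a b \<longleftrightarrow> val a \<le> val b"
  unfolding le_bits_def by (subst fold_le_step) auto

lemma polytime_le_bits0: "polytime (\<lambda>p. le_bits (fst p) (snd p))"
proof -
  have "polytime (\<lambda>p. fold le_step (fst p @ snd p) (True, fst p, snd p))"
  proof (rule polytime_fold_grow)
    show "polyb (\<lambda>p. 10)" by simp
    show "sz (le_step x t) \<le> sz t + 10" for x t
    proof -
      obtain c a b where t: "t = (c, a, b)" by (cases t)
      show ?thesis
        using sz_tl[of a] sz_tl[of b] sz_bool[of "if digit a = digit b then c else digit b"]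
        unfolding t le_step_def by (simp only: prod.case split: if_split) auto
    qed
    show "polytime (\<lambda>q. le_step (fst (snd q)) (snd (snd q)))"
      unfolding le_step_def case_prod_beta by (intro polytime_intro)
  qed (intro polytime_intro)+
  then show ?thesis unfolding le_bits_def by (intro polytime_intro)
qed

lemmas polytime_le_bits [polytime_intro] = polytime_comp2[OF polytime_le_bits0]

text \<open>The triple \<open>(a, b, q)\<close> represents the rational number $(a - b) / q$, which avoids signs.\<close>

type_synonym frac = "bits \<times> bits \<times> bits"

definition represents :: "frac \<Rightarrow> real \<Rightarrow> bool" where
  "represents t r \<longleftrightarrow> 0 < val (snd (snd t)) \<and>
     r = (real (val (fst t)) - real (val (fst (snd t)))) / real (val (snd (snd t)))"

text \<open>The order of the factors matters for sizes: the length bound of \<open>mult_bits\<close>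
  counts the first factor twice but the second only once. With the accumulator as \<open>s\<close>
  in second place, repeated addition lengthens it additively.\<close>

definition frac_add :: "frac \<Rightarrow> frac \<Rightarrow> frac" where
  "frac_add s t =
    (add_bits (mult_bits (snd (snd t)) (fst s)) (mult_bits (fst t) (snd (snd s))),
     add_bits (mult_bits (snd (snd t)) (fst (snd s))) (mult_bits (fst (snd t)) (snd (snd s))),
     mult_bits (snd (snd t)) (snd (snd s)))"

definition frac_mult :: "frac \<Rightarrow> frac \<Rightarrow> frac" where
  "frac_mult s t =
    (add_bits (mult_bits (fst s) (fst t)) (mult_bits (fst (snd s)) (fst (snd t))),
     add_bits (mult_bits (fst s) (fst (snd t))) (mult_bits (fst (snd s)) (fst t)),
     mult_bits (snd (snd s)) (snd (snd t)))"

definition frac_minus :: "frac \<Rightarrow> frac" where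
  "frac_minus t = (fst (snd t), fst t, snd (snd t))"

definition frac_nat :: "bits \<Rightarrow> frac" where
  "frac_nat a = (a, [], [True])"

definition frac_nonpos :: "frac \<Rightarrow> bool" where
  "frac_nonpos t = le_bits (fst t) (fst (snd t))"

definition frac_sum :: "frac list \<Rightarrow> frac" where
  "frac_sum l = fold (\<lambda>t s. frac_add s t) l ([], [], [True])"

lemma represents_add: "represents s a \<Longrightarrow> represents t b \<Longrightarrow> represents (frac_add s t) (a + b)"
  by (simp add: represents_def frac_add_def val_add_bits val_mult_bits field_simps)

lemma represents_mult: "represents s a \<Longrightarrow> represents t b \<Longrightarrow> represents (frac_mult s t) (a * b)"
  by (simp add: represents_def frac_mult_def val_add_bits val_mult_bits field_simps)

lemma represents_minus: "represents t a \<Longrightarrow> represents (frac_minus t) (- a)"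
  by (simp add: represents_def frac_minus_def minus_divide_left)

lemma represents_nat: "represents (frac_nat a) (real (val a))"
  by (simp add: represents_def frac_nat_def)

lemma frac_nonpos_iff: "represents t r \<Longrightarrow> frac_nonpos t \<longleftrightarrow> r \<le> 0"
  by (simp add: represents_def frac_nonpos_def le_bits_iff divide_le_0_iff)

lemma represents_sum:
  assumes "\<And>j. j < n \<Longrightarrow> represents (f j) (g j)"
  shows "represents (frac_sum (map f [0..<n])) (\<Sum>j<n. g j)"
  using assms
proof (induction n)
  case 0
  then show ?case by (simp add: frac_sum_def represents_def)
next
  case (Suc n)
  then show ?case by (simp add: frac_sum_def represents_add)
qed

lemmas represents_intros = represents_add represents_mult represents_minus represents_nat represents_sum

lemma polytime_frac_add0: "polytime (\<lambda>p. frac_add (fst p) (snd p))"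
  unfolding frac_add_def by (intro polytime_intro)

lemmas polytime_frac_add [polytime_intro] = polytime_comp2[OF polytime_frac_add0]

lemma polytime_frac_mult0: "polytime (\<lambda>p. frac_mult (fst p) (snd p))"
  unfolding frac_mult_def by (intro polytime_intro)

lemmas polytime_frac_mult [polytime_intro] = polytime_comp2[OF polytime_frac_mult0]

text \<open>Each component of a sum mixes numerators and denominator of \<open>s\<close>, so the
  total length of the three components does not grow additively, whereas their maximal length
  does.\<close>

lemma polytime_frac_sum [polytime_intro]:
  assumes "polytime f" shows "polytime (\<lambda>x. frac_sum (f x))"
proof -
  define m where "m = (\<lambda>t :: frac. max (length (fst t)) (max (length (fst (snd t))) (length (snd (snd t)))))"
  have m: "sz t \<le> 12 * m t + 12" "m t \<le> sz t" for t
    using sz_bool_list[of "fst t"] sz_bool_list[of "fst (snd t)"] sz_bool_list[of "snd (snd t)"]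
      length_le_sz[of "fst t"] length_le_sz[of "fst (snd t)"] length_le_sz[of "snd (snd t)"]
    by (cases t, simp add: m_def)+
  have le_m: "length (fst t) \<le> m t" "length (fst (snd t)) \<le> m t" "length (snd (snd t)) \<le> m t" for t
    by (simp_all add: m_def)
  have m_le: "m t \<le> k" if "length (fst t) \<le> k" "length (fst (snd t)) \<le> k" "length (snd (snd t)) \<le> k" for t k
    using that by (simp add: m_def)
  have mult: "length (mult_bits a b) \<le> m s + 2 * m t" if "length a \<le> m t" "length b \<le> m s" for a b s t
    using length_mult_bits[of a b] that by linarith
  have "m (frac_add s t) \<le> m s + (2 * m t + 1)" for s t
    by (rule m_le) (simp_all add: frac_add_def length_add_bits mult le_m trans_le_add1 le_SucI)
  then have grow: "m (frac_add s t) \<le> m s + (2 * sz l + 1)" if "t \<in> set l" for s t l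
    using m(2)[of t] sz_mem[OF that] by (meson add_le_mono add_mono_thms_linordered_semiring(2) le_refl le_trans mult_le_mono2)
  have "polytime (\<lambda>l. frac_sum l)"
    unfolding frac_sum_def
  proof (rule polytime_fold_measure[where m = m and c = 12])
    show "polyb (\<lambda>l :: frac list. 2 * sz l + 1)" by (intro polyb_intros)
  qed (intro polytime_intro m grow | assumption)+
  from polytime_comp[OF this assms] show ?thesis .
qed

section \<open>The verifier\<close>

definition code_nat :: "bits \<Rightarrow> bits" where
  "code_nat ds = concat (map (\<lambda>d. [True, d]) ds) @ [False]"

text \<open>The state consists of the flag that a digit follows, the reversed current token and the
  reversed list of the previous tokens.\<close>

definition decode_step :: "bool \<Rightarrow> bool \<times> bits \<times> bits list \<Rightarrow> bool \<times> bits \<times> bits list" where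
  "decode_step b = (\<lambda>(f, cur, out). if f then (False, b # cur, out) else
     if b then (True, cur, out) else (False, [], rev cur # out))"

text \<open>Total on all bit strings: an unfinished last token is dropped, so every string is a
  legitimate certificate.\<close>

definition decode_nats :: "bits \<Rightarrow> bits list" where
  "decode_nats w = rev (snd (snd (fold decode_step w (False, [], []))))"

lemma decode_nats: "decode_nats (concat (map code_nat ts)) = ts"
proof -
  have 1: "fold decode_step (code_nat ds) (False, cur, out) = (False, [], (rev cur @ ds) # out)" for ds cur out
  proof (induction ds arbitrary: cur)
    case (Cons d ds)
    then show ?case by (simp add: code_nat_def decode_step_def)
  qed (simp add: code_nat_def decode_step_def)
  have "fold decode_step (concat (map code_nat ts)) (False, [], out) = (False, [], rev ts @ out)" for out
    by (induction ts arbitrary: out) (simp_all add: 1)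
  then show ?thesis by (simp add: decode_nats_def)
qed

lemma length_code_nat: "length (code_nat ds) = 2 * length ds + 1"
  by (induction ds) (auto simp: code_nat_def)

lemma polytime_decode_nats [polytime_intro]:
  assumes "polytime f" shows "polytime (\<lambda>x. decode_nats (f x))"
proof -
  have "polytime (\<lambda>w. fold decode_step w (False, [], []))"
  proof (rule polytime_fold_grow)
    show "polyb (\<lambda>w. 10)" by simp
    show "sz (decode_step b t) \<le> sz t + 10" for b t
    proof -
      obtain f cur out where t: "t = (f, cur, out)" by (cases t)
      show ?thesis using sz_bool[of b] unfolding t decode_step_def by (cases f; cases b) auto
    qed
    show "polytime (\<lambda>q. decode_step (fst (snd q)) (snd (snd q)))"
      unfolding decode_step_def case_prod_beta by (intro polytime_intro)
  qed (intro polytime_intro)+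
  then have "polytime decode_nats" unfolding decode_nats_def by (intro polytime_intro)
  from polytime_comp[OF this assms] show ?thesis .
qed

lemma polytime_code_nat [polytime_intro]: "polytime f \<Longrightarrow> polytime (\<lambda>x. code_nat (f x))"
  unfolding code_nat_def by (intro polytime_intro)

text \<open>The first certificate lists the tokens of the instance (the six dimensions, the bound, and
  sign, numerator and denominator of each entry) and then the components of \<open>x\<close>. The instance
  therefore need not be parsed; it only has to be compared with the code of the tokens.\<close>

definition tok :: "bits list \<Rightarrow> nat \<Rightarrow> bits" where
  "tok xs i = nth_default [] xs i"

definition tok_nx :: "bits list \<Rightarrow> nat" where "tok_nx xs = length (tok xs 0)"
definition tok_nu :: "bits list \<Rightarrow> nat" where "tok_nu xs = length (tok xs 1)"
definition tok_ny :: "bits list \<Rightarrow> nat" where "tok_ny xs = length (tok xs 2)"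
definition tok_mx :: "bits list \<Rightarrow> nat" where "tok_mx xs = length (tok xs 3)"
definition tok_mu :: "bits list \<Rightarrow> nat" where "tok_mu xs = length (tok xs 4)"
definition tok_my :: "bits list \<Rightarrow> nat" where "tok_my xs = length (tok xs 5)"

definition off_A :: "bits list \<Rightarrow> nat" where
  "off_A xs = tok_mx xs + tok_mu xs"
definition off_W :: "bits list \<Rightarrow> nat" where
  "off_W xs = off_A xs + tok_mx xs * tok_nx xs"
definition off_B :: "bits list \<Rightarrow> nat" where
  "off_B xs = off_W xs + tok_my xs * tok_ny xs"
definition off_T :: "bits list \<Rightarrow> nat" where
  "off_T xs = off_B xs + tok_nx xs * (tok_mu xs * tok_nu xs)"
definition num_entries :: "bits list \<Rightarrow> nat" where
  "num_entries xs = off_T xs + tok_nu xs * (tok_my xs * tok_nx xs)"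

text \<open>Seven tokens, the six dimensions and the bound, come before the entries. A nonempty sign
  token means minus and puts the numerator into the subtracted component.\<close>

definition entry :: "bits list \<Rightarrow> nat \<Rightarrow> frac" where
  "entry xs i = (if tok xs (7 + 3 * i) \<noteq> [] then ([], tok xs (8 + 3 * i), tok xs (9 + 3 * i))
     else (tok xs (8 + 3 * i), [], tok xs (9 + 3 * i)))"

abbreviation entry_A :: "bits list \<Rightarrow> nat \<Rightarrow> nat \<Rightarrow> frac" where
  "entry_A xs i j \<equiv> entry xs (off_A xs + (i * tok_nx xs + j))"
abbreviation entry_W :: "bits list \<Rightarrow> nat \<Rightarrow> nat \<Rightarrow> frac" where
  "entry_W xs i j \<equiv> entry xs (off_W xs + (i * tok_ny xs + j))"
abbreviation entry_B :: "bits list \<Rightarrow> nat \<Rightarrow> nat \<Rightarrow> nat \<Rightarrow> frac" where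
  "entry_B xs k i j \<equiv> entry xs (off_B xs + (k * (tok_mu xs * tok_nu xs) + (i * tok_nu xs + j)))"
abbreviation entry_T :: "bits list \<Rightarrow> nat \<Rightarrow> nat \<Rightarrow> nat \<Rightarrow> frac" where
  "entry_T xs k i j \<equiv> entry xs (off_T xs + (k * (tok_my xs * tok_nx xs) + (i * tok_nx xs + j)))"

definition x_coord :: "bits list \<Rightarrow> nat \<Rightarrow> bits" where
  "x_coord xs j = tok xs (7 + 3 * num_entries xs + j)"

text \<open>One common denominator, token 0, serves all coordinates; as \<open>u\<close> is
  nonnegative, nothing is subtracted.\<close>

definition u_coord :: "bits list \<Rightarrow> nat \<Rightarrow> frac" where
  "u_coord ys j = (tok ys (Suc j), [], tok ys 0)"

abbreviation code_entry :: "bits list \<Rightarrow> nat \<Rightarrow> bits" where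
  "code_entry xs i \<equiv> (tok xs (7 + 3 * i) \<noteq> []) # code_nat (tok xs (8 + 3 * i)) @ code_nat (tok xs (9 + 3 * i))"

definition code_tokens :: "bits list \<Rightarrow> bits" where
  "code_tokens xs = concat (map (\<lambda>i. map (\<lambda>_. True) (tok xs i) @ [False]) [0..<6]) @ code_nat (tok xs 6) @
     concat (map (code_entry xs) [0..<num_entries xs])"

text \<open>Equality with \<open>w\<close> ties the guessed tokens to the instance. That
  denominators are nonzero concerns their value and not the shape of the code, hence a test of its
  own.\<close>

definition check_code :: "bits \<Rightarrow> bits list \<Rightarrow> bool" where
  "check_code w xs \<longleftrightarrow> w = code_tokens xs \<and>
     list_all (\<lambda>i. \<not> list_all Not (tok xs (9 + 3 * i))) [0..<num_entries xs]"

definition row_X :: "bits list \<Rightarrow> nat \<Rightarrow> frac" where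
  "row_X xs i = frac_add (frac_minus (entry xs i))
     (frac_sum (map (\<lambda>j. frac_mult (entry_A xs i j) (frac_nat (x_coord xs j))) [0..<tok_nx xs]))"

definition row_U :: "bits list \<Rightarrow> bits list \<Rightarrow> nat \<Rightarrow> frac" where
  "row_U xs ys i = frac_add (frac_minus (entry xs (tok_mx xs + i)))
     (frac_sum (map (\<lambda>j. frac_mult
         (frac_sum (map (\<lambda>k. frac_mult (frac_nat (x_coord xs k)) (entry_B xs k i j)) [0..<tok_nx xs]))
         (u_coord ys j)) [0..<tok_nu xs]))"

definition row_Y :: "bits list \<Rightarrow> bits list \<Rightarrow> bits list \<Rightarrow> nat \<Rightarrow> frac" where
  "row_Y xs ys zs i = frac_add
     (frac_sum (map (\<lambda>j. frac_mult
         (frac_sum (map (\<lambda>k. frac_mult (u_coord ys k) (entry_T xs k i j)) [0..<tok_nu xs]))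
         (frac_nat (x_coord xs j))) [0..<tok_nx xs]))
     (frac_sum (map (\<lambda>j. frac_mult (entry_W xs i j) (frac_nat (tok zs j))) [0..<tok_ny xs]))"

definition check_X :: "bits list \<Rightarrow> bool" where
  "check_X xs \<longleftrightarrow> list_all (\<lambda>j. le_bits (x_coord xs j) (tok xs 6)) [0..<tok_nx xs] \<and>
     list_all (\<lambda>i. frac_nonpos (row_X xs i)) [0..<tok_mx xs]"

definition check_U :: "bits list \<Rightarrow> bits list \<Rightarrow> bool" where
  "check_U xs ys \<longleftrightarrow>
     list_all (\<lambda>j. le_bits (tok ys (Suc j)) (mult_bits (tok xs 6) (tok ys 0))) [0..<tok_nu xs] \<and>
     list_all (\<lambda>i. frac_nonpos (row_U xs ys i)) [0..<tok_mu xs]"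

definition check_Y :: "bits list \<Rightarrow> bits list \<Rightarrow> bits list \<Rightarrow> bool" where
  "check_Y xs ys zs \<longleftrightarrow> list_all (\<lambda>j. le_bits (tok zs j) (tok xs 6)) [0..<tok_ny xs] \<and>
     list_all (\<lambda>i. frac_nonpos (row_Y xs ys zs i)) [0..<tok_my xs]"

text \<open>A second certificate with denominator zero or with an infeasible \<open>u\<close> is no
  counterexample and is accepted; a malformed first certificate is rejected.\<close>

definition verify :: "bits \<Rightarrow> bits list \<Rightarrow> bits list \<Rightarrow> bits list \<Rightarrow> bool" where
  "verify w xs ys zs \<longleftrightarrow> check_code w xs \<and> check_X xs \<and>
     (list_all Not (tok ys 0) \<or> \<not> check_U xs ys \<or> check_Y xs ys zs)"

definition verifier :: "bits list \<Rightarrow> bool" where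
  "verifier ws = verify (tok ws 0) (decode_nats (tok ws 1)) (decode_nats (tok ws 2)) (decode_nats (tok ws 3))"

lemma poly_time_decidable_verifier: "poly_time_decidable 4 verifier"
proof (rule poly_time_decidable_polytime)
  show "polytime verifier"
    unfolding verifier_def verify_def check_code_def code_tokens_def check_X_def check_U_def check_Y_def
      row_X_def row_U_def row_Y_def u_coord_def x_coord_def entry_def num_entries_def off_T_def off_B_def
      off_W_def off_A_def tok_nx_def tok_nu_def tok_ny_def tok_mx_def tok_mu_def tok_my_def tok_def frac_minus_def
      frac_nat_def frac_nonpos_def
    by (intro polytime_intro)
qed

section \<open>Small solutions of systems of linear inequalities\<close>

lemma det_Ints:
  fixes A :: "real mat"
  assumes "A \<in> carrier_mat n n" "\<And>i j. i < n \<Longrightarrow> j < n \<Longrightarrow> A $$ (i, j) \<in> \<int>"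
  shows "det A \<in> \<int>"
  unfolding det_def'[OF assms(1)]
proof (intro Ints_sum Ints_mult Ints_prod)
  fix p i assume "p \<in> {p. p permutes {0..<n}}" "i \<in> {0..<n}"
  then show "A $$ (i, p i) \<in> \<int>" using assms(2) permutes_in_image[of p "{0..<n}" i] by auto
qed (auto simp: sign_def)

text \<open>The Leibniz formula has \<open>fact n\<close> terms. The estimate is crude, but its
  logarithm is polynomial, which is enough for certificate lengths.\<close>

lemma abs_det_le:
  fixes A :: "real mat"
  assumes "A \<in> carrier_mat n n" "\<And>i j. i < n \<Longrightarrow> j < n \<Longrightarrow> \<bar>A $$ (i, j)\<bar> \<le> B"
  shows "\<bar>det A\<bar> \<le> fact n * B ^ n"
proof -
  have "\<bar>det A\<bar> \<le> (\<Sum>p | p permutes {0..<n}. \<bar>signof p * (\<Prod>i = 0..<n. A $$ (i, p i))\<bar>)"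
    unfolding det_def'[OF assms(1)] by (rule sum_abs)
  also have "\<dots> \<le> (\<Sum>p | p permutes {0..<n}. B ^ n)"
  proof (rule sum_mono)
    fix p assume p: "p \<in> {p. p permutes {0..<n}}"
    have "\<bar>signof p * (\<Prod>i = 0..<n. A $$ (i, p i))\<bar> = (\<Prod>i = 0..<n. \<bar>A $$ (i, p i)\<bar>)"
      by (simp add: abs_mult sign_def abs_prod)
    also have "\<dots> \<le> (\<Prod>i = 0..<n. B)"
      using p assms(2) permutes_in_image[of p "{0..<n}"] by (intro prod_mono) auto
    finally show "\<bar>signof p * (\<Prod>i = 0..<n. A $$ (i, p i))\<bar> \<le> B ^ n" by simp
  qed
  also have "\<dots> = fact n * B ^ n" by (simp add: card_permutations)
  finally show ?thesis .
qed

text \<open>A feasible point at which as many constraints as possible are tight is determined by its tight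
  constraints, since one could otherwise move along a direction that preserves them.\<close>

lemma tight_point:
  fixes c :: "'i \<Rightarrow> nat \<Rightarrow> real" and d :: "'i \<Rightarrow> real"
  assumes fin: "finite I"
    and bounded: "\<And>z. z e \<ge> 0 \<Longrightarrow> \<exists>j<N. z j \<noteq> 0 \<Longrightarrow> \<exists>i\<in>I. (\<Sum>j<N. c i j * z j) > 0"
    and feas: "\<forall>i\<in>I. (\<Sum>j<N. c i j * v0 j) \<le> d i" "v0 e > 0"
  obtains v T where "T \<subseteq> I" "\<forall>i\<in>I. (\<Sum>j<N. c i j * v j) \<le> d i" "v e > 0"
    "\<forall>i\<in>T. (\<Sum>j<N. c i j * v j) = d i"
    "\<And>z. \<forall>i\<in>T. (\<Sum>j<N. c i j * z j) = 0 \<Longrightarrow> \<forall>j<N. z j = 0"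
proof -
  define L where "L = (\<lambda>z i. \<Sum>j<N. c i j * z j)"
  have lin: "L (\<lambda>j. v j + t * z j) i = L v i + t * L z i" for v z t i
    by (simp add: L_def sum.distrib sum_distrib_left algebra_simps)
  have bounded: "z e \<ge> 0 \<Longrightarrow> \<exists>j<N. z j \<noteq> 0 \<Longrightarrow> \<exists>i\<in>I. L z i > 0" for z
    using bounded unfolding L_def by blast
  define tight where "tight = (\<lambda>v. {i \<in> I. L v i = d i})"
  define F where "F = (\<lambda>v. (\<forall>i\<in>I. L v i \<le> d i) \<and> v e > 0)"
  have tight_sub: "tight v \<subseteq> I" for v by (auto simp: tight_def)
  \<comment> \<open>The number of tight constraints is at most \<open>card I\<close>, so a maximum
    exists without any compactness argument.\<close>
  have "\<exists>v. F v \<and> (\<forall>v'. F v' \<longrightarrow> card (tight v') \<le> card (tight v))"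
  proof (rule ex_has_greatest_nat[where b = "Suc (card I)" and k = v0])
    show "F v0" using feas by (simp add: F_def L_def)
    show "\<forall>v. F v \<longrightarrow> card (tight v) < Suc (card I)"
      using card_mono[OF fin tight_sub] by (simp add: less_Suc_eq_le)
  qed
  then obtain v where "F v \<and> (\<forall>v'. F v' \<longrightarrow> card (tight v') \<le> card (tight v))" ..
  then have v: "F v" "\<And>v'. F v' \<Longrightarrow> card (tight v') \<le> card (tight v)" by simp_all
  have le_d: "L v i \<le> d i" if "i \<in> I" for i using v(1) that by (simp add: F_def)
  \<comment> \<open>Along such a direction \<open>v e\<close> does not decrease and tight
    constraints stay tight; by \<open>bounded\<close> some further constraint is eventually hit,
    which contradicts the choice of \<open>v\<close>.\<close>
  have key: False if z: "\<forall>i\<in>tight v. L z i = 0" "\<exists>j<N. z j \<noteq> 0" "z e \<ge> 0" for z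
  proof -
    define S where "S = {i \<in> I. L z i > 0}"
    define g where "g = (\<lambda>i. (d i - L v i) / L z i)"
    have "finite S" using fin by (simp add: S_def)
    moreover have "S \<noteq> {}" using bounded[OF z(3,2)] by (auto simp: S_def)
    ultimately have gS: "finite (g ` S)" "g ` S \<noteq> {}" by simp_all
    have SI: "i \<in> I" "L z i > 0" "i \<notin> tight v" if "i \<in> S" for i
      using that z(1) by (auto simp: S_def)
    have gpos: "g i > 0" if "i \<in> S" for i
    proof -
      have "L v i < d i" using le_d[OF SI(1)[OF that]] SI(1,3)[OF that] by (simp add: tight_def)
      then show ?thesis using SI(2)[OF that] by (simp add: g_def)
    qed
    \<comment> \<open>The first time at which a constraint that grows along \<open>z\<close> becomes
      tight.\<close>
    define t where "t = Min (g ` S)"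
    obtain i0 where i0: "i0 \<in> S" "t = g i0"
      using Min_in[OF gS] unfolding t_def by (rule imageE)
    have t: "t > 0" using gpos i0 by simp
    define v' where "v' = (\<lambda>j. v j + t * z j)"
    have lin: "L v' i = L v i + t * L z i" for i unfolding v'_def by (rule lin)
    have "L v' i \<le> d i" if "i \<in> I" for i
    proof (cases "i \<in> S")
      case True
      then have "t \<le> g i" unfolding t_def using gS(1) by (intro Min_le) auto
      then show ?thesis using SI(2)[OF True] unfolding lin g_def by (simp add: pos_le_divide_eq)
    next
      case False
      then have "L z i \<le> 0" using that by (simp add: S_def)
      then have "t * L z i \<le> 0" using t by (simp add: mult_le_0_iff)
      then show ?thesis using le_d[OF that] unfolding lin by linarith
    qed
    moreover have "v' e > 0" using v(1) z(3) t unfolding v'_def F_def by (simp add: add_pos_nonneg)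
    ultimately have "F v'" by (simp add: F_def)
    have "i0 \<in> tight v'"
      using i0 SI[OF i0(1)] by (simp add: tight_def lin g_def)
    moreover have "tight v \<subseteq> tight v'" using z(1) by (auto simp: tight_def lin)
    ultimately have "tight v \<subset> tight v'" using SI(3)[OF i0(1)] by auto
    moreover have "finite (tight v')" using fin tight_sub finite_subset by blast
    ultimately have "card (tight v) < card (tight v')" by (intro psubset_card_mono)
    then show False using v(2)[OF \<open>F v'\<close>] by simp
  qed
  show thesis
  proof (rule that[of "tight v" v])
    show "\<forall>j<N. z j = 0" if z: "\<forall>i\<in>tight v. (\<Sum>j<N. c i j * z j) = 0" for z
    proof (rule ccontr)
      assume n: "\<not> (\<forall>j<N. z j = 0)"
      have z: "\<forall>i\<in>tight v. L z i = 0" using z by (simp add: L_def)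
      show False
      \<comment> \<open>The tight constraints do not distinguish \<open>z\<close> from its negative,
        so the sign of \<open>z e\<close> can be chosen.\<close>
      proof (cases "z e \<ge> 0")
        case True
        show False by (rule key[OF z _ True]) (use n in blast)
      next
        case False
        have "\<forall>i\<in>tight v. L (\<lambda>j. - z j) i = 0" using z by (simp add: L_def sum_negf)
        then show False by (rule key) (use n False in auto)
      qed
    qed
    show "\<forall>i\<in>I. (\<Sum>j<N. c i j * v j) \<le> d i" using le_d by (simp add: L_def)
    show "v e > 0" using v(1) by (simp add: F_def)
    show "\<forall>i\<in>tight v. (\<Sum>j<N. c i j * v j) = d i" by (simp add: tight_def L_def)
  qed (rule tight_sub)
qed

text \<open>The Gram matrix of the tight constraints is nonsingular, so that Cramer's rule applies.\<close>

lemma small_feasible_point: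
  fixes c :: "'i \<Rightarrow> nat \<Rightarrow> real" and d :: "'i \<Rightarrow> real"
  assumes fin: "finite I"
    and ints: "\<And>i j. i \<in> I \<Longrightarrow> j < N \<Longrightarrow> c i j \<in> \<int> \<and> \<bar>c i j\<bar> \<le> K" "\<And>i. i \<in> I \<Longrightarrow> d i \<in> \<int>"
    and bounded: "\<And>z. z e \<ge> 0 \<Longrightarrow> \<exists>j<N. z j \<noteq> 0 \<Longrightarrow> \<exists>i\<in>I. (\<Sum>j<N. c i j * z j) > 0"
    and feas: "\<forall>i\<in>I. (\<Sum>j<N. c i j * v0 j) \<le> d i" "v0 e > 0"
  obtains v and D :: nat where "\<forall>i\<in>I. (\<Sum>j<N. c i j * v j) \<le> d i" "v e > 0"
    "D > 0" "\<forall>j<N. real D * v j \<in> \<int>" "real D \<le> fact N * (real (card I) * K\<^sup>2) ^ N"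
proof -
  obtain v T where T: "T \<subseteq> I" and v: "\<forall>i\<in>I. (\<Sum>j<N. c i j * v j) \<le> d i" "v e > 0"
    and tight: "\<forall>i\<in>T. (\<Sum>j<N. c i j * v j) = d i"
    and ker: "\<And>z. \<forall>i\<in>T. (\<Sum>j<N. c i j * z j) = 0 \<Longrightarrow> \<forall>j<N. z j = 0"
  proof (rule tight_point[OF fin _ feas])
    show "\<exists>i\<in>I. (\<Sum>j<N. c i j * z j) > 0" if "z e \<ge> 0" "\<exists>j<N. z j \<noteq> 0" for z
      using bounded that .
  qed (rule that)
  have finT: "finite T" using T fin finite_subset by blast
  define G where "G = mat N N (\<lambda>(j, k). \<Sum>i\<in>T. c i j * c i k)"
  define h where "h = vec N (\<lambda>j. \<Sum>i\<in>T. c i j * d i)"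
  have G: "G \<in> carrier_mat N N" by (simp add: G_def)
  have Gmul: "(G *\<^sub>v z) $ j = (\<Sum>i\<in>T. c i j * (\<Sum>k<N. c i k * z $ k))" if "z \<in> carrier_vec N" "j < N" for z j
  proof -
    have "(G *\<^sub>v z) $ j = (\<Sum>k<N. (\<Sum>i\<in>T. c i j * c i k) * z $ k)"
      using that by (simp add: G_def scalar_prod_def lessThan_atLeast0)
    also have "\<dots> = (\<Sum>k<N. \<Sum>i\<in>T. c i j * (c i k * z $ k))"
      by (simp add: sum_distrib_right mult.assoc)
    also have "\<dots> = (\<Sum>i\<in>T. c i j * (\<Sum>k<N. c i k * z $ k))"
      by (subst sum.swap) (simp add: sum_distrib_left)
    finally show ?thesis .
  qed
  have det: "det G \<noteq> 0"
  proof
    assume "det G = 0"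
    then obtain z where z: "z \<in> carrier_vec N" "z \<noteq> 0\<^sub>v N" "G *\<^sub>v z = 0\<^sub>v N"
      using det_0_iff_vec_prod_zero_field[OF G] by blast
    let ?L = "\<lambda>i. \<Sum>k<N. c i k * z $ k"
    \<comment> \<open>The quadratic form of \<open>G\<close> at \<open>z\<close> is the sum of the
      squared tight rows, so a kernel vector of \<open>G\<close> annihilates every one of
      them.\<close>
    have "(\<Sum>i\<in>T. (?L i)\<^sup>2) = (\<Sum>j<N. z $ j * (\<Sum>i\<in>T. c i j * ?L i))"
    proof -
      have "(\<Sum>j<N. z $ j * (\<Sum>i\<in>T. c i j * ?L i)) =
          (\<Sum>j<N. \<Sum>i\<in>T. (c i j * z $ j) * ?L i)"
        by (simp add: sum_distrib_left mult.assoc mult.left_commute)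
      also have "\<dots> = (\<Sum>i\<in>T. (\<Sum>j<N. c i j * z $ j) * ?L i)"
        by (subst sum.swap) (simp add: sum_distrib_right)
      finally show ?thesis by (simp add: power2_eq_square)
    qed
    also have "\<dots> = (\<Sum>j<N. z $ j * (G *\<^sub>v z) $ j)"
      using Gmul[OF z(1)] by simp
    also have "\<dots> = 0" using z(3) by simp
    finally have "\<forall>i\<in>T. ?L i = 0"
      using finT by (simp add: sum_nonneg_eq_0_iff)
    then have "\<forall>j<N. z $ j = 0" by (rule ker)
    then have "z = 0\<^sub>v N" using z(1) by (intro eq_vecI) auto
    then show False using z(2) by simp
  qed
  \<comment> \<open>The normal equations: the tight constraints hold with equality, and combining
    them with the weights \<open>c i j\<close> gives row \<open>j\<close> of this system.\<close>
  have Gv: "G *\<^sub>v vec N v = h"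
  proof (rule eq_vecI)
    fix j assume "j < dim_vec h"
    then have j: "j < N" by (simp add: h_def)
    then have "(G *\<^sub>v vec N v) $ j = (\<Sum>i\<in>T. c i j * (\<Sum>k<N. c i k * v k))"
      using Gmul[of "vec N v" j] by simp
    then show "(G *\<^sub>v vec N v) $ j = h $ j" using tight j by (simp add: h_def)
  qed (simp add: G_def h_def)
  have Gint: "G $$ (i, j) \<in> \<int>" if "i < N" "j < N" for i j
    using that ints(1) T by (auto simp: G_def intro!: Ints_sum Ints_mult)
  have hint: "h $ j \<in> \<int>" if "j < N" for j
    using that ints T by (auto simp: h_def intro!: Ints_sum Ints_mult)
  have Gle: "\<bar>G $$ (i, j)\<bar> \<le> real (card I) * K\<^sup>2" if ij: "i < N" "j < N" for i j
  proof -
    have "\<bar>G $$ (i, j)\<bar> \<le> (\<Sum>a\<in>T. \<bar>c a i * c a j\<bar>)"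
      using ij by (simp add: G_def)
    also have "\<dots> \<le> (\<Sum>a\<in>T. K\<^sup>2)"
    proof (rule sum_mono)
      fix a assume "a \<in> T"
      then have "\<bar>c a i\<bar> \<le> K" "\<bar>c a j\<bar> \<le> K" using ints(1) T ij by auto
      then show "\<bar>c a i * c a j\<bar> \<le> K\<^sup>2"
        unfolding abs_mult power2_eq_square by (intro mult_mono) auto
    qed
    also have "\<dots> \<le> real (card I) * K\<^sup>2"
      using card_mono[OF fin T] by (simp add: mult_right_mono)
    finally show ?thesis .
  qed
  obtain k where k: "det G = of_int k" using det_Ints[OF G Gint] Ints_cases by blast
  define D where "D = nat \<bar>k\<bar>"
  have D: "real D = \<bar>det G\<bar>" by (simp add: D_def k)
  \<comment> \<open>By Cramer's rule this is the determinant of \<open>G\<close> with column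
    \<open>j\<close> replaced by \<open>h\<close>, a matrix of integers.\<close>
  have cram: "det G * v j \<in> \<int>" if "j < N" for j
  proof -
    have "det (replace_col G (G *\<^sub>v vec N v) j) = vec N v $ j * det G"
      using cramer_lemma_mat[OF G _ that, of "vec N v"] by simp
    moreover have "det (replace_col G (G *\<^sub>v vec N v) j) \<in> \<int>"
      unfolding Gv using G Gint hint
      by (intro det_Ints[of _ N]) (auto simp: replace_col_def)
    ultimately show ?thesis using that by (simp add: mult.commute)
  qed
  show thesis
  proof (rule that[OF v])
    show "D > 0" using det D by (metis abs_eq_0 of_nat_0 gr0I)
    show "\<forall>j<N. real D * v j \<in> \<int>"
      using cram unfolding D by (metis (no_types, lifting) Ints_minus abs_if minus_mult_left)
    show "real D \<le> fact N * (real (card I) * K\<^sup>2) ^ N"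
      unfolding D by (rule abs_det_le[OF G Gle])
  qed
qed

text \<open>Shifted by the ceiling of \<open>K\<close>, the values become natural numbers, and these
  are well-ordered; finiteness of \<open>A\<close> does not enter.\<close>

lemma least_int_valued:
  fixes g :: "'y \<Rightarrow> real"
  assumes "y0 \<in> A" "\<And>y. y \<in> A \<Longrightarrow> g y \<in> \<int> \<and> - K \<le> g y"
  shows "\<exists>y\<in>A. \<forall>y'\<in>A. g y \<le> g y'"
proof -
  obtain y where y: "y \<in> A" "\<forall>y'. y' \<in> A \<longrightarrow> nat (\<lfloor>g y\<rfloor> + \<lceil>K\<rceil>) \<le> nat (\<lfloor>g y'\<rfloor> + \<lceil>K\<rceil>)"
    using ex_has_least_nat[of "\<lambda>y. y \<in> A" y0 "\<lambda>y. nat (\<lfloor>g y\<rfloor> + \<lceil>K\<rceil>)"] assms(1) by blast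
  have "g y \<le> g y'" if "y' \<in> A" for y'
  proof -
    have "real_of_int \<lfloor>g z\<rfloor> = g z" "0 \<le> \<lfloor>g z\<rfloor> + \<lceil>K\<rceil>" if "z \<in> A" for z
    proof -
      show *: "real_of_int \<lfloor>g z\<rfloor> = g z" using assms(2)[OF that] by (auto elim!: Ints_cases)
      show "0 \<le> \<lfloor>g z\<rfloor> + \<lceil>K\<rceil>" using assms(2)[OF that] * by linarith
    qed
    from this[OF y(1)] this[OF that] y(2)[rule_format, OF that] show ?thesis by linarith
  qed
  then show ?thesis using y(1) by blast
qed

text \<open>The strict inequalities are handled by an additional variable that is to be positive.
  For every row only the least right-hand side matters.\<close>

lemma small_counterexample:
  fixes \<beta> \<tau> :: "nat \<Rightarrow> nat \<Rightarrow> real" and b u :: "nat \<Rightarrow> real" and w :: "'y \<Rightarrow> nat \<Rightarrow> real"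
    and M R n p r :: nat and K :: real
  assumes "1 \<le> K" "real R \<le> K" "M > 0"
    and \<beta>: "\<And>i j. i < p \<Longrightarrow> j < n \<Longrightarrow> M * \<beta> i j \<in> \<int> \<and> \<bar>M * \<beta> i j\<bar> \<le> K"
    and b: "\<And>i. i < p \<Longrightarrow> M * b i \<in> \<int>"
    and \<tau>: "\<And>i j. i < r \<Longrightarrow> j < n \<Longrightarrow> M * \<tau> i j \<in> \<int> \<and> \<bar>M * \<tau> i j\<bar> \<le> K"
    and w: "\<And>y i. y \<in> S \<Longrightarrow> i < r \<Longrightarrow> M * w y i \<in> \<int> \<and> - L \<le> M * w y i"
    and u: "\<And>j. j < n \<Longrightarrow> 0 \<le> u j \<and> u j \<le> R" "\<And>i. i < p \<Longrightarrow> (\<Sum>j<n. \<beta> i j * u j) \<le> b i"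
      "\<And>y. y \<in> S \<Longrightarrow> \<exists>i<r. (\<Sum>j<n. \<tau> i j * u j) + w y i > 0"
  obtains q :: nat and v :: "nat \<Rightarrow> nat"
  where "q > 0" "real q \<le> fact (Suc n) * (real (2 * n + 1 + p + r) * K\<^sup>2) ^ Suc n"
    "\<And>j. j < n \<Longrightarrow> v j \<le> R * q" "\<And>i. i < p \<Longrightarrow> (\<Sum>j<n. \<beta> i j * (v j / q)) \<le> b i"
    "\<And>y. y \<in> S \<Longrightarrow> \<exists>i<r. (\<Sum>j<n. \<tau> i j * (v j / q)) + w y i > 0"
proof -
  \<comment> \<open>\<open>f\<close> fixes one violated row for every \<open>y\<close>, which turns
    the disjunctions into a conjunction.\<close>
  obtain f where f: "\<And>y. y \<in> S \<Longrightarrow> f y < r \<and> (\<Sum>j<n. \<tau> (f y) j * u j) + w y (f y) > 0"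
    using u(3) by metis
  define U where "U = f ` S"
  have U: "U \<subseteq> {..<r}" using f by (auto simp: U_def)
  have "\<exists>y\<in>{y \<in> S. f y = i}. \<forall>y'\<in>{y \<in> S. f y = i}. M * w y i \<le> M * w y' i" if i: "i \<in> U" for i
  proof -
    obtain y0 where "y0 \<in> {y \<in> S. f y = i}" using i by (auto simp: U_def)
    then show ?thesis by (rule least_int_valued[where K = L]) (use w i U in auto)
  qed
  then have "\<forall>i\<in>U. \<exists>y. y \<in> S \<and> f y = i \<and> (\<forall>y'\<in>S. f y' = i \<longrightarrow> M * w y i \<le> M * w y' i)"
    by blast
  from bchoice[OF this] obtain Y
    where "\<forall>i\<in>U. Y i \<in> S \<and> f (Y i) = i \<and> (\<forall>y'\<in>S. f y' = i \<longrightarrow> M * w (Y i) i \<le> M * w y' i)" ..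
  then have Y: "\<And>i. i \<in> U \<Longrightarrow> Y i \<in> S \<and> f (Y i) = i"
    and Ymin: "\<And>i y. i \<in> U \<Longrightarrow> y \<in> S \<Longrightarrow> f y = i \<Longrightarrow> M * w (Y i) i \<le> M * w y i"
    by blast+
  \<comment> \<open>Five families of constraints: 0 and 1 form the box, 2 caps the additional
    variable, which has index \<open>n\<close>, by 1, 3 holds the rows of \<beta>, and 4 says that
    the additional variable is at most \<open>M\<close> times the margin by which row
    \<open>i\<close> is violated at \<open>Y i\<close>.\<close>
  define c where "c = (\<lambda>(a, i) k. if a = 0 then of_bool (k = i) else if a = 1 then - of_bool (k = i)
     else if a = 2 then of_bool (k = n) else if a = (3::nat) then (if k < n then M * \<beta> i k else 0)
     else (if k < n then - (M * \<tau> i k) else 1))"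
  define d where "d = (\<lambda>(a, i). if a = 0 then real R else if a = 1 then 0 else if a = 2 then 1
     else if a = (3::nat) then M * b i else M * w (Y i) i)"
  define I where "I = Pair 0 ` {..<n} \<union> Pair 1 ` {..<n} \<union> {(2, 0)} \<union> Pair 3 ` {..<p} \<union> Pair (4::nat) ` U"
  have finU: "finite U" "card U \<le> r" using U finite_subset card_mono[OF _ U] by auto
  have fin: "finite I" using finU by (simp add: I_def)
  have cardI: "card I \<le> 2 * n + 1 + p + r"
  proof -
    have "card I \<le> n + n + 1 + p + card U"
      unfolding I_def
      by (intro order_trans[OF card_Un_le] add_mono order_trans[OF card_image_le]) (auto simp: finU)
    then show ?thesis using finU by simp
  qed
  define E where "E = (\<lambda>z i. \<Sum>k<Suc n. c i k * z k)"
  have E: "E z (0, j) = z j" "E z (1, j) = - z j" if "j < n" for z j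
  proof -
    have "E z (0, j) = (\<Sum>k<Suc n. if k = j then z k else 0)"
      unfolding E_def by (rule sum.cong) (auto simp: c_def)
    then show "E z (0, j) = z j" using that by (simp add: sum.delta)
    have "E z (1, j) = (\<Sum>k<Suc n. if k = j then - z k else 0)"
      unfolding E_def by (rule sum.cong) (auto simp: c_def)
    then show "E z (1, j) = - z j" using that by (simp add: sum.delta)
  qed
  have E2: "E z (2, 0) = z n" for z
    unfolding E_def by (simp add: c_def)
  have E3: "E z (3, i) = M * (\<Sum>k<n. \<beta> i k * z k)" for z i
    unfolding E_def by (simp add: c_def sum_distrib_left mult.assoc)
  have E4: "E z (4, i) = z n - M * (\<Sum>k<n. \<tau> i k * z k)" for z i
    unfolding E_def by (simp add: c_def sum_distrib_left sum_negf mult.assoc)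
  define g where "g = (\<lambda>i. M * ((\<Sum>k<n. \<tau> i k * u k) + w (Y i) i))"
  have gpos: "g i > 0" if "i \<in> U" for i
  proof -
    have "(\<Sum>k<n. \<tau> i k * u k) + w (Y i) i > 0" using f[of "Y i"] Y[OF that] by auto
    then show ?thesis using \<open>M > 0\<close> by (simp add: g_def)
  qed
  \<comment> \<open>The least of finitely many positive margins, cut at 1 to respect the cap: a
    value of the additional variable that makes \<open>u\<close> feasible.\<close>
  define \<epsilon> where "\<epsilon> = Min (insert 1 (g ` U))"
  have \<epsilon>: "\<epsilon> > 0" "\<epsilon> \<le> 1" "\<And>i. i \<in> U \<Longrightarrow> \<epsilon> \<le> g i"
    using finU(1) gpos by (auto simp: \<epsilon>_def)
  define v0 where "v0 = (\<lambda>k. if k < n then u k else \<epsilon>)"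
  have sum_v0: "(\<Sum>k<n. h k * v0 k) = (\<Sum>k<n. h k * u k)" for h
    by (rule sum.cong) (auto simp: v0_def)
  have feas: "E v0 i \<le> d i" if "i \<in> I" for i
    using that unfolding I_def
  proof (elim UnE imageE)
    fix j assume "i = (0, j)" "j \<in> {..<n}"
    then show ?thesis using u(1)[of j] by (simp add: E d_def v0_def)
  next
    fix j assume "i = (1, j)" "j \<in> {..<n}"
    then show ?thesis using u(1)[of j] E(2)[of j v0] by (simp add: d_def v0_def)
  next
    assume "i \<in> {(2, 0)}"
    then show ?thesis using \<epsilon>(2) by (simp add: E2 d_def v0_def)
  next
    fix j assume "i = (3, j)" "j \<in> {..<p}"
    then show ?thesis using u(2)[of j] by (simp add: E3 d_def sum_v0 mult_left_mono)
  next
    fix j assume "i = (4, j)" "j \<in> U"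
    then show ?thesis using \<epsilon>(3)[of j] by (simp add: E4 d_def sum_v0 g_def v0_def algebra_simps)
  qed
  obtain v and D :: nat where v: "\<forall>i\<in>I. (\<Sum>k<Suc n. c i k * v k) \<le> d i" "v n > 0"
    and D: "D > 0" "\<forall>k<Suc n. real D * v k \<in> \<int>" "real D \<le> fact (Suc n) * (real (card I) * K\<^sup>2) ^ Suc n"
  proof (rule small_feasible_point[of I "Suc n" c K d n v0])
    show "finite I" by (rule fin)
    show "c i j \<in> \<int> \<and> \<bar>c i j\<bar> \<le> K" if "i \<in> I" "j < Suc n" for i j
      using that \<beta> \<tau> U \<open>1 \<le> K\<close> unfolding I_def c_def by auto
    show "d i \<in> \<int>" if "i \<in> I" for i
      using that b w Y U unfolding I_def d_def by auto
    show "\<forall>i\<in>I. (\<Sum>j<Suc n. c i j * v0 j) \<le> d i" using feas unfolding E_def by blast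
    show "v0 n > 0" using \<epsilon> by (simp add: v0_def)
    \<comment> \<open>A nonzero coordinate below \<open>n\<close> is seen by one of its two box
      rows; otherwise \<open>z n\<close> is positive and the cap sees it.\<close>
    show "\<exists>i\<in>I. (\<Sum>j<Suc n. c i j * z j) > 0" if z: "z n \<ge> 0" "\<exists>j<Suc n. z j \<noteq> 0" for z
    proof (cases "\<exists>j<n. z j \<noteq> 0")
      case True
      then obtain j where j: "j < n" "z j \<noteq> 0" by blast
      then have "E z (0, j) > 0 \<or> E z (1, j) > 0" using E[of j z] by auto
      moreover have "(0, j) \<in> I" "(1, j) \<in> I" using j by (auto simp: I_def)
      ultimately show ?thesis unfolding E_def by blast
    next
      case False
      then have "z n > 0" using z by (metis less_Suc_eq order_le_less)
      then have "E z (2, 0) > 0" by (simp add: E2)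
      moreover have "(2, 0) \<in> I" by (simp add: I_def)
      ultimately show ?thesis unfolding E_def by blast
    qed
  qed (rule that)
  have vE: "E v i \<le> d i" if "i \<in> I" for i using v(1) that unfolding E_def by blast
  have vbox: "0 \<le> v j" "v j \<le> R" if "j < n" for j
    using vE[of "(0, j)"] vE[of "(1, j)"] E[OF that, of v] that by (auto simp: I_def d_def)
  \<comment> \<open>No rounding takes place: \<open>D * v j\<close> is a nonnegative
    integer.\<close>
  define a where "a = (\<lambda>j. nat \<lfloor>D * v j\<rfloor>)"
  have a: "real (a j) = D * v j" if j: "j < n" for j
  proof -
    have "D * v j \<in> \<int>" using D(2) j by simp
    then obtain k where k: "D * v j = of_int k" by (rule Ints_cases)
    have "0 \<le> D * v j" using vbox(1)[OF j] by simp
    then have "k \<ge> 0" unfolding k by simp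
    then show ?thesis using k by (simp add: a_def)
  qed
  have aD: "real (a j) / real D = v j" if "j < n" for j using a[OF that] D(1) by simp
  have sum_a: "(\<Sum>k<n. h k * (real (a k) / real D)) = (\<Sum>k<n. h k * v k)" for h
    by (rule sum.cong) (auto simp: aD)
  show thesis
  proof (rule that[of D a])
    show "D > 0" by fact
    have "(real (card I) * K\<^sup>2) ^ Suc n \<le> (real (2 * n + 1 + p + r) * K\<^sup>2) ^ Suc n"
      using cardI by (intro power_mono mult_right_mono) auto
    then have "fact (Suc n) * (real (card I) * K\<^sup>2) ^ Suc n \<le> fact (Suc n) * (real (2 * n + 1 + p + r) * K\<^sup>2) ^ Suc n"
      by (intro mult_left_mono) auto
    then show "real D \<le> fact (Suc n) * (real (2 * n + 1 + p + r) * K\<^sup>2) ^ Suc n" using D(3) by linarith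
    show "a j \<le> R * D" if "j < n" for j
    proof -
      have "real (a j) \<le> real R * real D"
        using a[OF that] vbox[OF that] by (simp add: mult.commute mult_left_mono)
      then show ?thesis by (metis of_nat_le_iff of_nat_mult)
    qed
    show "(\<Sum>j<n. \<beta> i j * (real (a j) / real D)) \<le> b i" if "i < p" for i
      unfolding sum_a using vE[of "(3, i)"] that \<open>M > 0\<close> by (simp add: I_def E3 d_def)
    show "\<exists>i<r. (\<Sum>j<n. \<tau> i j * (real (a j) / real D)) + w y i > 0" if "y \<in> S" for y
    proof (intro exI conjI)
      have fy: "f y \<in> U" using that by (simp add: U_def)
      then show "f y < r" using U by auto
      \<comment> \<open>The constraint was imposed only for the minimiser \<open>Y (f y)\<close>. In
        this row \<open>w y\<close> is at least as large, and \<open>v n > 0\<close> restores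
        strictness.\<close>
      have "v n - M * (\<Sum>k<n. \<tau> (f y) k * v k) \<le> M * w (Y (f y)) (f y)"
        using vE[of "(4, f y)"] fy by (simp add: I_def E4 d_def)
      then have "0 < M * ((\<Sum>k<n. \<tau> (f y) k * v k) + w y (f y))"
        using v(2) Ymin[OF fy that] by (simp add: distrib_left)
      then show "(\<Sum>j<n. \<tau> (f y) j * (real (a j) / real D)) + w y (f y) > 0"
        unfolding sum_a by (simp add: zero_less_mult_iff)
    qed
  qed
qed

section \<open>Tokens and instances\<close>

lemma index_less: "i < m \<Longrightarrow> j < n \<Longrightarrow> i * n + j < m * (n :: nat)"
proof -
  assume "i < m" "j < n"
  then have "i * n + j < Suc i * n" by simp
  also have "\<dots> \<le> m * n" using \<open>i < m\<close> by (intro mult_right_mono) auto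
  finally show ?thesis .
qed

lemma length_concat_uniform: "\<forall>l\<in>set ls. length l = n \<Longrightarrow> length (concat ls) = length ls * n"
  by (induction ls) auto

lemma nth_concat_uniform:
  "\<forall>l\<in>set ls. length l = n \<Longrightarrow> i < length ls \<Longrightarrow> j < n \<Longrightarrow> concat ls ! (i * n + j) = ls ! i ! j"
proof (induction ls arbitrary: i)
  case (Cons l ls)
  show ?case
  proof (cases i)
    case 0
    then show ?thesis using Cons.prems by (simp add: nth_append)
  next
    case (Suc i')
    then have "concat (l # ls) ! (i * n + j) = concat ls ! (i' * n + j)"
      using Cons.prems by (simp add: nth_append add.assoc)
    then show ?thesis using Cons.IH[of i'] Cons.prems Suc by simp
  qed
qed simp

lemma mat_entries_nth:
  assumes "C \<in> carrier_mat m n"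
  shows "length (mat_entries C) = m * n"
    "i < m \<Longrightarrow> j < n \<Longrightarrow> mat_entries C ! (i * n + j) = C $$ (i, j)"
proof -
  have l: "length (mat_to_list C) = m" "\<forall>l\<in>set (mat_to_list C). length l = n"
    using assms by (auto simp: mat_to_list_def)
  show "length (mat_entries C) = m * n"
    using length_concat_uniform[OF l(2)] l(1) by (simp add: mat_entries_def)
  show "i < m \<Longrightarrow> j < n \<Longrightarrow> mat_entries C ! (i * n + j) = C $$ (i, j)"
    using nth_concat_uniform[OF l(2), of i j] l(1) assms by (simp add: mat_entries_def mat_to_list_def)
qed

lemma mats_entries_nth:
  assumes "set Cs \<subseteq> carrier_mat m n"
  shows "length (concat (map mat_entries Cs)) = length Cs * (m * n)"
    "k < length Cs \<Longrightarrow> i < m \<Longrightarrow> j < n \<Longrightarrow>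
      concat (map mat_entries Cs) ! (k * (m * n) + (i * n + j)) = (Cs ! k) $$ (i, j)"
proof -
  have l: "\<forall>l\<in>set (map mat_entries Cs). length l = m * n"
    using assms mat_entries_nth(1) by auto
  show "length (concat (map mat_entries Cs)) = length Cs * (m * n)"
    using length_concat_uniform[OF l] by simp
  assume k: "k < length Cs" and ij: "i < m" "j < n"
  have "concat (map mat_entries Cs) ! (k * (m * n) + (i * n + j)) = mat_entries (Cs ! k) ! (i * n + j)"
    using nth_concat_uniform[OF l, of k "i * n + j"] k index_less[OF ij] by simp
  then show "concat (map mat_entries Cs) ! (k * (m * n) + (i * n + j)) = (Cs ! k) $$ (i, j)"
    using mat_entries_nth(2)[of "Cs ! k" m n i j] subsetD[OF assms nth_mem[OF k]] ij by simp
qed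

lemma concat_map_blocks:
  "concat (map (\<lambda>k. map (\<lambda>t. h (k * c + t)) [0..<c]) [0..<m]) = map h [0..<m * c]"
proof (induction m)
  case (Suc m)
  have "map h [0..<Suc m * c] = map h [0..<m * c] @ map h [m * c..<m * c + c]"
    using upt_add_eq_append[of 0 "m * c" c] by (simp only: mult_Suc add.commute[of c] map_append le0)
  moreover have "map h [m * c..<m * c + c] = map (\<lambda>t. h (m * c + t)) [0..<c]"
    by (rule nth_equalityI) auto
  ultimately show ?case using Suc by simp
qed simp

lemma map_upt_append: "map h [0..<a] @ map (\<lambda>t. h (a + t)) [0..<b] = map h [0..<a + b]"
  by (rule nth_equalityI) (auto simp: nth_append)

lemma mat_entries_mat: "mat_entries (mat m n (\<lambda>(i, j). h (i * n + j))) = map h [0..<m * n]"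
proof -
  have "mat_entries (mat m n (\<lambda>(i, j). h (i * n + j))) = concat (map (\<lambda>i. map (\<lambda>j. h (i * n + j)) [0..<n]) [0..<m])"
    unfolding mat_entries_def mat_to_list_def
    by (rule arg_cong[of _ _ concat], rule map_cong, simp, rule map_cong, simp, simp)
  then show ?thesis unfolding concat_map_blocks .
qed

lemma list_of_vec_vec: "list_of_vec (vec n f) = map f [0..<n]"
  by (rule nth_equalityI) auto

section \<open>Token lists and the instances they describe\<close>

definition entry_rat :: "bits list \<Rightarrow> nat \<Rightarrow> rat" where
  "entry_rat xs i = Rat.Fract (if tok xs (7 + 3 * i) \<noteq> [] then - int (val (tok xs (8 + 3 * i)))
     else int (val (tok xs (8 + 3 * i)))) (int (val (tok xs (9 + 3 * i))))"

lemma represents_entry: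
  "\<not> list_all Not (tok xs (9 + 3 * i)) \<Longrightarrow> represents (entry xs i) (of_rat (entry_rat xs i))"
  by (simp add: represents_def entry_def entry_rat_def of_rat_rat val_eq_0[symmetric])

text \<open>Entries are compared by value: the tokens of a rational need not be in lowest terms,
  while the instance holds plain rationals.\<close>

definition matches :: "bits list \<Rightarrow> two_stage \<Rightarrow> bool" where
  "matches xs I \<longleftrightarrow> wf_two_stage I \<and> tok_nx xs = nx I \<and> tok_nu xs = nu I \<and> tok_ny xs = ny I \<and>
     tok_mx xs = mx I \<and> tok_mu xs = mu I \<and> tok_my xs = my I \<and> val (tok xs 6) = bound I \<and>
     length (two_stage_entries I) = num_entries xs \<and>
     (\<forall>i<num_entries xs. represents (entry xs i) (of_rat (two_stage_entries I ! i)))"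

lemma two_stage_dims:
  assumes "wf_two_stage I"
  shows "vec_a I \<in> carrier_vec (mx I)" "vec_b I \<in> carrier_vec (mu I)"
     "mat_A I \<in> carrier_mat (mx I) (nx I)" "mat_W I \<in> carrier_mat (my I) (ny I)"
     "length (coeffs_B I) = nx I" "set (coeffs_B I) \<subseteq> carrier_mat (mu I) (nu I)"
     "length (coeffs_T I) = nu I" "set (coeffs_T I) \<subseteq> carrier_mat (my I) (nx I)"
  using assms by (auto simp: wf_two_stage_def)

lemma matches_entries:
  assumes "matches xs I"
  shows "i < mx I \<Longrightarrow> represents (entry xs i) (of_rat (vec_a I $ i))" (is "_ \<Longrightarrow> ?R1")
    and "i < mu I \<Longrightarrow> represents (entry xs (tok_mx xs + i)) (of_rat (vec_b I $ i))" (is "_ \<Longrightarrow> ?R2")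
    and "i < mx I \<Longrightarrow> j < nx I \<Longrightarrow> represents (entry_A xs i j) (of_rat (mat_A I $$ (i, j)))" (is "_ \<Longrightarrow> _ \<Longrightarrow> ?R3")
    and "i < my I \<Longrightarrow> j < ny I \<Longrightarrow> represents (entry_W xs i j) (of_rat (mat_W I $$ (i, j)))" (is "_ \<Longrightarrow> _ \<Longrightarrow> ?R4")
    and "k < nx I \<Longrightarrow> i < mu I \<Longrightarrow> j < nu I \<Longrightarrow>
      represents (entry_B xs k i j) (of_rat ((coeffs_B I ! k) $$ (i, j)))" (is "_ \<Longrightarrow> _ \<Longrightarrow> _ \<Longrightarrow> ?R5")
    and "k < nu I \<Longrightarrow> i < my I \<Longrightarrow> j < nx I \<Longrightarrow>
      represents (entry_T xs k i j) (of_rat ((coeffs_T I ! k) $$ (i, j)))" (is "_ \<Longrightarrow> _ \<Longrightarrow> _ \<Longrightarrow> ?R6")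
proof -
  have wf: "wf_two_stage I" and [simp]: "tok_nx xs = nx I" "tok_nu xs = nu I" "tok_ny xs = ny I"
      "tok_mx xs = mx I" "tok_mu xs = mu I" "tok_my xs = my I"
    and es: "length (two_stage_entries I) = num_entries xs"
      "\<And>i. i < num_entries xs \<Longrightarrow> represents (entry xs i) (of_rat (two_stage_entries I ! i))"
    using assms by (auto simp: matches_def)
  let ?a = "list_of_vec (vec_a I)" and ?b = "list_of_vec (vec_b I)"
  let ?A = "mat_entries (mat_A I)" and ?W = "mat_entries (mat_W I)"
  let ?B = "concat (map mat_entries (coeffs_B I))" and ?T = "concat (map mat_entries (coeffs_T I))"
  note dims = two_stage_dims[OF wf]
  have len: "length ?a = mx I" "length ?b = mu I" "length ?A = mx I * nx I" "length ?W = my I * ny I"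
    "length ?B = nx I * (mu I * nu I)" "length ?T = nu I * (my I * nx I)"
    using dims mat_entries_nth(1) mats_entries_nth(1) by auto
  have off: "off_A xs = length (?a @ ?b)" "off_W xs = length (?a @ ?b @ ?A)" "off_B xs = length (?a @ ?b @ ?A @ ?W)"
    "off_T xs = length (?a @ ?b @ ?A @ ?W @ ?B)"
    by (simp_all only: off_A_def off_W_def off_B_def off_T_def len length_append) simp_all
  have val: "represents (entry xs (length l1 + t)) (of_rat (l2 ! t))"
    if "two_stage_entries I = l1 @ l2 @ l3" "t < length l2" for l1 l2 l3 t
    using es(2)[of "length l1 + t"] that unfolding es(1)[symmetric] by (simp add: nth_append)
  have E: "two_stage_entries I = ?a @ ?b @ ?A @ ?W @ ?B @ ?T" by (simp add: two_stage_entries_def)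
  show "i < mx I \<Longrightarrow> ?R1"
    using val[of "[]" ?a "?b @ ?A @ ?W @ ?B @ ?T" i] E len dims by (simp add: list_of_vec_index)
  show "i < mu I \<Longrightarrow> ?R2"
    using val[of ?a ?b "?A @ ?W @ ?B @ ?T" i] E len dims by (simp add: list_of_vec_index)
  show "i < mx I \<Longrightarrow> j < nx I \<Longrightarrow> ?R3"
    using val[of "?a @ ?b" ?A "?W @ ?B @ ?T" "i * nx I + j"] index_less[of i "mx I" j "nx I"] E len(3)
      mat_entries_nth(2)[OF dims(3), of i j] unfolding off by simp
  show "i < my I \<Longrightarrow> j < ny I \<Longrightarrow> ?R4"
    using val[of "?a @ ?b @ ?A" ?W "?B @ ?T" "i * ny I + j"] index_less[of i "my I" j "ny I"] E len(4)
      mat_entries_nth(2)[OF dims(4), of i j] unfolding off by simp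
  show "k < nx I \<Longrightarrow> i < mu I \<Longrightarrow> j < nu I \<Longrightarrow> ?R5"
    using val[of "?a @ ?b @ ?A @ ?W" ?B "?T" "k * (mu I * nu I) + (i * nu I + j)"]
      index_less[of k "nx I" "i * nu I + j" "mu I * nu I"] index_less[of i "mu I" j "nu I"] E len(5)
      mats_entries_nth(2)[OF dims(6), of k i j] dims(5) unfolding off by simp
  show "k < nu I \<Longrightarrow> i < my I \<Longrightarrow> j < nx I \<Longrightarrow> ?R6"
    using val[of "?a @ ?b @ ?A @ ?W @ ?B" ?T "[]" "k * (my I * nx I) + (i * nx I + j)"]
      index_less[of k "nu I" "i * nx I + j" "my I * nx I"] index_less[of i "my I" j "nx I"] E len(6)
      mats_entries_nth(2)[OF dims(8), of k i j] dims(7) unfolding off by simp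
qed

lemma nat_codes_iff: "c \<in> nat_codes n \<longleftrightarrow> (\<exists>ds. c = code_nat ds \<and> val ds = n)"
  by (auto simp: nat_codes_def code_nat_def val_def)

lemma code_tokens_alt:
  "code_tokens xs = concat (map unary_code [tok_nx xs, tok_nu xs, tok_ny xs, tok_mx xs, tok_mu xs, tok_my xs]) @
     code_nat (tok xs 6) @
     concat (map (code_entry xs) [0..<num_entries xs])"
  by (simp add: code_tokens_def unary_code_def tok_nx_def tok_nu_def tok_ny_def tok_mx_def tok_mu_def
      tok_my_def map_replicate_const upt_conv_Cons eval_nat_numeral)

lemma rat_codes_iff:
  "c \<in> rat_codes r \<longleftrightarrow> (\<exists>s p q. c = s # code_nat p @ code_nat q \<and> 0 < val q \<and>
     r = Rat.Fract (if s then - int (val p) else int (val p)) (int (val q)))" (is "?l \<longleftrightarrow> ?r")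
proof
  assume ?l
  then obtain z q s c1 d where *: "c = (s # c1) @ d" "c1 \<in> nat_codes (nat \<bar>z\<bar>)" "z \<noteq> 0 \<longrightarrow> s = (z < 0)"
      "d \<in> nat_codes q" "0 < q" "r = Rat.Fract z (int q)"
    unfolding rat_codes_def int_codes_def by blast
  obtain ps qs where "c1 = code_nat ps" "val ps = nat \<bar>z\<bar>" "d = code_nat qs" "val qs = q"
    using *(2,4) unfolding nat_codes_iff by blast
  \<comment> \<open>For zero either sign bit is allowed, and both choices give the same
    value.\<close>
  moreover have "z = (if s then - int (val ps) else int (val ps))"
    using *(3) \<open>val ps = nat \<bar>z\<bar>\<close> by (cases "z = 0") auto
  ultimately have "c = s # code_nat ps @ code_nat qs" "0 < val qs"
      "r = Rat.Fract (if s then - int (val ps) else int (val ps)) (int (val qs))"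
    using *(1,5,6) by auto
  then show ?r by blast
next
  assume ?r
  then obtain s p q where *: "c = s # code_nat p @ code_nat q" "0 < val q"
     "r = Rat.Fract (if s then - int (val p) else int (val p)) (int (val q))" by blast
  let ?z = "if s then - int (val p) else int (val p)"
  have "s # code_nat p \<in> int_codes ?z"
    unfolding int_codes_def nat_codes_iff by auto
  moreover have "code_nat q \<in> nat_codes (val q)" by (auto simp: nat_codes_iff)
  ultimately show ?l
    unfolding rat_codes_def mem_Collect_eq using *
    by (intro exI[of _ "s # code_nat p"] exI[of _ "code_nat q"] exI[of _ ?z] exI[of _ "val q"]) simp
qed

text \<open>Soundness of guessing the tokens: the instance is assembled from their values, and the
  comparison with \<open>w\<close> makes \<open>w\<close> one of its codes.\<close>

lemma check_code_matches:
  assumes "check_code w xs"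
  obtains I where "w \<in> two_stage_codes I" "matches xs I"
proof -
  let ?h = "entry_rat xs"
  have ok: "\<not> list_all Not (tok xs (9 + 3 * i))" if "i < num_entries xs" for i
    using assms that by (auto simp: check_code_def list_all_iff)
  define I where "I = \<lparr>bound = val (tok xs 6), nx = tok_nx xs, nu = tok_nu xs, ny = tok_ny xs,
    mx = tok_mx xs, mu = tok_mu xs, my = tok_my xs,
    vec_a = vec (tok_mx xs) ?h, vec_b = vec (tok_mu xs) (\<lambda>t. ?h (tok_mx xs + t)),
    mat_A = mat (tok_mx xs) (tok_nx xs) (\<lambda>(i, j). (\<lambda>t. ?h (off_A xs + t)) (i * tok_nx xs + j)),
    mat_W = mat (tok_my xs) (tok_ny xs) (\<lambda>(i, j). (\<lambda>t. ?h (off_W xs + t)) (i * tok_ny xs + j)),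
    coeffs_B = map (\<lambda>k. mat (tok_mu xs) (tok_nu xs)
      (\<lambda>(i, j). (\<lambda>t. (\<lambda>t. ?h (off_B xs + t)) (k * (tok_mu xs * tok_nu xs) + t)) (i * tok_nu xs + j))) [0..<tok_nx xs],
    coeffs_T = map (\<lambda>k. mat (tok_my xs) (tok_nx xs)
      (\<lambda>(i, j). (\<lambda>t. (\<lambda>t. ?h (off_T xs + t)) (k * (tok_my xs * tok_nx xs) + t)) (i * tok_nx xs + j))) [0..<tok_nu xs]\<rparr>"
  have wf: "wf_two_stage I" by (auto simp: wf_two_stage_def I_def)
  have "two_stage_entries I = map ?h [0..<tok_mx xs] @ map (\<lambda>t. ?h (tok_mx xs + t)) [0..<tok_mu xs] @
      map (\<lambda>t. ?h (off_A xs + t)) [0..<tok_mx xs * tok_nx xs] @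
      map (\<lambda>t. ?h (off_W xs + t)) [0..<tok_my xs * tok_ny xs] @
      map (\<lambda>t. ?h (off_B xs + t)) [0..<tok_nx xs * (tok_mu xs * tok_nu xs)] @
      map (\<lambda>t. ?h (off_T xs + t)) [0..<tok_nu xs * (tok_my xs * tok_nx xs)]"
  proof -
    have B: "mat_entries (mat (tok_mu xs) (tok_nu xs) (\<lambda>(i, j). ?h (off_B xs + (k * (tok_mu xs * tok_nu xs) + (i * tok_nu xs + j))))) =
        map (\<lambda>t. ?h (off_B xs + (k * (tok_mu xs * tok_nu xs) + t))) [0..<tok_mu xs * tok_nu xs]" for k
      by (rule mat_entries_mat)
    have T: "mat_entries (mat (tok_my xs) (tok_nx xs) (\<lambda>(i, j). ?h (off_T xs + (k * (tok_my xs * tok_nx xs) + (i * tok_nx xs + j))))) =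
        map (\<lambda>t. ?h (off_T xs + (k * (tok_my xs * tok_nx xs) + t))) [0..<tok_my xs * tok_nx xs]" for k
      by (rule mat_entries_mat)
    show ?thesis
      unfolding two_stage_entries_def I_def two_stage.simps list_of_vec_vec map_map comp_def B T
        mat_entries_mat[of _ _ "\<lambda>t. ?h (off_A xs + t)"] mat_entries_mat[of _ _ "\<lambda>t. ?h (off_W xs + t)"]
        concat_map_blocks[of "\<lambda>t. ?h (off_B xs + t)"] concat_map_blocks[of "\<lambda>t. ?h (off_T xs + t)"] ..
  qed
  also have "\<dots> = map ?h [0..<num_entries xs]"
    unfolding append_assoc[symmetric] map_upt_append off_A_def[symmetric] off_W_def[symmetric]
      off_B_def[symmetric] off_T_def[symmetric] num_entries_def[symmetric] ..
  finally have es: "two_stage_entries I = map ?h [0..<num_entries xs]" .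
  show thesis
  proof (rule that)
    show "matches xs I" unfolding matches_def es using wf represents_entry[OF ok] by (simp add: I_def)
    let ?cs = "map (code_entry xs) [0..<num_entries xs]"
    have "list_all2 (\<lambda>c r. c \<in> rat_codes r) ?cs (two_stage_entries I)"
      unfolding es list_all2_map1 list_all2_map2
    proof (rule list.rel_refl_strong)
      fix i assume "i \<in> set [0..<num_entries xs]"
      then have "0 < val (tok xs (9 + 3 * i))" using ok by (simp add: val_eq_0[symmetric])
      then show "code_entry xs i \<in> rat_codes (?h i)"
        unfolding rat_codes_iff entry_rat_def by blast
    qed
    then have "concat ?cs \<in> rat_list_codes (two_stage_entries I)" unfolding rat_list_codes_def by blast
    moreover have "code_nat (tok xs 6) \<in> nat_codes (bound I)" by (auto simp: nat_codes_iff I_def)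
    moreover have "w = concat (map unary_code [nx I, nu I, ny I, mx I, mu I, my I]) @ code_nat (tok xs 6) @ concat ?cs"
      using assms unfolding check_code_def code_tokens_alt by (simp add: I_def)
    ultimately show "w \<in> two_stage_codes I" unfolding two_stage_codes_def by blast
  qed
qed

lemma length_two_stage_entries:
  assumes "wf_two_stage I"
  shows "length (two_stage_entries I) = mx I + mu I + mx I * nx I + my I * ny I + nx I * (mu I * nu I) + nu I * (my I * nx I)"
proof -
  note dims = two_stage_dims[OF assms]
  show ?thesis
    unfolding two_stage_entries_def length_append mat_entries_nth(1)[OF dims(3)] mat_entries_nth(1)[OF dims(4)]
      mats_entries_nth(1)[OF dims(6)] mats_entries_nth(1)[OF dims(8)] dims(5) dims(7)
    using dims(1,2) by simp
qed

lemma tok_append: "tok (ts @ cs) i = (if i < length ts then ts ! i else tok cs (i - length ts))"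
  by (auto simp: tok_def nth_default_def nth_append)

lemma tok_Cons: "tok (a # l) 0 = a" "tok (a # l) (Suc i) = tok l i"
  by (auto simp: tok_def nth_default_def)

text \<open>The suffix \<open>cs\<close> stays free because the coordinates of \<open>x\<close>
  follow the instance in the same certificate. The factor 3 comes from the sign, which is a single
  bit in the code but up to three bits as a token.\<close>

lemma codes_tokens:
  assumes "wf_two_stage I" "w \<in> two_stage_codes I"
  obtains ts where "\<And>cs. check_code w (ts @ cs) \<and> matches (ts @ cs) I"
    "\<And>cs j. x_coord (ts @ cs) j = tok cs j" "length (concat (map code_nat ts)) \<le> 3 * length w"
proof -
  let ?dims = "[nx I, nu I, ny I, mx I, mu I, my I]"
  let ?es = "two_stage_entries I" let ?N = "length ?es"
  obtain c d where w: "w = concat (map unary_code ?dims) @ c @ d" "c \<in> nat_codes (bound I)" "d \<in> rat_list_codes ?es"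
    using assms(2) unfolding two_stage_codes_def by blast
  obtain ds where ds: "c = code_nat ds" "val ds = bound I" using w(2) unfolding nat_codes_iff by blast
  obtain rs where rs: "d = concat rs" "list_all2 (\<lambda>c r. c \<in> rat_codes r) rs ?es"
    using w(3) unfolding rat_list_codes_def by blast
  have lenrs: "length rs = ?N" using rs(2) by (rule list_all2_lengthD)
  have "\<forall>i. \<exists>s p q. i < ?N \<longrightarrow> rs ! i = s # code_nat p @ code_nat q \<and> 0 < val q \<and>
      ?es ! i = Rat.Fract (if s then - int (val p) else int (val p)) (int (val q))"
    using list_all2_nthD2[OF rs(2)] unfolding rat_codes_iff by blast
  then obtain s p q where t: "\<And>i. i < ?N \<Longrightarrow> rs ! i = s i # code_nat (p i) @ code_nat (q i)"
    "\<And>i. i < ?N \<Longrightarrow> 0 < val (q i)"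
    "\<And>i. i < ?N \<Longrightarrow> ?es ! i = Rat.Fract (if s i then - int (val (p i)) else int (val (p i))) (int (val (q i)))"
    unfolding choice_iff by blast
  define groups where "groups = map (\<lambda>i. [if s i then [True] else [], p i, q i]) [0..<?N]"
  define ts where "ts = map (\<lambda>n. replicate n True) ?dims @ [ds] @ concat groups"
  have g3: "\<forall>l\<in>set groups. length l = 3" by (auto simp: groups_def)
  have lg: "length (concat groups) = 3 * ?N" using length_concat_uniform[OF g3] by (simp add: groups_def)
  have lts: "length ts = 7 + 3 * ?N" by (simp add: ts_def lg)
  have grp: "tok (ts @ cs) (7 + 3 * i) = (if s i then [True] else [])"
    "tok (ts @ cs) (8 + 3 * i) = p i" "tok (ts @ cs) (9 + 3 * i) = q i" if i: "i < ?N" for cs i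
  proof -
    have "tok (ts @ cs) (7 + (i * 3 + j)) = groups ! i ! j" if "j < 3" for j
    proof -
      have "7 + (i * 3 + j) < length ts" using i that lts by simp
      then have "tok (ts @ cs) (7 + (i * 3 + j)) = ts ! (7 + (i * 3 + j))" by (simp add: tok_append)
      also have "\<dots> = concat groups ! (i * 3 + j)"
        by (simp add: ts_def nth_append)
      also have "\<dots> = groups ! i ! j" using nth_concat_uniform[OF g3] i that by (simp add: groups_def)
      finally show ?thesis .
    qed
    from this[of 0] this[of 1] this[of 2] show
      "tok (ts @ cs) (7 + 3 * i) = (if s i then [True] else [])"
      "tok (ts @ cs) (8 + 3 * i) = p i" "tok (ts @ cs) (9 + 3 * i) = q i"
      using i by (simp_all add: groups_def mult.commute eval_nat_numeral)
  qed
  have dims: "tok_nx (ts @ cs) = nx I" "tok_nu (ts @ cs) = nu I" "tok_ny (ts @ cs) = ny I" "tok_mx (ts @ cs) = mx I"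
    "tok_mu (ts @ cs) = mu I" "tok_my (ts @ cs) = my I" "tok (ts @ cs) 6 = ds" for cs
    by (simp_all add: tok_nx_def tok_nu_def tok_ny_def tok_mx_def tok_mu_def tok_my_def tok_Cons ts_def eval_nat_numeral)
  have num: "num_entries (ts @ cs) = ?N" for cs
    unfolding num_entries_def off_T_def off_B_def off_W_def off_A_def dims length_two_stage_entries[OF assms(1)] by simp
  have ok: "\<not> list_all Not (tok (ts @ cs) (9 + 3 * i))" if "i < ?N" for cs i
    using that t(2) by (simp add: grp val_eq_0[symmetric])
  have es: "entry_rat (ts @ cs) i = ?es ! i" if "i < ?N" for cs i
    using that t(3) by (simp add: entry_rat_def grp)
  show thesis
  proof (rule that)
    fix cs
    have m: "matches (ts @ cs) I"
      unfolding matches_def dims num using assms(1) ds(2) represents_entry[OF ok[of _ cs]] es by simp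
    have "map (code_entry (ts @ cs)) [0..<?N] = rs"
      using lenrs t(1) by (intro nth_equalityI) (auto simp: grp)
    then have "w = code_tokens (ts @ cs)"
      unfolding code_tokens_alt dims num w(1) ds(1) rs(1) by simp
    moreover have "list_all (\<lambda>i. \<not> list_all Not (tok (ts @ cs) (9 + 3 * i))) [0..<?N]" using ok by (simp add: list_all_iff)
    ultimately have "check_code w (ts @ cs)"
      unfolding check_code_def num by (intro conjI)
    with m show "check_code w (ts @ cs) \<and> matches (ts @ cs) I" by simp
    fix j
    have "\<not> 7 + 3 * num_entries (ts @ cs) + j < length ts" "7 + 3 * num_entries (ts @ cs) + j - length ts = j"
      unfolding num lts by simp_all
    then show "x_coord (ts @ cs) j = tok cs j" unfolding x_coord_def tok_append by simp
  next
    have "length (concat (map code_nat (concat groups))) \<le> 3 * length d"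
    proof -
      have "length (concat (map code_nat (concat (map (\<lambda>i. [if s i then [True] else [], p i, q i]) [0..<n]))))
         \<le> 3 * length (concat (map (\<lambda>i. rs ! i) [0..<n]))" if "n \<le> ?N" for n
        using that by (induction n) (auto simp: t(1) length_code_nat)
      from this[of ?N] show ?thesis unfolding groups_def rs(1) using lenrs map_nth[of rs] by simp
    qed
    then show "length (concat (map code_nat ts)) \<le> 3 * length w"
      unfolding ts_def w(1) ds(1) by (simp add: length_code_nat unary_code_def)
  qed
qed

section \<open>Correctness of the verifier\<close>

lemma X_d_iff:
  assumes "wf_two_stage I" "x \<in> carrier_vec (nx I)"
  shows "x \<in> X_d I \<longleftrightarrow> (\<forall>j<nx I. 0 \<le> x $ j \<and> x $ j \<le> bound I \<and> x $ j \<in> \<int>) \<and>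
    (\<forall>i<mx I. (\<Sum>j<nx I. of_rat (mat_A I $$ (i, j)) * x $ j) \<le> of_rat (vec_a I $ i))"
  using assms by (auto simp: X_d_def box_def int_vecs_def wf_two_stage_def less_eq_vec_def scalar_prod_def lessThan_atLeast0)

lemma U_c_iff:
  assumes "wf_two_stage I" "u \<in> carrier_vec (nu I)"
  shows "u \<in> U_c I x \<longleftrightarrow> (\<forall>j<nu I. 0 \<le> u $ j \<and> u $ j \<le> bound I) \<and>
    (\<forall>i<mu I. (\<Sum>j<nu I. (\<Sum>k<nx I. x $ k * of_rat ((coeffs_B I ! k) $$ (i, j))) * u $ j) \<le> of_rat (vec_b I $ i))"
  using assms by (auto simp: U_c_def box_def wf_two_stage_def less_eq_vec_def scalar_prod_def lessThan_atLeast0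
      mat_B_def linear_mat_def)

lemma Y_d_iff:
  assumes "wf_two_stage I" "x \<in> carrier_vec (nx I)" "y \<in> carrier_vec (ny I)"
  shows "y \<in> Y_d I x u \<longleftrightarrow> (\<forall>j<ny I. 0 \<le> y $ j \<and> y $ j \<le> bound I \<and> y $ j \<in> \<int>) \<and>
    (\<forall>i<my I. (\<Sum>j<nx I. (\<Sum>k<nu I. u $ k * of_rat ((coeffs_T I ! k) $$ (i, j))) * x $ j) +
      (\<Sum>j<ny I. of_rat (mat_W I $$ (i, j)) * y $ j) \<le> 0)"
  using assms by (auto simp: Y_d_def box_def int_vecs_def wf_two_stage_def less_eq_vec_def scalar_prod_def lessThan_atLeast0
      mat_T_def linear_mat_def)

section \<open>Vectors described by the certificates\<close>

definition x_vec :: "two_stage \<Rightarrow> bits list \<Rightarrow> real vec" where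
  "x_vec I xs = vec (nx I) (\<lambda>j. real (val (x_coord xs j)))"

definition u_vec :: "two_stage \<Rightarrow> bits list \<Rightarrow> real vec" where
  "u_vec I ys = vec (nu I) (\<lambda>j. real (val (tok ys (Suc j))) / real (val (tok ys 0)))"

definition y_vec :: "two_stage \<Rightarrow> bits list \<Rightarrow> real vec" where
  "y_vec I zs = vec (ny I) (\<lambda>j. real (val (tok zs j)))"

lemma represents_u_coord:
  "0 < val (tok ys 0) \<Longrightarrow> represents (u_coord ys j) (real (val (tok ys (Suc j))) / real (val (tok ys 0)))"
  by (simp add: u_coord_def represents_def)

lemma check_X_iff:
  assumes "matches xs I"
  shows "check_X xs \<longleftrightarrow> x_vec I xs \<in> X_d I"
proof -
  have wf: "wf_two_stage I" and dims: "tok_nx xs = nx I" "tok_mx xs = mx I" "val (tok xs 6) = bound I"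
    using assms by (auto simp: matches_def)
  have x: "x_vec I xs \<in> carrier_vec (nx I)" by (simp add: x_vec_def)
  have "represents (row_X xs i) (- of_rat (vec_a I $ i) + (\<Sum>j<nx I. of_rat (mat_A I $$ (i, j)) * real (val (x_coord xs j))))"
    if "i < mx I" for i
    unfolding row_X_def dims(1) using that
    by (intro represents_intros matches_entries[OF assms, unfolded dims(1)])
  then have "frac_nonpos (row_X xs i) \<longleftrightarrow> (\<Sum>j<nx I. of_rat (mat_A I $$ (i, j)) * x_vec I xs $ j) \<le> of_rat (vec_a I $ i)"
    if "i < mx I" for i using frac_nonpos_iff that by (fastforce simp: x_vec_def)
  then show ?thesis
    unfolding check_X_def X_d_iff[OF wf x] by (auto simp: list_all_iff dims le_bits_iff x_vec_def)
qed

lemma check_U_iff: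
  assumes "matches xs I" "0 < val (tok ys 0)"
  shows "check_U xs ys \<longleftrightarrow> u_vec I ys \<in> U_c I (x_vec I xs)"
proof -
  have wf: "wf_two_stage I" and dims: "tok_nx xs = nx I" "tok_nu xs = nu I" "tok_mu xs = mu I" "val (tok xs 6) = bound I"
    using assms by (auto simp: matches_def)
  have u: "u_vec I ys \<in> carrier_vec (nu I)" by (simp add: u_vec_def)
  have "represents (row_U xs ys i) (- of_rat (vec_b I $ i) +
      (\<Sum>j<nu I. (\<Sum>k<nx I. real (val (x_coord xs k)) * of_rat ((coeffs_B I ! k) $$ (i, j))) *
        (real (val (tok ys (Suc j))) / real (val (tok ys 0)))))"
    if "i < mu I" for i
    unfolding row_U_def dims(1,2) using that
    by (intro represents_intros represents_u_coord assms(2) matches_entries[OF assms(1), unfolded dims(2)])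
  then have "frac_nonpos (row_U xs ys i) \<longleftrightarrow>
      (\<Sum>j<nu I. (\<Sum>k<nx I. x_vec I xs $ k * of_rat ((coeffs_B I ! k) $$ (i, j))) * u_vec I ys $ j) \<le> of_rat (vec_b I $ i)"
    if "i < mu I" for i using frac_nonpos_iff that by (fastforce simp: x_vec_def u_vec_def)
  moreover have "le_bits (tok ys (Suc j)) (mult_bits (tok xs 6) (tok ys 0)) \<longleftrightarrow> 0 \<le> u_vec I ys $ j \<and> u_vec I ys $ j \<le> bound I"
    if "j < nu I" for j
  proof -
    have "real (val (tok ys (Suc j))) / real (val (tok ys 0)) \<le> real (bound I) \<longleftrightarrow>
        real (val (tok ys (Suc j))) \<le> real (bound I * val (tok ys 0))"
      using assms(2) by (simp add: pos_divide_le_eq)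
    then show ?thesis using that by (simp only: le_bits_iff val_mult_bits dims of_nat_le_iff) (simp add: u_vec_def)
  qed
  ultimately show ?thesis
    unfolding check_U_def U_c_iff[OF wf u] list_all_iff by (auto simp: dims(2,3))
qed

lemma check_Y_iff:
  assumes "matches xs I" "0 < val (tok ys 0)"
  shows "check_Y xs ys zs \<longleftrightarrow> y_vec I zs \<in> Y_d I (x_vec I xs) (u_vec I ys)"
proof -
  have wf: "wf_two_stage I" and dims: "tok_nx xs = nx I" "tok_nu xs = nu I" "tok_ny xs = ny I" "tok_my xs = my I"
      "val (tok xs 6) = bound I"
    using assms by (auto simp: matches_def)
  have c: "x_vec I xs \<in> carrier_vec (nx I)" "y_vec I zs \<in> carrier_vec (ny I)"
    by (simp_all add: x_vec_def y_vec_def)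
  have "represents (row_Y xs ys zs i)
      ((\<Sum>j<nx I. (\<Sum>k<nu I. (real (val (tok ys (Suc k))) / real (val (tok ys 0))) * of_rat ((coeffs_T I ! k) $$ (i, j))) *
         real (val (x_coord xs j))) + (\<Sum>j<ny I. of_rat (mat_W I $$ (i, j)) * real (val (tok zs j))))"
    if "i < my I" for i
    unfolding row_Y_def dims(1,2,3) using that
    by (intro represents_intros represents_u_coord assms(2) matches_entries[OF assms(1), unfolded dims(1,3)])
  then have "frac_nonpos (row_Y xs ys zs i) \<longleftrightarrow>
      (\<Sum>j<nx I. (\<Sum>k<nu I. u_vec I ys $ k * of_rat ((coeffs_T I ! k) $$ (i, j))) * x_vec I xs $ j) +
      (\<Sum>j<ny I. of_rat (mat_W I $$ (i, j)) * y_vec I zs $ j) \<le> 0"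
    if "i < my I" for i using frac_nonpos_iff that by (fastforce simp: x_vec_def u_vec_def y_vec_def)
  then show ?thesis
    unfolding check_Y_def Y_d_iff[OF wf c] list_all_iff
    by (auto simp: dims(3,4,5) le_bits_iff y_vec_def)
qed

section \<open>Sizes of certificates\<close>

text \<open>A fixed width, with zeros in the high digits, makes the length of a certificate
  independent of the numbers in it.\<close>

definition to_bits :: "nat \<Rightarrow> nat \<Rightarrow> bits" where
  "to_bits k m = map (bit m) [0..<k]"

lemma length_to_bits [simp]: "length (to_bits k m) = k"
  by (simp add: to_bits_def)

lemma val_to_bits: "m < 2 ^ k \<Longrightarrow> val (to_bits k m) = m"
  by (simp add: to_bits_def val_def horner_sum_bit_eq_take_bit take_bit_nat_eq_self)

lemma length_code_to_bits:
  "length (concat (map code_nat (map (\<lambda>j. to_bits k (f j)) [0..<m]))) = m * (2 * k + 1)"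
  by (induction m) (auto simp: length_code_nat)

lemma tok_map_upt: "j < m \<Longrightarrow> tok (map f [0..<m]) j = f j"
  by (simp add: tok_def nth_default_def)

lemma sum_list_map_upt: "sum_list (map f [0..<n]) = (\<Sum>j<n. f j)"
  by (induction n) auto

text \<open>Unary dimensions appear in \<open>w\<close> at full size, and \<open>code_nat\<close> is
  longer than the digits it carries. The last bound is on the sum over all entries because it will
  control a product of denominators.\<close>

lemma length_code_tokens:
  assumes "check_code w xs"
  shows "tok_nx xs \<le> length w" "tok_nu xs \<le> length w" "tok_ny xs \<le> length w" "tok_mx xs \<le> length w"
    "tok_mu xs \<le> length w" "tok_my xs \<le> length w" "length (tok xs 6) \<le> length w"
    "(\<Sum>i<num_entries xs. length (tok xs (8 + 3 * i)) + length (tok xs (9 + 3 * i))) \<le> length w"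
proof -
  have w: "w = code_tokens xs" using assms by (simp add: check_code_def)
  have "(\<Sum>i<num_entries xs. length (tok xs (8 + 3 * i)) + length (tok xs (9 + 3 * i))) \<le>
      (\<Sum>i<num_entries xs. length (code_entry xs i))"
    by (rule sum_mono) (simp add: length_code_nat)
  also have "\<dots> = length (concat (map (code_entry xs) [0..<num_entries xs]))"
    unfolding length_concat map_map comp_def sum_list_map_upt ..
  also have "\<dots> \<le> length w" unfolding w code_tokens_alt by simp
  finally show "(\<Sum>i<num_entries xs. length (tok xs (8 + 3 * i)) + length (tok xs (9 + 3 * i))) \<le> length w" .
qed (use assms in \<open>simp_all add: check_code_def code_tokens_alt unary_code_def length_code_nat\<close>)

text \<open>\<open>M\<close> is the product of all denominators. Multiplying entry \<open>i\<close>
  by it cancels the denominator of that entry; what remains is, up to sign, a numerator times the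
  other denominators, and the tokens of these lie in disjoint parts of \<open>w\<close>.\<close>

lemma common_denominator:
  assumes "check_code w xs"
  obtains M :: nat where "M > 0"
    "\<And>i r. i < num_entries xs \<Longrightarrow> represents (entry xs i) r \<Longrightarrow> real M * r \<in> \<int> \<and> \<bar>real M * r\<bar> \<le> 2 ^ length w"
proof -
  let ?N = "num_entries xs"
  let ?p = "\<lambda>i. tok xs (8 + 3 * i)" and ?q = "\<lambda>i. tok xs (9 + 3 * i)"
  have q: "0 < val (?q i)" if "i < ?N" for i
    using assms that by (auto simp: check_code_def list_all_iff[of _ "[0..<_]"] val_eq_0[symmetric])
  define M where "M = (\<Prod>i<?N. val (?q i))"
  show thesis
  proof (rule that)
    show "M > 0" unfolding M_def using q by (intro prod_pos) auto
    fix i r assume i: "i < ?N" and r: "represents (entry xs i) r"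
    let ?c = "val (?p i) * (\<Prod>j\<in>{..<?N} - {i}. val (?q j))"
    have M: "M = val (?q i) * (\<Prod>j\<in>{..<?N} - {i}. val (?q j))"
      unfolding M_def using i by (intro prod.remove) auto
    have "real M * r = real ?c \<or> real M * r = - real ?c"
      using q[OF i] r unfolding M by (simp add: entry_def represents_def)
    moreover have "?c \<le> 2 ^ length w"
    proof -
      have "?c \<le> 2 ^ length (?p i) * (\<Prod>j\<in>{..<?N} - {i}. 2 ^ length (?q j))"
        by (intro mult_mono prod_mono) (auto intro: less_imp_le val_less)
      also have "\<dots> = 2 ^ (length (?p i) + (\<Sum>j\<in>{..<?N} - {i}. length (?q j)))"
        by (simp add: power_add power_sum)
      also have "\<dots> \<le> 2 ^ length w"
      proof (rule power_increasing)
        have "length (?p i) + (\<Sum>j\<in>{..<?N} - {i}. length (?q j)) \<le>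
            (length (?p i) + length (?q i)) + (\<Sum>j\<in>{..<?N} - {i}. length (?p j) + length (?q j))"
          by (simp add: sum.distrib)
        also have "\<dots> = (\<Sum>j<?N. length (?p j) + length (?q j))"
          using i by (intro sum.remove[symmetric]) auto
        finally show "length (?p i) + (\<Sum>j\<in>{..<?N} - {i}. length (?q j)) \<le> length w"
          using length_code_tokens(8)[OF assms] by linarith
      qed simp
      finally show ?thesis .
    qed
    then have "real ?c \<le> 2 ^ length w" by (metis of_nat_le_iff of_nat_power of_nat_numeral)
    ultimately show "real M * r \<in> \<int> \<and> \<bar>real M * r\<bar> \<le> 2 ^ length w"
      by (elim disjE) (simp_all only: abs_minus_cancel abs_of_nat Ints_of_nat Ints_minus simp_thms)
  qed
qed

lemma sum_Ints_bounded:
  fixes f :: "nat \<Rightarrow> real"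
  assumes "\<And>k. k < m \<Longrightarrow> f k \<in> \<int> \<and> \<bar>f k\<bar> \<le> C"
  shows "(\<Sum>k<m. f k) \<in> \<int> \<and> \<bar>\<Sum>k<m. f k\<bar> \<le> real m * C"
proof
  show "(\<Sum>k<m. f k) \<in> \<int>" using assms by (intro Ints_sum) auto
  have "\<bar>\<Sum>k<m. f k\<bar> \<le> (\<Sum>k<m. \<bar>f k\<bar>)" by (rule sum_abs)
  also have "\<dots> \<le> (\<Sum>k<m. C)" using assms by (intro sum_mono) auto
  finally show "\<bar>\<Sum>k<m. f k\<bar> \<le> real m * C" by simp
qed

text \<open>The factorial contributes at most \<open>n * (n + 1)\<close> bits. The base of the power
  has at most \<open>4 * n\<close> bits from \<open>m\<close> and \<open>6 * n\<close> from the
  square, and the exponent is at most \<open>n + 1\<close>; together this is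
  \<open>11 * n * (n + 1)\<close>.\<close>

lemma counterexample_bound:
  fixes N n m k q :: nat
  assumes "N \<le> n" "m \<le> 4 * n + 1" "real q \<le> fact (Suc N) * (real m * (2 ^ (3 * n))\<^sup>2) ^ Suc N"
  shows "q \<le> 2 ^ (11 * (n + 1)\<^sup>2)"
proof -
  have e: "k + 1 \<le> 2 ^ k" for k :: nat by (metis Suc_eq_plus1 Suc_leI less_exp)
  have "fact (Suc N) \<le> (Suc N ^ Suc N :: nat)" using fact_le_power[of "Suc N", where 'a = nat] by simp
  also have "\<dots> \<le> (2 ^ n) ^ Suc N" using e[of n] assms(1) by (intro power_mono) auto
  also have "\<dots> \<le> (2 ^ n) ^ (n + 1)" using assms(1) by (intro power_increasing) auto
  finally have f: "fact (Suc N) \<le> (2 ^ (n * (n + 1)) :: nat)" unfolding power_mult[symmetric] .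
  have "m * (2 ^ (3 * n))\<^sup>2 \<le> 2 ^ (4 * n) * 2 ^ (6 * n)"
    using e[of "4 * n"] assms(2) by (intro mult_mono) (auto simp: power_mult[symmetric])
  also have "\<dots> = 2 ^ (10 * n)" by (simp add: power_add[symmetric])
  finally have "(m * (2 ^ (3 * n))\<^sup>2) ^ Suc N \<le> (2 ^ (10 * n)) ^ Suc N" by (intro power_mono) auto
  also have "\<dots> \<le> (2 ^ (10 * n)) ^ (n + 1)" using assms(1) by (intro power_increasing) auto
  finally have g: "(m * (2 ^ (3 * n))\<^sup>2) ^ Suc N \<le> 2 ^ (10 * n * (n + 1))" unfolding power_mult[symmetric] .
  have "real q \<le> real (fact (Suc N) * (m * (2 ^ (3 * n))\<^sup>2) ^ Suc N)"
    using assms(3) by (simp only: of_nat_mult of_nat_power of_nat_fact of_nat_numeral)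
  then have "q \<le> fact (Suc N) * (m * (2 ^ (3 * n))\<^sup>2) ^ Suc N" by (simp only: of_nat_le_iff)
  also have "\<dots> \<le> 2 ^ (n * (n + 1)) * 2 ^ (10 * n * (n + 1))" using f g by (intro mult_mono) auto
  also have "\<dots> = 2 ^ (11 * (n * (n + 1)))" by (simp add: power_add[symmetric] algebra_simps)
  also have "\<dots> \<le> 2 ^ (11 * (n + 1)\<^sup>2)"
    by (intro power_increasing) (auto simp: power2_eq_square)
  finally show ?thesis .
qed

lemma small_bad_scenario:
  assumes "check_code w xs" "matches xs I" "x \<in> X_d I" "u \<in> U_c I x" "\<And>y. y \<notin> Y_d I x u"
  obtains ys where "val (tok ys 0) > 0" "u_vec I ys \<in> U_c I x" "\<And>y. y \<notin> Y_d I x (u_vec I ys)"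
    "length (concat (map code_nat ys)) \<le> 25 * (length w + 1) ^ 3"
proof -
  let ?n = "length w"
  have wf: "wf_two_stage I" and dims: "tok_nx xs = nx I" "tok_nu xs = nu I" "tok_ny xs = ny I" "tok_mx xs = mx I"
      "tok_mu xs = mu I" "tok_my xs = my I" "val (tok xs 6) = bound I"
    using assms(2) by (auto simp: matches_def)
  note len = length_code_tokens[OF assms(1), unfolded dims]
  have "bound I < 2 ^ length (tok xs 6)" using val_less[of "tok xs 6"] dims by simp
  also have "\<dots> \<le> 2 ^ ?n" using len(7) by (intro power_increasing) auto
  finally have R: "bound I < 2 ^ ?n" .
  then have R': "real (bound I) \<le> 2 ^ ?n"
    by (metis less_imp_le of_nat_le_iff of_nat_numeral of_nat_power)
  have xc: "x \<in> carrier_vec (nx I)" and uc: "u \<in> carrier_vec (nu I)"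
    using assms(3,4) by (auto simp: X_d_def U_c_def box_def)
  have x: "\<And>j. j < nx I \<Longrightarrow> 0 \<le> x $ j \<and> x $ j \<le> bound I \<and> x $ j \<in> \<int>"
    using assms(3) X_d_iff[OF wf xc] by blast
  obtain M :: nat where M: "M > 0"
    "\<And>i r. i < num_entries xs \<Longrightarrow> represents (entry xs i) r \<Longrightarrow> real M * r \<in> \<int> \<and> \<bar>real M * r\<bar> \<le> 2 ^ ?n"
    using common_denominator[OF assms(1)] by blast
  note m = matches_entries[OF assms(2), unfolded dims]
  note num = num_entries_def off_T_def off_B_def off_W_def off_A_def dims
  let ?int = "\<lambda>r :: real. real M * r \<in> \<int> \<and> \<bar>real M * r\<bar> \<le> 2 ^ ?n"
  have Mb: "real M * of_rat (vec_b I $ i) \<in> \<int>" if "i < mu I" for i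
    using M(2)[OF _ m(2)[OF that]] that by (simp add: num)
  have MW: "?int (of_rat (mat_W I $$ (i, j)))"
    if "i < my I" "j < ny I" for i j
    using M(2)[OF _ m(4)[OF that]] index_less[OF that] by (simp add: num)
  have MB: "?int (of_rat ((coeffs_B I ! k) $$ (i, j)))"
    if "k < nx I" "i < mu I" "j < nu I" for k i j
    using M(2)[OF _ m(5)[OF that]] index_less[OF that(1) index_less[OF that(2,3)]] by (simp add: num)
  have MT: "?int (of_rat ((coeffs_T I ! k) $$ (i, j)))"
    if "k < nu I" "i < my I" "j < nx I" for k i j
    using M(2)[OF _ m(6)[OF that]] index_less[OF that(1) index_less[OF that(2,3)]] by (simp add: num)
  \<comment> \<open>Bounds a sum of at most \<open>2 ^ ?n\<close> terms, each a coordinate of size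
    at most \<open>2 ^ ?n\<close> times a scaled entry of size at most
    \<open>2 ^ ?n\<close>.\<close>
  define K :: real where "K = 2 ^ (3 * ?n)"
  have bounded: "(\<Sum>k<a. z k * (real M * c k)) \<in> \<int> \<and> \<bar>\<Sum>k<a. z k * (real M * c k)\<bar> \<le> K" (is "?s \<in> \<int> \<and> _")
    if z: "\<And>k. k < a \<Longrightarrow> 0 \<le> z k \<and> z k \<le> bound I \<and> z k \<in> \<int>" and a: "a \<le> ?n"
      and c: "\<And>k. k < a \<Longrightarrow> ?int (c k)" for a and z c :: "nat \<Rightarrow> real"
  proof -
    have "?s \<in> \<int> \<and> \<bar>?s\<bar> \<le> real a * (2 ^ ?n * 2 ^ ?n)"
    proof (rule sum_Ints_bounded)
      fix k assume k: "k < a"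
      have "\<bar>z k\<bar> \<le> 2 ^ ?n" using z[OF k] R' by linarith
      then have "\<bar>z k * (real M * c k)\<bar> \<le> 2 ^ ?n * 2 ^ ?n"
        unfolding abs_mult[of "z k"] using c[OF k] by (intro mult_mono) auto
      then show "z k * (real M * c k) \<in> \<int> \<and> \<bar>z k * (real M * c k)\<bar> \<le> 2 ^ ?n * 2 ^ ?n"
        using z[OF k] c[OF k] by (simp add: Ints_mult)
    qed
    moreover have "real a * (2 ^ ?n * 2 ^ ?n) \<le> K"
    proof -
      have "real a \<le> 2 ^ ?n" using a of_nat_less_two_power[of ?n, where 'a = real] by linarith
      then have "real a * (2 ^ ?n * 2 ^ ?n) \<le> 2 ^ ?n * (2 ^ ?n * 2 ^ ?n)" by (intro mult_right_mono) auto
      also have "\<dots> = K" unfolding K_def power_add[symmetric] by (rule arg_cong[where f = "power 2"]) simp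
      finally show ?thesis .
    qed
    ultimately show ?thesis by linarith
  qed
  \<comment> \<open>With \<open>x\<close> fixed, \<beta> and \<tau> are the coefficients of
    \<open>u\<close> in \<open>B(x) u\<close> and \<open>T(u) x\<close>; \<open>M\<close> makes them
    integral because the coordinates of \<open>x\<close> are integers.\<close>
  define \<beta> where "\<beta> = (\<lambda>i j. \<Sum>k<nx I. x $ k * of_rat ((coeffs_B I ! k) $$ (i, j)))"
  define \<tau> where "\<tau> = (\<lambda>i k. \<Sum>j<nx I. x $ j * of_rat ((coeffs_T I ! k) $$ (i, j)))"
  define \<omega> where "\<omega> = (\<lambda>y i. \<Sum>j<ny I. y $ j * of_rat (mat_W I $$ (i, j)) :: real)"
  define S :: "real vec set" where "S = {y \<in> carrier_vec (ny I). \<forall>j<ny I. 0 \<le> y $ j \<and> y $ j \<le> bound I \<and> y $ j \<in> \<int>}"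
  have U_iff: "v \<in> U_c I x \<longleftrightarrow> (\<forall>j<nu I. 0 \<le> v $ j \<and> v $ j \<le> bound I) \<and>
      (\<forall>i<mu I. (\<Sum>j<nu I. \<beta> i j * v $ j) \<le> of_rat (vec_b I $ i))" if "v \<in> carrier_vec (nu I)" for v
    unfolding U_c_iff[OF wf that] \<beta>_def ..
  have Y_iff: "(\<forall>y. y \<notin> Y_d I x v) \<longleftrightarrow> (\<forall>y\<in>S. \<exists>i<my I. (\<Sum>j<nu I. \<tau> i j * v $ j) + \<omega> y i > 0)" for v
  proof -
    \<comment> \<open>\<open>T(u) x\<close> is bilinear; exchanging the sums exhibits it as linear
      in \<open>u\<close>.\<close>
    have swap: "(\<Sum>j<nx I. (\<Sum>k<nu I. v $ k * of_rat ((coeffs_T I ! k) $$ (i, j))) * x $ j) = (\<Sum>j<nu I. \<tau> i j * v $ j)" for i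
      unfolding \<tau>_def sum_distrib_right by (subst sum.swap) (simp add: mult_ac)
    have "y \<in> Y_d I x v \<longleftrightarrow> y \<in> S \<and> (\<forall>i<my I. (\<Sum>j<nu I. \<tau> i j * v $ j) + \<omega> y i \<le> 0)" for y
    proof (cases "y \<in> carrier_vec (ny I)")
      case True
      show ?thesis unfolding Y_d_iff[OF wf xc True] swap S_def \<omega>_def using True by (simp add: mult.commute)
    next
      case False
      then show ?thesis by (simp add: S_def Y_d_def box_def)
    qed
    then show ?thesis by (meson not_le)
  qed
  obtain q :: nat and v :: "nat \<Rightarrow> nat"
    where q: "q > 0" "real q \<le> fact (Suc (nu I)) * (real (2 * nu I + 1 + mu I + my I) * K\<^sup>2) ^ Suc (nu I)"
    and v: "\<And>j. j < nu I \<Longrightarrow> v j \<le> bound I * q"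
      "\<And>i. i < mu I \<Longrightarrow> (\<Sum>j<nu I. \<beta> i j * (v j / q)) \<le> of_rat (vec_b I $ i)"
      "\<And>y. y \<in> S \<Longrightarrow> \<exists>i<my I. (\<Sum>j<nu I. \<tau> i j * (v j / q)) + \<omega> y i > 0"
  proof (rule small_counterexample[of K "bound I" M "mu I" "nu I" \<beta> "\<lambda>i. of_rat (vec_b I $ i)" "my I" \<tau> S \<omega> K "\<lambda>j. u $ j"])
    show "1 \<le> K" by (simp add: K_def)
    show "real (bound I) \<le> K"
    proof -
      have "(2::real) ^ ?n \<le> K" unfolding K_def by (intro power_increasing) auto
      then show ?thesis using R' by linarith
    qed
    show "M > 0" by (rule M(1))
    show "real M * \<beta> i j \<in> \<int> \<and> \<bar>real M * \<beta> i j\<bar> \<le> K" if "i < mu I" "j < nu I" for i j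
      using bounded[of "nx I" "\<lambda>k. x $ k" "\<lambda>k. of_rat ((coeffs_B I ! k) $$ (i, j))"] x len(1) MB that
      by (simp add: \<beta>_def sum_distrib_left mult.left_commute)
    show "real M * of_rat (vec_b I $ i) \<in> \<int>" if "i < mu I" for i by (rule Mb[OF that])
    show "real M * \<tau> i j \<in> \<int> \<and> \<bar>real M * \<tau> i j\<bar> \<le> K" if "i < my I" "j < nu I" for i j
      using bounded[of "nx I" "\<lambda>k. x $ k" "\<lambda>k. of_rat ((coeffs_T I ! j) $$ (i, k))"] x len(1) MT that
      by (simp add: \<tau>_def sum_distrib_left mult.left_commute)
    show "real M * \<omega> y i \<in> \<int> \<and> - K \<le> real M * \<omega> y i" if y: "y \<in> S" "i < my I" for y i
    proof -
      let ?sum = "\<Sum>k<ny I. y $ k * (real M * of_rat (mat_W I $$ (i, k)))"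
      have "?sum \<in> \<int> \<and> \<bar>?sum\<bar> \<le> K"
        by (rule bounded) (use y len(3) MW in \<open>auto simp: S_def\<close>)
      moreover have "real M * \<omega> y i = ?sum"
        by (simp add: \<omega>_def sum_distrib_left mult.left_commute)
      ultimately have "real M * \<omega> y i \<in> \<int> \<and> \<bar>real M * \<omega> y i\<bar> \<le> K" by (simp only:)
      then show ?thesis by (auto simp: abs_le_iff)
    qed
    show "0 \<le> u $ j \<and> u $ j \<le> real (bound I)" if "j < nu I" for j using assms(4) U_iff[OF uc] that by blast
    show "(\<Sum>j<nu I. \<beta> i j * u $ j) \<le> of_rat (vec_b I $ i)" if "i < mu I" for i using assms(4) U_iff[OF uc] that by blast
    show "\<exists>i<my I. (\<Sum>j<nu I. \<tau> i j * u $ j) + \<omega> y i > 0" if "y \<in> S" for y using assms(5) Y_iff[of u] that by blast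
  qed (rule that)
  \<comment> \<open>\<open>11 * (?n + 1)\<^sup>2\<close> bits for the denominator and
    \<open>?n\<close> more for the factor \<open>bound I\<close> in the numerators.\<close>
  define k where "k = 12 * (?n + 1)\<^sup>2"
  have "q \<le> 2 ^ (11 * (?n + 1)\<^sup>2)"
    by (rule counterexample_bound[OF len(2) _ q(2)[unfolded K_def]]) (use len in simp)
  have "bound I * q < 2 ^ ?n * 2 ^ (11 * (?n + 1)\<^sup>2)"
    using R \<open>q \<le> 2 ^ (11 * (?n + 1)\<^sup>2)\<close> q(1) by (intro mult_less_le_imp_less) auto
  also have "\<dots> = 2 ^ (?n + 11 * (?n + 1)\<^sup>2)" by (simp add: power_add)
  also have "\<dots> \<le> 2 ^ k" unfolding k_def by (intro power_increasing) (auto simp: power2_eq_square)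
  finally have vk: "v j < 2 ^ k" if "j < nu I" for j using v(1)[OF that] by linarith
  have "(2::nat) ^ (11 * (?n + 1)\<^sup>2) < 2 ^ k" unfolding k_def by (intro power_strict_increasing) auto
  with \<open>q \<le> 2 ^ (11 * (?n + 1)\<^sup>2)\<close> have qk: "q < 2 ^ k" by linarith
  define ys where "ys = to_bits k q # map (\<lambda>j. to_bits k (v j)) [0..<nu I]"
  have ys: "val (tok ys 0) = q" "\<And>j. j < nu I \<Longrightarrow> val (tok ys (Suc j)) = v j"
    by (simp_all add: ys_def tok_Cons tok_map_upt val_to_bits qk vk)
  have uv: "u_vec I ys \<in> carrier_vec (nu I)" "\<And>j. j < nu I \<Longrightarrow> u_vec I ys $ j = real (v j) / real q"
    by (simp_all add: u_vec_def ys)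
  show thesis
  proof (rule that)
    show "val (tok ys 0) > 0" using ys q by simp
    have "real (v j) / real q \<le> real (bound I)" if "j < nu I" for j
    proof -
      have "real (v j) \<le> real (bound I) * real q" using v(1)[OF that] by (metis of_nat_le_iff of_nat_mult)
      then show ?thesis using q(1) by (simp add: pos_divide_le_eq)
    qed
    then show "u_vec I ys \<in> U_c I x"
      unfolding U_iff[OF uv(1)] using v(2) by (simp add: uv(2))
    have "\<forall>y. y \<notin> Y_d I x (u_vec I ys)" unfolding Y_iff using v(3) by (simp add: uv(2))
    then show "y \<notin> Y_d I x (u_vec I ys)" for y by blast
    \<comment> \<open>The denominator and \<open>nu I\<close> numerators, each a token of
      \<open>k\<close> digits, which takes \<open>2 * k + 1\<close> bits.\<close>
    have "length (concat (map code_nat ys)) = (nu I + 1) * (2 * k + 1)"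
      unfolding ys_def list.map concat.simps length_append length_code_to_bits length_code_nat length_to_bits
      by simp
    also have "\<dots> \<le> (?n + 1) * (25 * (?n + 1)\<^sup>2)"
      using len(2) by (intro mult_mono) (auto simp: k_def power2_eq_square)
    also have "\<dots> = 25 * (?n + 1) ^ 3" by (simp add: power2_eq_square power3_eq_cube algebra_simps)
    finally show "length (concat (map code_nat ys)) \<le> 25 * (?n + 1) ^ 3" .
  qed
qed

theorem theorem14:
  shows "Bounded_Two_Stage \<in> Sigma3p"
proof -
  \<comment> \<open>25 is the constant from \<open>small_bad_scenario\<close>. For the first
    certificate it is split into 3 for the instance and 22 for the coordinates of \<open>x\<close>,
    whence the 22 below.\<close>
  define p :: "nat poly" where "p = [:25:] * [:1, 1:] ^ 3"
  have p: "poly p n = 25 * (n + 1) ^ 3" for n by (simp add: p_def poly_power)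
  have ver: "verifier [w, X, Y, Z] = verify w (decode_nats X) (decode_nats Y) (decode_nats Z)" for w X Y Z
    by (simp add: verifier_def tok_Cons eval_nat_numeral)
  \<comment> \<open>The bound of the box is written in binary inside \<open>w\<close>, so integral
    coordinates fit into \<open>length w\<close> digits.\<close>
  have int_coord: "\<exists>a. a < 2 ^ length w \<and> r = real a"
    if r: "0 \<le> r" "r \<le> real (bound I)" "r \<in> \<int>" and xs: "matches xs I" "check_code w xs" for r I xs w
  proof -
    obtain z where z: "r = of_int z" using r(3) by (rule Ints_cases)
    have "bound I < 2 ^ length (tok xs 6)" using val_less[of "tok xs 6"] xs(1) by (simp add: matches_def)
    also have "\<dots> \<le> 2 ^ length w" using length_code_tokens(7)[OF xs(2)] by (intro power_increasing) auto
    finally have "bound I < 2 ^ length w" .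
    moreover have "nat z \<le> bound I" using r(2) z by linarith
    ultimately have "nat z < 2 ^ length w" by linarith
    moreover have "r = real (nat z)" using r(1) z by simp
    ultimately show ?thesis by blast
  qed
  have bits_len: "m * (2 * n + 1) \<le> 22 * (n + 1) ^ 3" if "m \<le> n" for m n :: nat
  proof -
    have "m * (2 * n + 1) \<le> (n + 1) * (2 * (n + 1))" using that by (intro mult_mono) auto
    also have "\<dots> \<le> (n + 1) * (2 * (n + 1)) * (n + 1)" by simp
    also have "\<dots> = 2 * (n + 1) ^ 3" by (simp add: power3_eq_cube algebra_simps)
    finally show ?thesis by simp
  qed
  have "w \<in> Bounded_Two_Stage \<longleftrightarrow> (\<exists>X. length X \<le> poly p (length w) \<and> (\<forall>Y. length Y \<le> poly p (length w) \<longrightarrow>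
      (\<exists>Z. length Z \<le> poly p (length w) \<and> verifier [w, X, Y, Z])))" (is "_ \<longleftrightarrow> ?r") for w
  proof
    let ?n = "length w"
    assume "w \<in> Bounded_Two_Stage"
    then obtain I where I: "wf_two_stage I" "w \<in> two_stage_codes I" "bounded_two_stage I"
      unfolding Bounded_Two_Stage_def by blast
    then obtain x where x: "x \<in> X_d I" "\<And>u. u \<in> U_c I x \<Longrightarrow> \<exists>y. y \<in> Y_d I x u"
      unfolding bounded_two_stage_def by blast
    have xc: "x \<in> carrier_vec (nx I)" using x(1) by (simp add: X_d_def box_def)
    obtain ts where ts: "\<And>cs. check_code w (ts @ cs) \<and> matches (ts @ cs) I" "\<And>cs j. x_coord (ts @ cs) j = tok cs j"
        "length (concat (map code_nat ts)) \<le> 3 * ?n"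
      using codes_tokens[OF I(1,2)] by blast
    note len = length_code_tokens[OF conjunct1[OF ts(1)]]
    have dims: "nx I \<le> ?n" "ny I \<le> ?n" using len(1,3) ts(1) by (auto simp: matches_def)
    have "\<forall>j\<in>{..<nx I}. \<exists>a. a < 2 ^ ?n \<and> x $ j = real a"
      using X_d_iff[OF I(1) xc] x(1) int_coord ts(1) by (metis lessThan_iff)
    from bchoice[OF this] obtain a where a: "\<And>j. j < nx I \<Longrightarrow> a j < 2 ^ ?n \<and> x $ j = real (a j)" by blast
    define xs where "xs = ts @ map (\<lambda>j. to_bits ?n (a j)) [0..<nx I]"
    have xs: "check_code w xs" "matches xs I" using ts(1) by (auto simp: xs_def)
    have xv: "x_vec I xs = x"
      using xc a by (intro eq_vecI) (auto simp: x_vec_def xs_def ts(2) tok_map_upt val_to_bits)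
    show ?r
    proof (rule exI[of _ "concat (map code_nat xs)"], intro conjI allI impI)
      have "length (concat (map code_nat xs)) \<le> 3 * ?n + nx I * (2 * ?n + 1)"
        using ts(3) length_code_to_bits[of ?n a "nx I"] unfolding xs_def by simp
      also have "\<dots> \<le> 3 * (?n + 1) ^ 3 + 22 * (?n + 1) ^ 3"
        using bits_len[OF dims(1)] self_le_power[of "?n + 1" 3] by (intro add_mono) auto
      finally show "length (concat (map code_nat xs)) \<le> poly p ?n" by (simp add: p)
      fix Y
      show "\<exists>Z. length Z \<le> poly p ?n \<and> verifier [w, concat (map code_nat xs), Y, Z]"
      proof (cases "list_all Not (tok (decode_nats Y) 0) \<or> \<not> check_U xs (decode_nats Y)")
        case True
        \<comment> \<open>No counterexample was offered, so any \<open>Z\<close> will do.\<close>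
        then show ?thesis
          using xs check_X_iff[OF xs(2)] xv x(1) unfolding ver decode_nats verify_def
          by (intro exI[of _ "[]"]) auto
      next
        case False
        then have q: "val (tok (decode_nats Y) 0) > 0" by (simp add: val_eq_0[symmetric])
        then have "u_vec I (decode_nats Y) \<in> U_c I x" using False check_U_iff[OF xs(2)] xv by simp
        \<comment> \<open>The decoded scenario is one of the real scenarios, so this direction needs
          no bound on the size of \<open>u\<close>.\<close>
        then obtain y where y: "y \<in> Y_d I x (u_vec I (decode_nats Y))" using x(2) by blast
        have yc: "y \<in> carrier_vec (ny I)" using y by (simp add: Y_d_def box_def)
        have "\<forall>j\<in>{..<ny I}. \<exists>a. a < 2 ^ ?n \<and> y $ j = real a"
          using Y_d_iff[OF I(1) xc yc] y int_coord xs by (metis lessThan_iff)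
        from bchoice[OF this] obtain b where b: "\<And>j. j < ny I \<Longrightarrow> b j < 2 ^ ?n \<and> y $ j = real (b j)" by blast
        define zs where "zs = map (\<lambda>j. to_bits ?n (b j)) [0..<ny I]"
        have yv: "y_vec I zs = y"
          using yc b by (intro eq_vecI) (auto simp: y_vec_def zs_def tok_map_upt val_to_bits)
        show ?thesis
        proof (intro exI[of _ "concat (map code_nat zs)"] conjI)
          have "length (concat (map code_nat zs)) = ny I * (2 * ?n + 1)"
            unfolding zs_def by (rule length_code_to_bits)
          then show "length (concat (map code_nat zs)) \<le> poly p ?n"
            using bits_len[OF dims(2)] by (simp add: p)
          show "verifier [w, concat (map code_nat xs), Y, concat (map code_nat zs)]"
            using xs check_X_iff[OF xs(2)] check_Y_iff[OF xs(2) q, of zs] xv yv y x(1)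
            by (simp add: ver decode_nats verify_def)
        qed
      qed
    qed
  next
    assume ?r
    then obtain X where X: "\<And>Y. length Y \<le> poly p (length w) \<Longrightarrow>
      \<exists>Z. verify w (decode_nats X) (decode_nats Y) (decode_nats Z)" unfolding ver by blast
    define xs where "xs = decode_nats X"
    \<comment> \<open>Both conditions concern the first certificate only, so any admissible
      \<open>Y\<close> reveals them, in particular the empty one.\<close>
    have xs: "check_code w xs" "check_X xs" using X[of "[]"] by (auto simp: verify_def xs_def)
    obtain I where I: "w \<in> two_stage_codes I" "matches xs I" using check_code_matches[OF xs(1)] by blast
    have xd: "x_vec I xs \<in> X_d I" using xs(2) check_X_iff[OF I(2)] by simp
    have "\<exists>y. y \<in> Y_d I (x_vec I xs) u" if "u \<in> U_c I (x_vec I xs)" for u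
    proof (rule ccontr)
      \<comment> \<open>A real counterexample yields a short rational one, whose code is among the
        admissible \<open>Y\<close>.\<close>
      assume "\<nexists>y. y \<in> Y_d I (x_vec I xs) u"
      then obtain ys where ys: "val (tok ys 0) > 0" "u_vec I ys \<in> U_c I (x_vec I xs)"
          "\<And>y. y \<notin> Y_d I (x_vec I xs) (u_vec I ys)" "length (concat (map code_nat ys)) \<le> 25 * (length w + 1) ^ 3"
        using small_bad_scenario[OF xs(1) I(2) xd \<open>u \<in> U_c I (x_vec I xs)\<close>] by blast
      obtain Z where "verify w xs ys (decode_nats Z)"
        using X[of "concat (map code_nat ys)"] ys(4) by (auto simp: p decode_nats xs_def)
      then have "check_Y xs ys (decode_nats Z)"
        using ys(1,2) check_U_iff[OF I(2) ys(1)] by (auto simp: verify_def val_eq_0[symmetric])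
      then show False using check_Y_iff[OF I(2) ys(1)] ys(3) by blast
    qed
    then have "bounded_two_stage I" unfolding bounded_two_stage_def using xd by blast
    then show "w \<in> Bounded_Two_Stage"
      unfolding Bounded_Two_Stage_def using I by (auto simp: matches_def)
  qed
  then show ?thesis unfolding Sigma3p_def using poly_time_decidable_verifier by blast
qed

end
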